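(* Let $G=AB$ be a finite group which is a weak normal product of $w$-supersoluble subgroups $A$ and $B$, with $A$ normal in $G$. If the derived subgroup $G'$ is nilpotent, then $G$ is $w$-supersoluble.
   Context: All groups are finite. Two subgroups $X,Y$ of a group permute if $XY=YX$. Let $G=AB$ be a product of subgroups $A$ and $B$. $G$ is a weak normal product of $A$ and $B$ if (a) $A$ is normal in $G$, and (b) $B$ permutes with every maximal subgroup of every Sylow subgroup of $A$ (for all primes). A subgroup $H$ of a group $G$ is $\mathbb{P}$-subnormal in $G$ if either $H=G$ or there is a chain of subgroups $H=H_0\leqslant H_1\leqslant\cdots\leqslant H_n=G$ such that $|H_i:H_{i-1}|$ is a prime for every $i=1,\dots,n$. A group is $w$-supersoluble if every Sylow subgroup of it is $\mathbb{P}$-subnormal in it. *)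

theory Defs
  imports "HOL-Algebra.Generated_Groups" "HOL-Algebra.Sylow"
begin

text \<open>
  Subgroups are subsets of the carrier of an ambient group record.  A property of groups is applied
  to a subgroup \<open>H\<close> of \<open>G\<close> by passing the record \<open>G\<lparr>carrier := H\<rparr>\<close>.
\<close>

definition sylow_subgroup :: "nat \<Rightarrow> 'a set \<Rightarrow> ('a, 'b) monoid_scheme \<Rightarrow> bool" where
  "sylow_subgroup p P G \<longleftrightarrow> subgroup P G \<and> card P = p ^ multiplicity p (order G)"

definition maximal_subgroup :: "'a set \<Rightarrow> ('a, 'b) monoid_scheme \<Rightarrow> bool" where
  "maximal_subgroup M G \<longleftrightarrow>
     subgroup M G \<and> M \<noteq> carrier G \<and>
     (\<forall>K. subgroup K G \<and> M \<subseteq> K \<longrightarrow> K = M \<or> K = carrier G)"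

definition permute :: "('a, 'b) monoid_scheme \<Rightarrow> 'a set \<Rightarrow> 'a set \<Rightarrow> bool" where
  "permute G H K \<longleftrightarrow> H <#>\<^bsub>G\<^esub> K = K <#>\<^bsub>G\<^esub> H"

definition weak_normal_product :: "('a, 'b) monoid_scheme \<Rightarrow> 'a set \<Rightarrow> 'a set \<Rightarrow> bool" where
  "weak_normal_product G A B \<longleftrightarrow>
     subgroup A G \<and> subgroup B G \<and> A <#>\<^bsub>G\<^esub> B = carrier G \<and>
     A \<lhd> G \<and>
     (\<forall>p P M. prime p \<and> sylow_subgroup p P (G\<lparr>carrier := A\<rparr>) \<and>
        maximal_subgroup M (G\<lparr>carrier := P\<rparr>) \<longrightarrow> permute G B M)"

definition subgroup_index :: "('a, 'b) monoid_scheme \<Rightarrow> 'a set \<Rightarrow> nat" where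
  "subgroup_index G H = card (rcosets\<^bsub>G\<^esub> H)"

definition P_subnormal :: "'a set \<Rightarrow> ('a, 'b) monoid_scheme \<Rightarrow> bool" where
  "P_subnormal H G \<longleftrightarrow>
     subgroup H G \<and>
     (H = carrier G \<or>
      (\<exists>(n :: nat) C. C 0 = H \<and> C n = carrier G \<and>
         (\<forall>i\<le>n. subgroup (C i) G) \<and>
         (\<forall>i\<in>{1..n}. C (i - 1) \<subseteq> C i \<and>
            prime (subgroup_index (G\<lparr>carrier := C i\<rparr>) (C (i - 1))))))"

text \<open>
  For a prime not dividing the order of \<open>G\<close> the Sylow subgroup is trivial; including these primes
  imposes no extra condition, because in a nontrivial Sylow subgroup the trivial subgroup is the
  bottom of a chain with prime indices.
\<close>

definition w_supersoluble :: "('a, 'b) monoid_scheme \<Rightarrow> bool" where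
  "w_supersoluble G \<longleftrightarrow>
     (\<forall>p P. prime p \<and> sylow_subgroup p P G \<longrightarrow> P_subnormal P G)"

definition commutator_subgroup :: "('a, 'b) monoid_scheme \<Rightarrow> 'a set \<Rightarrow> 'a set \<Rightarrow> 'a set" where
  "commutator_subgroup G H K =
     generate G (\<Union>h\<in>H. \<Union>k\<in>K. {h \<otimes>\<^bsub>G\<^esub> k \<otimes>\<^bsub>G\<^esub> inv\<^bsub>G\<^esub> h \<otimes>\<^bsub>G\<^esub> inv\<^bsub>G\<^esub> k})"

text \<open>Nilpotency is the termination of the lower central series.\<close>

definition nilpotent_group :: "('a, 'b) monoid_scheme \<Rightarrow> bool" where
  "nilpotent_group G \<longleftrightarrow>
     (\<exists>n. ((\<lambda>H. commutator_subgroup G H (carrier G)) ^^ n) (carrier G) = {\<one>\<^bsub>G\<^esub>})"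

end

theory Submission
  imports Defs "HOL-Algebra.Multiplicative_Group" "HOL-Algebra.Zassenhaus"
    "HOL-Number_Theory.Residue_Primitive_Roots"
begin

text \<open>
  Write \<open>N\<close> for the derived subgroup and \<open>N_q\<close> for the set of its \<open>q\<close>-elements, which is the Sylow
  \<open>q\<close>-subgroup of \<open>N\<close> and normal in \<open>G\<close>.  Everything is reduced to one condition on elements: for distinct
  primes \<open>p\<close>, \<open>q\<close> and every \<open>p\<close>-element \<open>g\<close> of \<open>G\<close>, the power \<open>g^(q-1)\<close> centralizes \<open>N_q\<close>.

  The condition holds for \<open>p\<close>-elements of a Sylow subgroup of \<open>A\<close>.  A chain with prime indices from this
  Sylow subgroup to \<open>A\<close> cuts the \<open>q\<close>-group \<open>A \<inter> N_q\<close> into factors of order \<open>1\<close> or \<open>q\<close>.  By Fermat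
  \<open>g^(q-1)\<close> acts trivially on each factor, and since its order is prime to \<open>q\<close> it acts trivially on the whole
  (\<open>sylow_chain_centralizes\<close>).  It also stabilizes \<open>A \<inter> N_q \<le> N_q\<close>, because \<open>A\<close> is normal.

  It holds for \<open>p\<close>-elements of a Sylow subgroup of \<open>B\<close>.  The same argument in \<open>G/A\<close> shows that \<open>g^(q-1)\<close>
  is trivial on \<open>N_q/(A \<inter> N_q)\<close>.  On \<open>A \<inter> N_q\<close> the permutability is used: modulo the largest
  \<open>q'\<close>-subgroup of \<open>A\<close> that is normal in \<open>G\<close>, a Sylow \<open>q\<close>-subgroup \<open>Q\<close> of \<open>A\<close> becomes normal.  Now
  \<open>h = g^(q-1)\<close> centralizes \<open>B \<inter> Q\<close>, again by the chain argument.  If the centralizer of \<open>h\<close> in \<open>Q\<close> were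
  proper, a maximal subgroup \<open>M\<close> of \<open>Q\<close> above it would contain \<open>B \<inter> Q\<close>, so \<open>B M = M B\<close> would force \<open>g\<close> to
  normalize \<open>M\<close>; then \<open>h\<close> is trivial on \<open>Q/M\<close> and, by counting, fixes a point of every coset of \<open>M\<close>,
  also of one outside \<open>M\<close> (\<open>permutable_maximal_centralizes\<close>).

  It passes to all \<open>p\<close>-elements of \<open>G = A B\<close>, because \<open>g \<mapsto> g^(q-1)\<close> induces a homomorphism into the abelian
  quotient of \<open>G\<close> by \<open>C N_q\<close>, where \<open>C\<close> is the centralizer of \<open>N_q\<close> (\<open>product_centralizes\<close>).

  Finally the condition yields the required chain from a Sylow \<open>p\<close>-subgroup \<open>P\<close> to \<open>G\<close>.  Above \<open>N P\<close> all
  subgroups are normal with abelian quotients, so prime steps exist (\<open>chain_above_N\<close>).  A subgroup \<open>H\<close>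
  with \<open>P \<le> H < N P\<close> meets some \<open>N_q\<close>, \<open>q \<noteq> p\<close>, in a proper subgroup \<open>D\<close>.  On the normalizer
  of \<open>D\<close> in \<open>N_q\<close>, taken modulo \<open>D\<close>, the group \<open>P\<close> acts through commuting operators whose \<open>(q-1)\<close>-st power is
  the identity.  The polynomial \<open>X^(q-1) - 1\<close> splits over the field with \<open>q\<close> elements, so the operators have a
  common eigenvector, and this gives a subgroup \<open>E\<close> with \<open>card E = q * card D\<close> for which \<open>E H\<close> is the next
  member of the chain (\<open>prime_step_within_product\<close>).
\<close>

section \<open>Counting in finite groups\<close>

locale fin_group = group +
  assumes fin [simp]: "finite (carrier G)"

lemma (in group) inv_mult_cancel: "x \<in> carrier G \<Longrightarrow> y \<in> carrier G \<Longrightarrow> inv x \<otimes> (x \<otimes> y) = y"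
  by (simp add: m_assoc[symmetric])

lemma (in group) mult_inv_cancel: "x \<in> carrier G \<Longrightarrow> y \<in> carrier G \<Longrightarrow> x \<otimes> (inv x \<otimes> y) = y"
  by (simp add: m_assoc[symmetric])

lemmas (in group) group_cancel = m_assoc inv_mult_group inv_mult_cancel mult_inv_cancel

context fin_group
begin

lemma finite_sub: "subgroup H G \<Longrightarrow> finite H"
  using finite_subset[OF subgroup.subset fin] .

lemma card_sub_pos: "subgroup H G \<Longrightarrow> 0 < card H"
  using finite_sub[of H] subgroup.one_closed[of H G] by (auto simp: card_gt_0_iff)

lemma fin_group_sub: "subgroup H G \<Longrightarrow> fin_group (G\<lparr>carrier := H\<rparr>)"
  by (simp add: fin_group_def fin_group_axioms_def subgroup_imp_group finite_sub)

lemma fin_group_Mod: "N \<lhd> G \<Longrightarrow> fin_group (G Mod N)"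
  by (simp add: fin_group_def fin_group_axioms_def normal.factorgroup_is_group carrier_FactGroup)

lemma subgroup_in_sub_iff:
  "subgroup K G \<Longrightarrow> subgroup H (G\<lparr>carrier := K\<rparr>) \<longleftrightarrow> subgroup H G \<and> H \<subseteq> K"
  using incl_subgroup[of K H] subgroup_incl[of H K] subgroup.subset[of H "G\<lparr>carrier := K\<rparr>"] by auto

lemma pow_card_sub: assumes "subgroup H G" "x \<in> H" shows "x [^] card H = \<one>"
proof -
  interpret H: group "G\<lparr>carrier := H\<rparr>" using assms subgroup_imp_group by auto
  have "x [^]\<^bsub>G\<lparr>carrier := H\<rparr>\<^esub> order (G\<lparr>carrier := H\<rparr>) = \<one>\<^bsub>G\<lparr>carrier := H\<rparr>\<^esub>"
    by (rule H.pow_order_eq_1) (simp add: assms)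
  thus ?thesis by (simp add: order_def nat_pow_consistent[symmetric])
qed

lemma sub_pow_closed: "subgroup H G \<Longrightarrow> x \<in> H \<Longrightarrow> x [^] (n::nat) \<in> H"
  by (induction n) (auto intro: subgroup.one_closed subgroup.m_closed)

lemma card_sub_mono_dvd: assumes "subgroup H G" "subgroup K G" "H \<subseteq> K" shows "card H dvd card K"
proof -
  interpret K: group "G\<lparr>carrier := K\<rparr>" using assms subgroup_imp_group by auto
  have "subgroup H (G\<lparr>carrier := K\<rparr>)" using assms subgroup_in_sub_iff by auto
  from K.lagrange[OF this] have "card (rcosets\<^bsub>G\<lparr>carrier := K\<rparr>\<^esub> H) * card H = card K" by (simp add: order_def)
  thus ?thesis by (metis dvd_triv_right)
qed

text \<open>
  By Bezout the element itself is a product of powers of the two given powers.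
\<close>
lemma pow_coprime_mem:
  assumes "subgroup K G" "x \<in> carrier G" "x [^] (m::nat) \<in> K" "x [^] (n::nat) \<in> K" "coprime m n"
  shows "x \<in> K"
proof -
  have "gcd (int m) (int n) = 1" using assms(5) by simp
  then obtain a b where ab: "a * int m + b * int n = 1"
    using bezout_int[of "int m" "int n"] by auto
  have eq: "x [^] (int m * a + int n * b) = (x [^] m) [^] a \<otimes> (x [^] n) [^] b"
    using assms(2) by (simp only: int_pow_mult int_pow_pow[symmetric] int_pow_int)
  have "int m * a + int n * b = 1" using ab by (simp add: mult.commute)
  hence "x = (x [^] m) [^] a \<otimes> (x [^] n) [^] b" using eq assms(2) by simp
  moreover have "(x [^] m) [^] a \<in> K" "(x [^] n) [^] b \<in> K"
    using assms(3,4) by (auto intro: subgroup_int_pow_closed[OF assms(1)])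
  ultimately show ?thesis using subgroup.m_closed[OF assms(1), of "(x [^] m) [^] a" "(x [^] n) [^] b"] by simp
qed

end

lemma card_uniform_fibres:
  assumes "finite S" "\<And>y. y \<in> f ` S \<Longrightarrow> card {x \<in> S. f x = y} = c"
  shows "card S = card (f ` S) * c"
proof -
  have "card S = (\<Sum>x\<in>S. 1)" by simp
  also have "\<dots> = (\<Sum>y\<in>f ` S. \<Sum>x\<in>{x \<in> S. f x = y}. 1)" by (rule sum.image_gen[OF assms(1)])
  also have "\<dots> = (\<Sum>y\<in>f ` S. c)" by (rule sum.cong) (auto simp: assms(2))
  finally show ?thesis by simp
qed

context fin_group
begin

lemma card_coset: assumes "x \<in> carrier G" "M \<subseteq> carrier G" shows "card (x <#\<^bsub>G\<^esub> M) = card M"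
proof -
  have "x <#\<^bsub>G\<^esub> M = (\<lambda>m. x \<otimes> m) ` M" by (auto simp: l_coset_def)
  moreover have "inj_on (\<lambda>m. x \<otimes> m) M" using assms by (auto intro!: inj_onI simp: subset_iff)
  ultimately show ?thesis by (simp add: card_image)
qed

lemma card_hom_image:
  assumes f: "group_hom G K f" and H: "subgroup H G"
  shows "card H = card (f ` H) * card {x \<in> H. f x = \<one>\<^bsub>K\<^esub>}"
proof (rule card_uniform_fibres[OF finite_sub[OF H]])
  interpret f: group_hom G K f by fact
  interpret H: subgroup H G by fact
  fix y assume "y \<in> f ` H"
  then obtain h where h: "h \<in> H" "y = f h" by auto
  have "{x \<in> H. f x = y} = h <# {x \<in> H. f x = \<one>\<^bsub>K\<^esub>}"
  proof (intro equalityI subsetI)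
    fix x assume x: "x \<in> {x \<in> H. f x = y}"
    have "inv h \<otimes> x \<in> {x \<in> H. f x = \<one>\<^bsub>K\<^esub>}" using x h by auto
    moreover have "x = h \<otimes> (inv h \<otimes> x)" using x h by (simp add: m_assoc[symmetric])
    ultimately show "x \<in> h <# {x \<in> H. f x = \<one>\<^bsub>K\<^esub>}" unfolding l_coset_def by blast
  next
    fix x assume "x \<in> h <# {x \<in> H. f x = \<one>\<^bsub>K\<^esub>}"
    then show "x \<in> {x \<in> H. f x = y}" using h by (auto simp: l_coset_def)
  qed
  also have "card \<dots> = card {x \<in> H. f x = \<one>\<^bsub>K\<^esub>}"
    using h by (intro card_coset) auto
  finally show "card {x \<in> H. f x = y} = card {x \<in> H. f x = \<one>\<^bsub>K\<^esub>}" .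
qed

lemma card_set_mult:
  assumes H: "subgroup H G" and K: "subgroup K G"
  shows "card (H <#> K) * card (H \<inter> K) = card H * card K"
proof -
  interpret H: subgroup H G by fact
  interpret K: subgroup K G by fact
  let ?f = "\<lambda>(h, k). h \<otimes> k"
  have "card (H \<times> K) = card (?f ` (H \<times> K)) * card (H \<inter> K)"
  proof (rule card_uniform_fibres)
    show "finite (H \<times> K)" using finite_sub H K by auto
    fix y assume "y \<in> ?f ` (H \<times> K)"
    then obtain h k where hk: "h \<in> H" "k \<in> K" "y = h \<otimes> k" by auto
    have "bij_betw (\<lambda>t. (h \<otimes> t, inv t \<otimes> k)) (H \<inter> K) {x \<in> H \<times> K. ?f x = y}"
    proof (rule bij_betw_byWitness[where f' = "\<lambda>(a, b). inv h \<otimes> a"])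
      show "\<forall>t\<in>H \<inter> K. (case (h \<otimes> t, inv t \<otimes> k) of (a, b) \<Rightarrow> inv h \<otimes> a) = t"
        using hk by (auto simp: m_assoc[symmetric])
      show "\<forall>ab\<in>{x \<in> H \<times> K. ?f x = y}.
          (\<lambda>t. (h \<otimes> t, inv t \<otimes> k)) (case ab of (a, b) \<Rightarrow> inv h \<otimes> a) = ab"
      proof
        fix ab assume "ab \<in> {x \<in> H \<times> K. ?f x = y}"
        then obtain a b where ab': "ab = (a, b)" and ab: "a \<in> H" "b \<in> K" "a \<otimes> b = y" by auto
        have e1: "h \<otimes> (inv h \<otimes> a) = a" using ab hk by (simp add: m_assoc[symmetric])
        have e2: "inv (inv h \<otimes> a) \<otimes> k = inv a \<otimes> (h \<otimes> k)" using ab hk by (simp add: inv_mult_group m_assoc)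
        also have "h \<otimes> k = a \<otimes> b" using ab hk by simp
        also have "inv a \<otimes> (a \<otimes> b) = b" using ab(1,2) by (simp add: group_cancel)
        finally have "inv (inv h \<otimes> a) \<otimes> k = b" .
        thus "(\<lambda>t. (h \<otimes> t, inv t \<otimes> k)) (case ab of (a, b) \<Rightarrow> inv h \<otimes> a) = ab" by (simp add: ab' e1)
      qed
      show "(\<lambda>t. (h \<otimes> t, inv t \<otimes> k)) ` (H \<inter> K) \<subseteq> {x \<in> H \<times> K. ?f x = y}"
      proof
        fix w assume "w \<in> (\<lambda>t. (h \<otimes> t, inv t \<otimes> k)) ` (H \<inter> K)"
        then obtain t where t: "t \<in> H" "t \<in> K" "w = (h \<otimes> t, inv t \<otimes> k)" by auto
        have "h \<otimes> t \<otimes> (inv t \<otimes> k) = y" using t hk by (simp add: group_cancel)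
        thus "w \<in> {x \<in> H \<times> K. ?f x = y}" using t hk by simp
      qed
      show "(\<lambda>(a, b). inv h \<otimes> a) ` {x \<in> H \<times> K. ?f x = y} \<subseteq> H \<inter> K"
      proof
        fix w assume "w \<in> (\<lambda>(a, b). inv h \<otimes> a) ` {x \<in> H \<times> K. ?f x = y}"
        then obtain a b where ab: "a \<in> H" "b \<in> K" "a \<otimes> b = y" and w: "w = inv h \<otimes> a" by auto
        have "inv h \<otimes> a = inv h \<otimes> (a \<otimes> b) \<otimes> inv b" using ab(1,2) hk(1,2) by (simp add: m_assoc)
        also have "a \<otimes> b = h \<otimes> k" using ab hk by simp
        also have "inv h \<otimes> (h \<otimes> k) \<otimes> inv b = k \<otimes> inv b" using ab hk by (simp add: m_assoc[symmetric])
        finally have "w = k \<otimes> inv b" using w by simp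
        moreover have "k \<otimes> inv b \<in> K" "inv h \<otimes> a \<in> H" using ab(1,2) hk(1,2) by simp_all
        ultimately show "w \<in> H \<inter> K" using w by simp
      qed
    qed
    from bij_betw_same_card[OF this] show "card {x \<in> H \<times> K. ?f x = y} = card (H \<inter> K)" by simp
  qed
  moreover have "?f ` (H \<times> K) = H <#> K" by (auto simp: set_mult_def)
  ultimately show ?thesis by (simp add: card_cartesian_product)
qed

lemma Mod_hom: assumes "N \<lhd> G" shows "group_hom G (G Mod N) (\<lambda>x. N #> x)"
  using assms by (simp add: group_hom_def group_hom_axioms_def normal.r_coset_hom_Mod normal.factorgroup_is_group is_group)

lemma Mod_one_iff: assumes "N \<lhd> G" "x \<in> carrier G" shows "N #> x = \<one>\<^bsub>G Mod N\<^esub> \<longleftrightarrow> x \<in> N"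
  using assms by (metis coset_join1 coset_join2 normal_imp_subgroup one_FactGroup subgroup.subset)

lemma card_Mod_image: assumes N: "N \<lhd> G" and H: "subgroup H G"
  shows "card H = card ((\<lambda>x. N #> x) ` H) * card (H \<inter> N)"
proof -
  have "{x \<in> H. N #> x = \<one>\<^bsub>G Mod N\<^esub>} = H \<inter> N" using Mod_one_iff[OF N] subgroup.mem_carrier[OF H] by auto
  thus ?thesis using card_hom_image[OF Mod_hom[OF N] H] by simp
qed

text \<open>
  The carrier of \<open>G Mod N\<close> consists of cosets, so the preimage of a subgroup \<open>E\<close> of the quotient is
  simply its union.
\<close>
lemma Mod_pullback: assumes N: "N \<lhd> G" and E: "subgroup E (G Mod N)"
  shows "subgroup (\<Union>E) G" "N \<subseteq> \<Union>E" "card (\<Union>E) = card E * card N"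
    "\<And>x. x \<in> carrier G \<Longrightarrow> x \<in> \<Union>E \<longleftrightarrow> N #> x \<in> E"
proof -
  interpret N: normal N G by fact
  show sub: "subgroup (\<Union>E) G" by (rule N.factgroup_subgroup_union_subgroup[OF E])
  show mem: "\<And>x. x \<in> carrier G \<Longrightarrow> x \<in> \<Union>E \<longleftrightarrow> N #> x \<in> E"
    using N.factgroup_subgroup_union_char[OF E] by auto
  show NE: "N \<subseteq> \<Union>E" using subgroup.one_closed[OF E] by auto
  have "(\<lambda>x. N #> x) ` \<Union>E = E"
  proof (intro equalityI subsetI)
    fix e assume "e \<in> E"
    moreover from this have "e \<in> carrier (G Mod N)" using subgroup.subset[OF E] by auto
    ultimately show "e \<in> (\<lambda>x. N #> x) ` \<Union>E" unfolding carrier_FactGroup using mem by blast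
  next
    fix e assume "e \<in> (\<lambda>x. N #> x) ` \<Union>E"
    thus "e \<in> E" using mem subgroup.mem_carrier[OF sub] by blast
  qed
  moreover have "\<Union>E \<inter> N = N" using NE by auto
  ultimately show "card (\<Union>E) = card E * card N" using card_Mod_image[OF N sub] by simp
qed

text \<open>
  The image of \<open>H\<close> in \<open>G Mod K\<close> has order \<open>card H / card (H \<inter> K)\<close>, which divides \<open>m\<close>.
\<close>
lemma power_index_in_normal:
  assumes K: "K \<lhd> G" and H: "subgroup H G" and S: "subgroup S G" "S \<subseteq> H \<inter> K"
    and m: "card H = card S * m" and x: "x \<in> H"
  shows "x [^] m \<in> K"
proof -
  let ?f = "\<lambda>x. K #> x"
  interpret Q: fin_group "G Mod K" by (rule fin_group_Mod[OF K])
  interpret f: group_hom G "G Mod K" ?f by (rule Mod_hom[OF K])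
  have xc: "x \<in> carrier G" by (rule subgroup.mem_carrier[OF H x])
  have img: "subgroup (?f ` H) (G Mod K)" by (rule f.subgroup_img_is_subgroup[OF H])
  have HK: "subgroup (H \<inter> K) G" by (rule subgroups_Inter_pair[OF H normal_imp_subgroup[OF K]])
  obtain c where c: "card (H \<inter> K) = card S * c" using card_sub_mono_dvd[OF S(1) HK S(2)] by (auto elim: dvdE)
  have "card S * m = card S * (c * card (?f ` H))"
    using card_Mod_image[OF K H] m c by (simp add: ac_simps)
  hence mc: "m = card (?f ` H) * c" using card_sub_pos[OF S(1)] by simp
  have "?f x [^]\<^bsub>G Mod K\<^esub> card (?f ` H) = \<one>\<^bsub>G Mod K\<^esub>" by (rule Q.pow_card_sub[OF img]) (simp add: x)
  hence "?f x [^]\<^bsub>G Mod K\<^esub> m = \<one>\<^bsub>G Mod K\<^esub>"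
    unfolding mc using xc Q.nat_pow_one[of c] by (simp add: Q.nat_pow_pow[symmetric])
  hence "?f (x [^] m) = \<one>\<^bsub>G Mod K\<^esub>" using xc by (simp add: f.hom_nat_pow)
  thus ?thesis using Mod_one_iff[OF K] xc by blast
qed

lemma sylow_exists: assumes "prime p" "subgroup H G"
  obtains S where "subgroup S G" "S \<subseteq> H" "card S = p ^ multiplicity p (card H)"
proof -
  interpret H: fin_group "G\<lparr>carrier := H\<rparr>" using assms fin_group_sub by auto
  have "p ^ multiplicity p (card H) dvd card H" by (rule multiplicity_dvd)
  then obtain m where "order (G\<lparr>carrier := H\<rparr>) = p ^ multiplicity p (card H) * m" by (auto simp: order_def elim: dvdE)
  from sylow_thm[OF assms(1) H.is_group this H.fin] obtain S
    where S: "subgroup S (G\<lparr>carrier := H\<rparr>)" "card S = p ^ multiplicity p (card H)" by blast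
  have "subgroup S G" "S \<subseteq> H" using S(1) subgroup_in_sub_iff[OF assms(2)] by auto
  thus thesis using that S(2) by blast
qed

text \<open>
  The order of \<open>H\<close> is divisible by every prime power that occurs in the order of \<open>K\<close>.
\<close>
lemma eq_if_sylow_subgroups:
  assumes H: "subgroup H G" and K: "subgroup K G" and HK: "H \<subseteq> K"
    and syl: "\<And>r. prime r \<Longrightarrow> \<exists>S. subgroup S G \<and> S \<subseteq> H \<and> card S = r ^ multiplicity r (card K)"
  shows "H = K"
proof -
  have "card K dvd card H"
  proof (rule multiplicity_le_imp_dvd)
    show "card K \<noteq> 0" using card_sub_pos[OF K] by simp
    fix r :: nat assume r: "prime r"
    obtain S where S: "subgroup S G" "S \<subseteq> H" "card S = r ^ multiplicity r (card K)"
      using syl[OF r] by auto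
    hence "r ^ multiplicity r (card K) dvd card H" using card_sub_mono_dvd[OF S(1) H] by simp
    thus "multiplicity r (card K) \<le> multiplicity r (card H)"
      using r card_sub_pos[OF H] by (intro multiplicity_geI) (auto simp: prime_gt_1_nat)
  qed
  hence "card K \<le> card H" using card_sub_pos[OF H] by (rule dvd_imp_le)
  thus ?thesis using HK finite_sub[OF K] by (metis card_seteq)
qed

lemma subset_if_prime_power_elements:
  assumes H: "subgroup H G" and K: "subgroup K G"
    and pe: "\<And>r x j. prime r \<Longrightarrow> x \<in> K \<Longrightarrow> x [^] (r ^ j :: nat) = \<one> \<Longrightarrow> x \<in> H"
  shows "K \<subseteq> H"
proof -
  have "K \<inter> H = K"
  proof (rule eq_if_sylow_subgroups[OF subgroups_Inter_pair[OF K H] K Int_lower1])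
    fix r :: nat assume r: "prime r"
    obtain S where S: "subgroup S G" "S \<subseteq> K" "card S = r ^ multiplicity r (card K)"
      by (rule sylow_exists[OF r K])
    have "S \<subseteq> H" using pow_card_sub[OF S(1)] S pe[OF r] by auto
    thus "\<exists>S. subgroup S G \<and> S \<subseteq> K \<inter> H \<and> card S = r ^ multiplicity r (card K)" using S by auto
  qed
  thus ?thesis by (simp add: Int_absorb2 inf.absorb_iff1)
qed

end

section \<open>Fixed points of p-groups and growth of normalizers\<close>

text \<open>
  The set of points that are not fixed is a union of orbits, and each of them has as length a nontrivial
  power of \<open>p\<close>.  The action is given by a plain function, without the extensionality that \<open>group_action\<close>
  demands.
\<close>
lemma p_group_fixed_points:
  assumes P: "group P" "card (carrier P) = p ^ k" and p: "prime (p::nat)" and E: "finite E"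
    and closed: "\<And>g x. g \<in> carrier P \<Longrightarrow> x \<in> E \<Longrightarrow> f g x \<in> E"
    and one: "\<And>x. x \<in> E \<Longrightarrow> f \<one>\<^bsub>P\<^esub> x = x"
    and mult: "\<And>g h x. g \<in> carrier P \<Longrightarrow> h \<in> carrier P \<Longrightarrow> x \<in> E \<Longrightarrow> f (g \<otimes>\<^bsub>P\<^esub> h) x = f g (f h x)"
  shows "p dvd card (E - {x \<in> E. \<forall>g\<in>carrier P. f g x = x})"
proof -
  interpret P: group P by fact
  define D where "D = E - {x \<in> E. \<forall>g\<in>carrier P. f g x = x}"
  have fD: "finite D" using E by (simp add: D_def)
  have inv1: "f (inv\<^bsub>P\<^esub> g) (f g x) = x" if "g \<in> carrier P" "x \<in> E" for g x
    using mult[of "inv\<^bsub>P\<^esub> g" g x] that one by simp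
  have DE: "D \<subseteq> E" by (auto simp: D_def)
  have closedD: "f g x \<in> D" if g: "g \<in> carrier P" and x: "x \<in> D" for g x
  proof -
    have xE: "x \<in> E" using x DE by auto
    obtain h where h: "h \<in> carrier P" "f h x \<noteq> x" using x by (auto simp: D_def)
    have "f (g \<otimes>\<^bsub>P\<^esub> h \<otimes>\<^bsub>P\<^esub> inv\<^bsub>P\<^esub> g) (f g x) \<noteq> f g x"
    proof
      assume "f (g \<otimes>\<^bsub>P\<^esub> h \<otimes>\<^bsub>P\<^esub> inv\<^bsub>P\<^esub> g) (f g x) = f g x"
      hence "f g (f h x) = f g x" using mult closed g h(1) xE inv1 by (simp add: P.m_assoc)
      hence "f (inv\<^bsub>P\<^esub> g) (f g (f h x)) = f (inv\<^bsub>P\<^esub> g) (f g x)" by simp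
      thus False using inv1 g h xE closed by simp
    qed
    moreover have "g \<otimes>\<^bsub>P\<^esub> h \<otimes>\<^bsub>P\<^esub> inv\<^bsub>P\<^esub> g \<in> carrier P" using g h by simp
    ultimately show ?thesis using closed[OF g xE] unfolding D_def by blast
  qed
  let ?\<phi> = "\<lambda>g. restrict (f g) D"
  have bij: "?\<phi> g \<in> Bij D" if g: "g \<in> carrier P" for g
  proof -
    have "bij_betw (?\<phi> g) D D"
    proof (rule bij_betw_byWitness[where f' = "f (inv\<^bsub>P\<^esub> g)"])
      show "\<forall>x\<in>D. f (inv\<^bsub>P\<^esub> g) (?\<phi> g x) = x" using inv1 g DE by auto
      show "\<forall>x\<in>D. ?\<phi> g (f (inv\<^bsub>P\<^esub> g) x) = x"
        using inv1[of "inv\<^bsub>P\<^esub> g"] g DE closedD[of "inv\<^bsub>P\<^esub> g"] by auto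
      show "?\<phi> g ` D \<subseteq> D" using closedD g by auto
      show "f (inv\<^bsub>P\<^esub> g) ` D \<subseteq> D" using closedD[of "inv\<^bsub>P\<^esub> g"] g by auto
    qed
    thus ?thesis by (simp add: Bij_def)
  qed
  have "?\<phi> (g \<otimes>\<^bsub>P\<^esub> h) = compose D (?\<phi> g) (?\<phi> h)" if "g \<in> carrier P" "h \<in> carrier P" for g h
    using that closedD DE mult by (fastforce simp: compose_def restrict_def)
  hence "?\<phi> \<in> hom P (BijGroup D)"
    using bij by (auto simp: hom_def BijGroup_def)
  then interpret act: group_action P D ?\<phi>
    by (simp add: group_action_def group_hom_def group_hom_axioms_def P.is_group group_BijGroup)
  have "p dvd card orb" if orb: "orb \<in> orbits P D ?\<phi>" for orb
  proof -
    obtain x where x: "x \<in> D" "orb = orbit P ?\<phi> x" using orb by (auto simp: orbits_def)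
    have "card orb dvd p ^ k"
      using act.orbit_stabilizer_theorem[OF x(1)] x(2) P(2) by (metis (lifting) dvd_triv_left order_def)
    then obtain j where j: "card orb = p ^ j" using p by (auto simp: divides_primepow_nat)
    have xo: "x \<in> orb" using act.orbit_refl x by simp
    obtain g where g: "g \<in> carrier P" "f g x \<noteq> x" using x(1) by (auto simp: D_def)
    have "f g x \<in> orb" using g x by (auto simp: orbit_def)
    hence "card orb \<noteq> 1" using xo g(2) by (metis card_1_singletonE singletonD)
    hence "j \<noteq> 0" using j by (cases j) auto
    thus ?thesis using j by simp
  qed
  moreover have "card D = (\<Sum>orb\<in>orbits P D ?\<phi>. card orb)"
    using act.disjoint_sum[OF fD, of "\<lambda>_. 1::nat"] by simp
  ultimately show ?thesis unfolding D_def[symmetric] by (simp add: dvd_sum)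
qed

context group
begin

text \<open>
  Only one inclusion is demanded; for finite \<open>Y\<close> this is the usual normalizer.
\<close>
definition conj_normalizer :: "'a set \<Rightarrow> 'a set" where
  "conj_normalizer Y = {x \<in> carrier G. \<forall>y\<in>Y. x \<otimes> y \<otimes> inv x \<in> Y}"

lemma conj_normalizerD: "x \<in> conj_normalizer Y \<Longrightarrow> x \<in> carrier G"
    "x \<in> conj_normalizer Y \<Longrightarrow> y \<in> Y \<Longrightarrow> x \<otimes> y \<otimes> inv x \<in> Y"
  by (auto simp: conj_normalizer_def)

lemma conj_mult: "x \<in> carrier G \<Longrightarrow> y \<in> carrier G \<Longrightarrow> g \<in> carrier G \<Longrightarrow>
    g \<otimes> (x \<otimes> y) \<otimes> inv g = (g \<otimes> x \<otimes> inv g) \<otimes> (g \<otimes> y \<otimes> inv g)"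
  by (simp add: group_cancel)

lemma conj_pow: "x \<in> carrier G \<Longrightarrow> g \<in> carrier G \<Longrightarrow>
    g \<otimes> (x [^] (n::nat)) \<otimes> inv g = (g \<otimes> x \<otimes> inv g) [^] n"
proof (induction n)
  case (Suc n)
  thus ?case using conj_mult[of "x [^] n" x g] by simp
qed simp

lemma conj_conj: "x \<in> carrier G \<Longrightarrow> g \<in> carrier G \<Longrightarrow> h \<in> carrier G \<Longrightarrow>
    (g \<otimes> h) \<otimes> x \<otimes> inv (g \<otimes> h) = g \<otimes> (h \<otimes> x \<otimes> inv h) \<otimes> inv g"
  by (simp add: group_cancel)

end

context fin_group
begin

lemma conj_normalizer_subgroup: assumes Y: "subgroup Y G" shows "subgroup (conj_normalizer Y) G"
proof (rule subgroupI)
  interpret Y: subgroup Y G by fact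
  show "conj_normalizer Y \<subseteq> carrier G" by (auto simp: conj_normalizer_def)
  have "\<one> \<in> conj_normalizer Y" by (simp add: conj_normalizer_def)
  thus "conj_normalizer Y \<noteq> {}" by (metis empty_iff)
  fix x assume x: "x \<in> conj_normalizer Y"
  hence xc: "x \<in> carrier G" by (rule conj_normalizerD)
  have "(\<lambda>y. x \<otimes> y \<otimes> inv x) ` Y = Y"
  proof (rule endo_inj_surj[OF finite_sub[OF Y]])
    show "(\<lambda>y. x \<otimes> y \<otimes> inv x) ` Y \<subseteq> Y" using x by (auto simp: conj_normalizer_def)
    show "inj_on (\<lambda>y. x \<otimes> y \<otimes> inv x) Y" using xc by (intro inj_onI) simp
  qed
  note im = this
  have "inv x \<otimes> y \<otimes> inv (inv x) \<in> Y" if "y \<in> Y" for y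
  proof -
    have "y \<in> (\<lambda>y. x \<otimes> y \<otimes> inv x) ` Y" using that im by simp
    then obtain z where z: "z \<in> Y" "y = x \<otimes> z \<otimes> inv x" by (rule imageE)
    have "inv x \<otimes> y \<otimes> inv (inv x) = z" unfolding z(2) using z(1) xc by (simp add: group_cancel)
    thus ?thesis using z by simp
  qed
  thus "inv x \<in> conj_normalizer Y" using xc by (simp add: conj_normalizer_def)
  fix z assume z: "z \<in> conj_normalizer Y"
  show "x \<otimes> z \<in> conj_normalizer Y"
    unfolding conj_normalizer_def
  proof (intro CollectI conjI ballI)
    have zc: "z \<in> carrier G" using z by (rule conj_normalizerD)
    show "x \<otimes> z \<in> carrier G" using xc zc by simp
    fix y assume y: "y \<in> Y"
    have "x \<otimes> (z \<otimes> y \<otimes> inv z) \<otimes> inv x \<in> Y"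
      by (rule conj_normalizerD(2)[OF x conj_normalizerD(2)[OF z y]])
    thus "x \<otimes> z \<otimes> y \<otimes> inv (x \<otimes> z) \<in> Y"
      unfolding conj_conj[OF Y.mem_carrier[OF y] xc zc] .
  qed
qed

lemma subgroup_le_conj_normalizer: assumes Y: "subgroup Y G" shows "Y \<subseteq> conj_normalizer Y"
proof -
  interpret Y: subgroup Y G by fact
  show ?thesis by (auto simp: conj_normalizer_def)
qed

lemma inv_in_sub: "subgroup H G \<Longrightarrow> x \<in> H \<Longrightarrow> inv\<^bsub>G\<lparr>carrier := H\<rparr>\<^esub> x = inv x"
  by (rule m_inv_consistent)

lemma normal_in_sub_iff:
  assumes "subgroup H G" "subgroup Y G" "Y \<subseteq> H"
  shows "Y \<lhd> G\<lparr>carrier := H\<rparr> \<longleftrightarrow> H \<subseteq> conj_normalizer Y"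
proof -
  interpret H: group "G\<lparr>carrier := H\<rparr>" using assms subgroup_imp_group by auto
  show ?thesis unfolding H.normal_inv_iff
    using assms(2,3) subgroup_in_sub_iff[OF assms(1)] subgroup.subset[OF assms(1)]
    by (auto simp: inv_in_sub[OF assms(1)] conj_normalizer_def)
qed

text \<open>
  The subgroup \<open>K\<close> is the preimage of the subgroup generated by the image of \<open>y\<close>, which has order \<open>r\<close>, in the
  quotient of the normalizer by \<open>H\<close>.
\<close>
lemma prime_extension:
  assumes H: "subgroup H G" and y: "y \<in> conj_normalizer H" "y \<notin> H" and r: "prime r" "y [^] r \<in> H"
  obtains K where "subgroup K G" "H \<subseteq> K" "card K = r * card H" "K \<subseteq> conj_normalizer H"
    "\<forall>L. subgroup L G \<longrightarrow> H \<subseteq> L \<longrightarrow> y \<in> L \<longrightarrow> K \<subseteq> L"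
proof -
  define \<Gamma> where "\<Gamma> = conj_normalizer H"
  have \<Gamma>: "subgroup \<Gamma> G" unfolding \<Gamma>_def by (rule conj_normalizer_subgroup[OF H])
  let ?M = "G\<lparr>carrier := \<Gamma>\<rparr>"
  interpret M: fin_group ?M by (rule fin_group_sub[OF \<Gamma>])
  have HM: "H \<subseteq> \<Gamma>" using subgroup_le_conj_normalizer[OF H] by (simp add: \<Gamma>_def)
  have N: "H \<lhd> ?M" using normal_in_sub_iff[OF \<Gamma> H HM] by (simp add: \<Gamma>_def)
  interpret Q: fin_group "?M Mod H" by (rule M.fin_group_Mod[OF N])
  interpret f: group_hom ?M "?M Mod H" "\<lambda>x. H #>\<^bsub>?M\<^esub> x" by (rule M.Mod_hom[OF N])
  have yM: "y \<in> carrier ?M" using y by (simp add: \<Gamma>_def)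
  let ?y = "H #>\<^bsub>?M\<^esub> y"
  have yQ: "?y \<in> carrier (?M Mod H)" using f.hom_closed[OF yM] .
  have "?y [^]\<^bsub>?M Mod H\<^esub> r = H #>\<^bsub>?M\<^esub> (y [^]\<^bsub>?M\<^esub> r)" using f.hom_nat_pow[OF yM, of r] by simp
  also have "\<dots> = \<one>\<^bsub>?M Mod H\<^esub>"
    using M.Mod_one_iff[OF N, of "y [^]\<^bsub>?M\<^esub> r"] r(2) M.nat_pow_closed[OF yM, of r] by (simp add: nat_pow_consistent[symmetric])
  finally have "Q.ord ?y dvd r" using Q.pow_eq_id[OF yQ] by simp
  moreover have "Q.ord ?y \<noteq> 1" using M.Mod_one_iff[OF N yM] y(2) Q.ord_eq_1[OF yQ] by auto
  ultimately have ordy: "Q.ord ?y = r" using r(1) by (metis prime_nat_iff)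
  define E where "E = generate (?M Mod H) {?y}"
  have E: "subgroup E (?M Mod H)" unfolding E_def by (rule Q.generate_is_subgroup) (use yQ in auto)
  have cE: "card E = r" unfolding E_def using Q.generate_pow_card[OF yQ] ordy by simp
  define K where "K = \<Union>E"
  note pb = M.Mod_pullback[OF N E, folded K_def]
  have K: "subgroup K G" "K \<subseteq> \<Gamma>" using pb(1) subgroup_in_sub_iff[OF \<Gamma>] by auto
  show thesis
  proof (rule that[OF K(1) pb(2)])
    show "card K = r * card H" using pb(3) cE by simp
    show "K \<subseteq> conj_normalizer H" using K(2) by (simp add: \<Gamma>_def)
    show "\<forall>L. subgroup L G \<longrightarrow> H \<subseteq> L \<longrightarrow> y \<in> L \<longrightarrow> K \<subseteq> L"
    proof (intro allI impI subsetI)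
      fix L assume L: "subgroup L G" "H \<subseteq> L" "y \<in> L"
      fix x assume x: "x \<in> K"
      hence xM: "x \<in> carrier ?M" using K by auto
      have "H #>\<^bsub>?M\<^esub> x \<in> E" using pb(4)[OF xM] x by simp
      moreover have "E = {?y [^]\<^bsub>?M Mod H\<^esub> k | k. k \<in> (UNIV :: nat set)}"
        unfolding E_def by (rule Q.generate_pow_nat[OF yQ]) (use ordy r(1) in auto)
      ultimately obtain k :: nat where "H #>\<^bsub>?M\<^esub> x = ?y [^]\<^bsub>?M Mod H\<^esub> k" by auto
      also have "\<dots> = H #>\<^bsub>?M\<^esub> (y [^]\<^bsub>?M\<^esub> k)" using f.hom_nat_pow[OF yM, of k] by simp
      finally have "H #> x = H #> y [^] k" by (simp add: nat_pow_consistent[symmetric])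
      hence "x \<in> H #> y [^] k" using rcos_self[OF _ H, of x] xM \<Gamma> subgroup.mem_carrier[OF \<Gamma>] by auto
      then obtain h where "h \<in> H" "x = h \<otimes> y [^] k" by (auto simp: r_coset_def)
      thus "x \<in> L" using L sub_pow_closed[OF L(1,3)] subgroup.m_closed[OF L(1)] by auto
    qed
  qed
qed

lemma last_power_outside:
  assumes "x \<in> carrier G" "x \<notin> Y" "x [^] (q ^ k :: nat) \<in> Y"
  obtains i where "x [^] (q ^ i :: nat) \<notin> Y" "(x [^] (q ^ i :: nat)) [^] q \<in> Y"
proof -
  define j where "j = (LEAST j. x [^] (q ^ j :: nat) \<in> Y)"
  have j: "x [^] (q ^ j :: nat) \<in> Y" unfolding j_def by (rule LeastI[of _ k]) fact
  have "j \<noteq> 0" using j assms(1,2) by (intro notI) simp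
  then obtain i where i: "j = Suc i" by (cases j) auto
  have "x [^] (q ^ i :: nat) \<notin> Y" using not_less_Least[of i "\<lambda>j. x [^] (q ^ j :: nat) \<in> Y"] i j_def by simp
  moreover have "(x [^] (q ^ i :: nat)) [^] q \<in> Y"
    using j i assms(1) by (simp add: nat_pow_pow mult.commute)
  ultimately show thesis by (rule that)
qed

text \<open>
  \<open>Y\<close> acts by right multiplication on its cosets in \<open>X\<close>.  It fixes the coset \<open>Y\<close>, and the number of fixed
  cosets is divisible by \<open>q\<close>; a second fixed coset consists of elements that normalize \<open>Y\<close>.  In particular
  a maximal subgroup of a \<open>q\<close>-group is normal of index \<open>q\<close>.
\<close>
lemma p_group_growth:
  assumes X: "subgroup X G" "card X = q ^ k" and q: "prime q"
    and Y: "subgroup Y G" "Y \<subseteq> X" "Y \<noteq> X"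
  obtains K where "subgroup K G" "Y \<subseteq> K" "K \<subseteq> X" "card K = q * card Y" "K \<subseteq> conj_normalizer Y"
proof -
  interpret X: subgroup X G by fact
  interpret Y: subgroup Y G by fact
  let ?E = "(\<lambda>x. Y #> x) ` X"
  let ?F = "{C \<in> ?E. \<forall>y\<in>Y. C #> inv y = C}"
  have cY: "card Y dvd q ^ k" using card_sub_mono_dvd[OF Y(1) X(1) Y(2)] X(2) by simp
  then obtain j where j: "card Y = q ^ j" using q by (auto simp: divides_primepow_nat)
  have fE: "finite ?E" using finite_sub[OF X(1)] by simp
  have cE: "card X = card ?E * card Y"
  proof (rule card_uniform_fibres[OF finite_sub[OF X(1)]])
    fix C assume "C \<in> ?E"
    then obtain x where x: "x \<in> X" "C = Y #> x" by auto
    have "{z \<in> X. Y #> z = C} = Y #> x"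
    proof (intro equalityI subsetI)
      fix z assume "z \<in> {z \<in> X. Y #> z = C}"
      thus "z \<in> Y #> x" using x rcos_self[OF _ Y(1), of z] by auto
    next
      fix z assume z: "z \<in> Y #> x"
      then obtain h where "h \<in> Y" "z = h \<otimes> x" by (auto simp: r_coset_def)
      hence "z \<in> X" using Y(2) x by auto
      moreover have "Y #> z = Y #> x" using repr_independence[OF z _ Y(1)] x by auto
      ultimately show "z \<in> {z \<in> X. Y #> z = C}" using x by simp
    qed
    thus "card {z \<in> X. Y #> z = C} = card Y"
      using card_rcosets_equal[OF rcosetsI[OF Y.subset, of x] Y.subset] x by simp
  qed
  have "q dvd card ?E"
  proof -
    have "card ?E dvd q ^ k" using cE X(2) by (metis dvd_triv_left)
    then obtain i where i: "card ?E = q ^ i" using q by (auto simp: divides_primepow_nat)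
    have "i \<noteq> 0"
    proof
      assume "i = 0"
      hence "card X = card Y" using i cE by simp
      thus False using card_subset_eq[OF finite_sub[OF X(1)] Y(2)] Y(3) by simp
    qed
    thus ?thesis using i by simp
  qed
  moreover have "q dvd card (?E - ?F)"
  proof -
    have "q dvd card (?E - {C \<in> ?E. \<forall>g\<in>carrier (G\<lparr>carrier := Y\<rparr>). C #> inv g = C})"
    proof (rule p_group_fixed_points[OF subgroup_imp_group[OF Y(1)], of q j])
      show "card (carrier (G\<lparr>carrier := Y\<rparr>)) = q ^ j" using j by simp
      show "C #> inv g \<in> ?E" if "g \<in> carrier (G\<lparr>carrier := Y\<rparr>)" "C \<in> ?E" for g C
      proof -
        obtain x where x: "x \<in> X" "C = Y #> x" using \<open>C \<in> ?E\<close> by blast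
        have g: "g \<in> Y" "g \<in> X" using that Y(2) by auto
        have "C #> inv g = Y #> (x \<otimes> inv g)"
          using x g coset_mult_assoc[OF Y.subset, of x "inv g"] by simp
        moreover have "x \<otimes> inv g \<in> X" using x g by simp
        ultimately show ?thesis by (rule image_eqI)
      qed
      show "C #> inv \<one>\<^bsub>G\<lparr>carrier := Y\<rparr>\<^esub> = C" if "C \<in> ?E" for C
        using that by (auto simp: coset_mult_assoc[OF Y.subset])
      show "C #> inv (g \<otimes>\<^bsub>G\<lparr>carrier := Y\<rparr>\<^esub> h) = C #> inv h #> inv g"
        if "g \<in> carrier (G\<lparr>carrier := Y\<rparr>)" "h \<in> carrier (G\<lparr>carrier := Y\<rparr>)" "C \<in> ?E" for g h C
      proof -
        obtain x where x: "x \<in> X" "C = Y #> x" using \<open>C \<in> ?E\<close> by blast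
        have "C \<subseteq> carrier G" using x r_coset_subset_G[OF Y.subset, of x] by simp
        thus ?thesis using that coset_mult_assoc[of C "inv h" "inv g"] by (simp add: inv_mult_group)
      qed
    qed (use q fE in auto)
    thus ?thesis by simp
  qed
  moreover have "card ?E = card ?F + card (?E - ?F)"
  proof -
    have "?F \<subseteq> ?E" by blast
    from card_Diff_subset[OF finite_subset[OF this fE] this] card_mono[OF fE this] show ?thesis by linarith
  qed
  ultimately have dF: "q dvd card ?F" using dvd_add_left_iff[of q "card (?E - ?F)" "card ?F"] by simp
  have YF: "Y \<in> ?F"
  proof -
    have "Y = Y #> \<one>" using coset_mult_one[OF Y.subset] by simp
    hence "Y \<in> ?E" by (rule image_eqI) simp
    moreover have "Y #> inv y = Y" if "y \<in> Y" for y using that coset_join2[OF _ Y(1), of "inv y"] by simp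
    ultimately show ?thesis by simp
  qed
  have "card ?F \<noteq> 1" using dF q by auto
  hence "?F \<noteq> {Y}" by auto
  moreover have "?F = {Y}" if "\<forall>C\<in>?F. C = Y" using YF that by (intro equalityI subsetI) simp_all
  ultimately have "\<not> (\<forall>C\<in>?F. C = Y)" by (rule contrapos_nn)
  hence "\<exists>C\<in>?F. C \<noteq> Y" by simp
  then obtain C where C: "C \<in> ?F" "C \<noteq> Y" ..
  have "C \<in> ?E" using C(1) by simp
  then obtain x where x: "x \<in> X" "C = Y #> x" by (rule imageE)
  have xY: "x \<notin> Y" using C(2) x coset_join2[OF _ Y(1), of x] by auto
  have xn: "x \<in> conj_normalizer Y"
  proof -
    have "x \<otimes> y \<otimes> inv x \<in> Y" if y: "y \<in> Y" for y
    proof -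
      have "\<forall>y\<in>Y. C #> inv y = C" using C(1) by simp
      hence "Y #> x #> inv (inv y) = Y #> x" using x(2) Y.m_inv_closed[OF y] by simp
      hence "Y #> (x \<otimes> y) = Y #> x" using x y coset_mult_assoc[OF Y.subset, of x y] by simp
      hence "x \<otimes> y \<in> Y #> x" using rcos_self[OF _ Y(1), of "x \<otimes> y"] x y by simp
      then obtain h where h: "h \<in> Y" "x \<otimes> y = h \<otimes> x" by (auto simp: r_coset_def)
      hence "x \<otimes> y \<otimes> inv x = h" using x by (simp add: group_cancel)
      thus ?thesis using h by simp
    qed
    thus ?thesis using x by (auto simp: conj_normalizer_def)
  qed
  have "x [^] (q ^ k :: nat) \<in> Y" using pow_card_sub[OF X(1) x(1)] X(2) by simp
  then obtain i where i: "x [^] (q ^ i :: nat) \<notin> Y" "(x [^] (q ^ i :: nat)) [^] q \<in> Y"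
    using last_power_outside[of x Y q k] xY x by auto
  have "x [^] (q ^ i :: nat) \<in> conj_normalizer Y" by (rule sub_pow_closed[OF conj_normalizer_subgroup[OF Y(1)] xn])
  then obtain K where K: "subgroup K G" "Y \<subseteq> K" "card K = q * card Y" "K \<subseteq> conj_normalizer Y"
      "\<forall>L. subgroup L G \<longrightarrow> Y \<subseteq> L \<longrightarrow> x [^] (q ^ i :: nat) \<in> L \<longrightarrow> K \<subseteq> L"
    by (rule prime_extension[OF Y(1) _ i(1) q i(2)])
  show thesis by (rule that[OF K(1,2) K(5)[rule_format, OF X(1) Y(2) sub_pow_closed[OF X(1) x(1)]] K(3,4)])
qed

end

section \<open>Coprime action\<close>

context group
begin

text \<open>
  If \<open>h\<close> moves \<open>x\<close> by a factor \<open>c\<close> that it fixes, then iterating multiplies by powers of \<open>c\<close>.  Both the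
  triviality of coprime stable actions and the commuting of coprime elements in nilpotent groups come from
  this identity.
\<close>
lemma conj_shift_power:
  assumes "h \<in> carrier G" "x \<in> carrier G" "c \<in> carrier G"
    and hx: "h \<otimes> x \<otimes> inv h = x \<otimes> c" and hc: "h \<otimes> c = c \<otimes> h"
  shows "h [^] (n::nat) \<otimes> x \<otimes> inv (h [^] n) = x \<otimes> c [^] n"
proof (induction n)
  case 0 show ?case using assms(1-3) by simp
next
  case (Suc n)
  have hcn: "h \<otimes> c [^] n \<otimes> inv h = c [^] n"
  proof -
    have "h \<otimes> c \<otimes> inv h = c" using hc assms(1-3) by (simp add: m_assoc)
    thus ?thesis using conj_pow[of c h n] assms(1-3) by simp
  qed
  have "h [^] Suc n = h \<otimes> h [^] n" using nat_pow_Suc2[OF assms(1)] .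
  hence "h [^] Suc n \<otimes> x \<otimes> inv (h [^] Suc n) = h \<otimes> (h [^] n \<otimes> x \<otimes> inv (h [^] n)) \<otimes> inv h"
    using conj_conj[of x h "h [^] n"] assms(1-3) by simp
  also have "\<dots> = h \<otimes> (x \<otimes> c [^] n) \<otimes> inv h" using Suc by simp
  also have "\<dots> = (x \<otimes> c) \<otimes> c [^] n" using conj_mult[of x "c [^] n" h] hcn hx assms(1-3) by simp
  also have "\<dots> = x \<otimes> c [^] Suc n" using assms(1-3) nat_pow_Suc2[of c n] by (simp add: m_assoc)
  finally show ?case .
qed

lemma conj_shift_order:
  assumes "h \<in> carrier G" "x \<in> carrier G" "c \<in> carrier G"
    and "h \<otimes> x \<otimes> inv h = x \<otimes> c" "h \<otimes> c = c \<otimes> h" "h [^] (n::nat) = \<one>"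
  shows "c [^] n = \<one>"
  using conj_shift_power[OF assms(1-5), of n] assms by simp

end

context fin_group
begin

lemma coprime_order_one:
  "x \<in> carrier G \<Longrightarrow> x [^] (m::nat) = \<one> \<Longrightarrow> x [^] (n::nat) = \<one> \<Longrightarrow> coprime m n \<Longrightarrow> x = \<one>"
  using pow_coprime_mem[OF triv_subgroup, of x m n] by simp

lemma coprime_action_trivial:
  assumes h: "h \<in> carrier G" "h [^] (m::nat) = \<one>" and x: "x \<in> carrier G"
    and c: "c \<in> carrier G" "c [^] (n::nat) = \<one>" "coprime m n"
    and hx: "h \<otimes> x \<otimes> inv h = x \<otimes> c" and hc: "h \<otimes> c = c \<otimes> h"
  shows "h \<otimes> x = x \<otimes> h"
proof -
  have "c [^] m = \<one>" by (rule conj_shift_order[OF h(1) x c(1) hx hc h(2)])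
  hence "c = \<one>" using coprime_order_one[OF c(1) _ c(2,3)] by simp
  hence "h \<otimes> x \<otimes> inv h = x" using hx x by simp
  hence "h \<otimes> x \<otimes> inv h \<otimes> h = x \<otimes> h" by simp
  thus ?thesis using h x by (simp add: m_assoc)
qed

text \<open>
  \<open>g\<close> induces an automorphism of the cyclic group \<open>X/Y\<close> of order \<open>q\<close>, that is, raising to some power \<open>j\<close> prime to
  \<open>q\<close>, and \<open>j ^ (q - 1)\<close> is \<open>1\<close> modulo \<open>q\<close>.
\<close>
lemma power_acts_trivially_on_prime_quotient:
  assumes X: "subgroup X G" and Y: "subgroup Y G" "Y \<subseteq> X" "X \<subseteq> conj_normalizer Y"
    and q: "prime q" "card X = q * card Y"
    and g: "g \<in> conj_normalizer X" "g \<in> conj_normalizer Y" and x: "x \<in> X"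
  shows "\<exists>y\<in>Y. g [^] (q - 1) \<otimes> x \<otimes> inv (g [^] (q - 1)) = x \<otimes> y"
proof (cases "x \<in> Y")
  case True
  interpret Y: subgroup Y G by fact
  have gn: "g [^] (q - 1) \<in> conj_normalizer Y" by (rule sub_pow_closed[OF conj_normalizer_subgroup[OF Y(1)] g(2)])
  have gc: "g [^] (q - 1) \<in> carrier G" using gn by (rule conj_normalizerD)
  have "inv x \<otimes> (g [^] (q - 1) \<otimes> x \<otimes> inv (g [^] (q - 1))) \<in> Y"
    using conj_normalizerD(2)[OF gn True] True by simp
  moreover have "g [^] (q - 1) \<otimes> x \<otimes> inv (g [^] (q - 1)) = x \<otimes> (inv x \<otimes> (g [^] (q - 1) \<otimes> x \<otimes> inv (g [^] (q - 1))))"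
    using gc True by (simp add: group_cancel del: nat_pow_closed)
  ultimately show ?thesis by (rule rev_bexI)
next
  case False
  interpret X: subgroup X G by fact
  interpret Y: subgroup Y G by fact
  let ?M = "G\<lparr>carrier := X\<rparr>"
  interpret M: fin_group ?M by (rule fin_group_sub[OF X])
  have N: "Y \<lhd> ?M" using normal_in_sub_iff[OF X Y(1,2)] Y(3) by simp
  interpret Q: fin_group "?M Mod Y" by (rule M.fin_group_Mod[OF N])
  define \<pi> where "\<pi> = (\<lambda>x. Y #>\<^bsub>?M\<^esub> x)"
  interpret f: group_hom ?M "?M Mod Y" \<pi> unfolding \<pi>_def by (rule M.Mod_hom[OF N])
  have gc: "g \<in> carrier G" using g(1) by (rule conj_normalizerD)
  have \<pi>c: "\<pi> u \<in> carrier (?M Mod Y)" if "u \<in> X" for u using f.hom_closed[of u] that by simp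
  have \<pi>1: "\<pi> u = \<one>\<^bsub>?M Mod Y\<^esub> \<longleftrightarrow> u \<in> Y" if "u \<in> X" for u using M.Mod_one_iff[OF N, of u] that by (simp add: \<pi>_def)
  have \<pi>pow: "\<pi> (u [^] n) = \<pi> u [^]\<^bsub>?M Mod Y\<^esub> n" if "u \<in> X" for u and n :: nat
    using f.hom_nat_pow[of u n] that by (simp add: nat_pow_consistent[symmetric])
  have "card (carrier (?M Mod Y)) = q"
  proof -
    have "card X = card (\<pi> ` X) * card (X \<inter> Y)"
      using M.card_Mod_image[OF N M.subgroup_self] by (simp add: \<pi>_def)
    moreover have "\<pi> ` X = carrier (?M Mod Y)" by (simp add: carrier_FactGroup \<pi>_def)
    moreover have "X \<inter> Y = Y" using Y(2) by (rule Int_absorb1)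
    ultimately show ?thesis using q(2) card_sub_pos[OF Y(1)] by simp
  qed
  hence ordQ: "order (?M Mod Y) = q" by (simp add: order_def)
  have ordx: "Q.ord (\<pi> x) = q"
    using Q.ord_dvd_group_order[OF \<pi>c[OF x]] ordQ Q.ord_eq_1[OF \<pi>c[OF x]] \<pi>1[OF x] False q(1)
    by (auto simp: prime_nat_iff)
  have gX: "g \<otimes> u \<otimes> inv g \<in> X" if "u \<in> X" for u using conj_normalizerD(2)[OF g(1) that] .
  have full: "generate (?M Mod Y) {\<pi> x} = carrier (?M Mod Y)"
  proof (rule card_subset_eq[OF Q.fin])
    show "generate (?M Mod Y) {\<pi> x} \<subseteq> carrier (?M Mod Y)" by (rule Q.generate_incl) (simp add: \<pi>c x)
    show "card (generate (?M Mod Y) {\<pi> x}) = card (carrier (?M Mod Y))"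
      using Q.generate_pow_card[OF \<pi>c[OF x]] ordx ordQ by (simp add: order_def)
  qed
  have "generate (?M Mod Y) {\<pi> x} = {\<pi> x [^]\<^bsub>?M Mod Y\<^esub> k | k. k \<in> (UNIV :: nat set)}"
    by (rule Q.generate_pow_nat[OF \<pi>c[OF x]]) (use ordx q(1) in auto)
  hence "\<pi> (g \<otimes> x \<otimes> inv g) \<in> {\<pi> x [^]\<^bsub>?M Mod Y\<^esub> k | k. k \<in> (UNIV :: nat set)}"
    using \<pi>c[OF gX[OF x]] full by simp
  then obtain j :: nat where j: "\<pi> (g \<otimes> x \<otimes> inv g) = \<pi> x [^]\<^bsub>?M Mod Y\<^esub> j" by auto
  have \<pi>eq: "\<pi> u = \<pi> v \<longleftrightarrow> inv u \<otimes> v \<in> Y" if "u \<in> X" "v \<in> X" for u v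
  proof -
    have "\<pi> u = \<pi> v \<longleftrightarrow> inv\<^bsub>?M Mod Y\<^esub> (\<pi> u) \<otimes>\<^bsub>?M Mod Y\<^esub> \<pi> v = \<one>\<^bsub>?M Mod Y\<^esub>"
      using \<pi>c[OF that(1)] \<pi>c[OF that(2)] by (metis Q.inv_solve_left Q.one_closed Q.r_one)
    also have "inv\<^bsub>?M Mod Y\<^esub> (\<pi> u) \<otimes>\<^bsub>?M Mod Y\<^esub> \<pi> v = \<pi> (inv u \<otimes> v)"
      using that f.hom_inv[of u] f.hom_mult[of "inv u" v] inv_in_sub[OF X that(1)] by simp
    also have "\<dots> = \<one>\<^bsub>?M Mod Y\<^esub> \<longleftrightarrow> inv u \<otimes> v \<in> Y" by (rule \<pi>1) (simp add: that)
    finally show ?thesis .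
  qed
  have conj_eq: "\<pi> (g \<otimes> u \<otimes> inv g) = \<pi> (g \<otimes> v \<otimes> inv g)" if uv: "u \<in> X" "v \<in> X" "\<pi> u = \<pi> v" for u v
  proof -
    have "g \<otimes> (inv u \<otimes> v) \<otimes> inv g \<in> Y" using conj_normalizerD(2)[OF g(2)] \<pi>eq[OF uv(1,2)] uv(3) by simp
    moreover have "inv (g \<otimes> u \<otimes> inv g) \<otimes> (g \<otimes> v \<otimes> inv g) = g \<otimes> (inv u \<otimes> v) \<otimes> inv g"
      using uv gc by (simp add: group_cancel)
    ultimately show ?thesis using \<pi>eq[OF gX[OF uv(1)] gX[OF uv(2)]] by simp
  qed
  have iter: "g [^] n \<otimes> x \<otimes> inv (g [^] n) \<in> X \<and> \<pi> (g [^] n \<otimes> x \<otimes> inv (g [^] n)) = \<pi> x [^]\<^bsub>?M Mod Y\<^esub> (j ^ n)" for n :: nat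
  proof (induction n)
    case 0 show ?case using x \<pi>c[OF x] by (simp del: mult_FactGroup one_FactGroup)
  next
    case (Suc n)
    let ?u = "g [^] n \<otimes> x \<otimes> inv (g [^] n)"
    have uX: "?u \<in> X" and u: "\<pi> ?u = \<pi> (x [^] (j ^ n))" using Suc \<pi>pow[OF x] by simp_all
    have xX: "x [^] (j ^ n) \<in> X" by (rule sub_pow_closed[OF X x])
    have eq: "g [^] Suc n \<otimes> x \<otimes> inv (g [^] Suc n) = g \<otimes> ?u \<otimes> inv g"
      using conj_conj[of x g "g [^] n"] nat_pow_Suc2[OF gc, of n] gc x by simp
    have "\<pi> (g \<otimes> ?u \<otimes> inv g) = \<pi> (g \<otimes> x [^] (j ^ n) \<otimes> inv g)" by (rule conj_eq[OF uX xX u])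
    also have "\<dots> = \<pi> ((g \<otimes> x \<otimes> inv g) [^] (j ^ n))" using conj_pow[of x g] x gc by simp
    also have "\<dots> = \<pi> x [^]\<^bsub>?M Mod Y\<^esub> (j ^ Suc n)"
      using \<pi>pow[OF gX[OF x]] j Q.nat_pow_pow[OF \<pi>c[OF x]] by simp
    finally show ?case using eq gX[OF uX] by simp
  qed
  have "\<not> q dvd j"
  proof
    assume "q dvd j"
    hence "\<pi> x [^]\<^bsub>?M Mod Y\<^esub> j = \<one>\<^bsub>?M Mod Y\<^esub>" using Q.pow_eq_id[OF \<pi>c[OF x], of j] ordx by simp
    hence "g \<otimes> x \<otimes> inv g \<in> Y" using j \<pi>1[OF gX[OF x]] by simp
    moreover have "inv g \<in> conj_normalizer Y" by (rule subgroup.m_inv_closed[OF conj_normalizer_subgroup[OF Y(1)] g(2)])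
    ultimately have "inv g \<otimes> (g \<otimes> x \<otimes> inv g) \<otimes> inv (inv g) \<in> Y" by (rule conj_normalizerD(2)[rotated])
    thus False using False gc x by (simp add: group_cancel)
  qed
  hence "[j ^ (q - 1) = 1] (mod q)" using fermat_theorem[OF q(1)] by simp
  hence "\<pi> x [^]\<^bsub>?M Mod Y\<^esub> (j ^ (q - 1)) = \<pi> x [^]\<^bsub>?M Mod Y\<^esub> (1::nat)"
    using Q.pow_eq_id[OF \<pi>c[OF x]] ordx
    by (metis (no_types, lifting) Q.ord_eq_0 Q.pow_ord_eq_1 \<pi>c x cong_def Q.nat_pow_closed Q.nat_pow_mult Q.nat_pow_pow Q.nat_pow_one Q.l_one mult_div_mod_eq)
  hence "\<pi> x = \<pi> (g [^] (q - 1) \<otimes> x \<otimes> inv (g [^] (q - 1)))" using iter[of "q - 1"] \<pi>c[OF x] by (simp del: mult_FactGroup one_FactGroup)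
  hence mem: "inv x \<otimes> (g [^] (q - 1) \<otimes> x \<otimes> inv (g [^] (q - 1))) \<in> Y" using \<pi>eq[OF x conjunct1[OF iter[of "q - 1"]]] by simp
  have "g [^] (q - 1) \<otimes> x \<otimes> inv (g [^] (q - 1)) = x \<otimes> (inv x \<otimes> (g [^] (q - 1) \<otimes> x \<otimes> inv (g [^] (q - 1))))"
    using gc x by (simp add: group_cancel)
  thus ?thesis using mem by (rule rev_bexI[rotated])
qed

lemma set_mult_subset:
  assumes "subgroup S G" "H \<subseteq> S" "K \<subseteq> S" shows "H <#> K \<subseteq> S"
proof
  fix z assume "z \<in> H <#> K"
  then obtain h k where "h \<in> H" "k \<in> K" "z = h \<otimes> k" by (auto simp: set_mult_def)
  thus "z \<in> S" using assms subgroup.m_closed[OF assms(1), of h k] by auto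
qed

section \<open>Chains of subgroups with prime indices\<close>

lemma subset_set_mult:
  assumes H: "subgroup H G" and K: "subgroup K G"
  shows "H \<subseteq> H <#> K" "K \<subseteq> H <#> K"
proof -
  show "H \<subseteq> H <#> K"
  proof
    fix h assume h: "h \<in> H"
    hence "h = h \<otimes> \<one>" using subgroup.mem_carrier[OF H] by simp
    thus "h \<in> H <#> K" using h subgroup.one_closed[OF K] unfolding set_mult_def by blast
  qed
  show "K \<subseteq> H <#> K"
  proof
    fix k assume k: "k \<in> K"
    hence "k = \<one> \<otimes> k" using subgroup.mem_carrier[OF K] by simp
    thus "k \<in> H <#> K" using k subgroup.one_closed[OF H] unfolding set_mult_def by blast
  qed
qed

definition prime_step :: "'a set \<Rightarrow> 'a set \<Rightarrow> bool" where
  "prime_step H K \<longleftrightarrow> subgroup H G \<and> subgroup K G \<and> H \<subseteq> K \<and> (\<exists>r. prime r \<and> card K = r * card H)"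

text \<open>
  \<open>(Q \<inter> D) C\<close> lies between \<open>C\<close> and \<open>D\<close>, so the index of \<open>Q \<inter> C\<close> in \<open>Q \<inter> D\<close> is \<open>1\<close> or the
  prime index of \<open>C\<close> in \<open>D\<close>; as an index in a \<open>q\<close>-group it can only be \<open>q\<close> in the second case.
\<close>
lemma prime_step_intersection:
  assumes st: "prime_step C D" and Q: "Q \<lhd> G" "card Q = q ^ a" and q: "prime q"
  shows "Q \<inter> C = Q \<inter> D \<or> card (Q \<inter> D) = q * card (Q \<inter> C)"
proof -
  obtain r where C: "subgroup C G" and D: "subgroup D G" and CD: "C \<subseteq> D" and r: "prime r" "card D = r * card C"
    using st by (auto simp: prime_step_def)
  note Qs = normal_imp_subgroup[OF Q(1)]
  have X: "subgroup (Q \<inter> D) G" and Y: "subgroup (Q \<inter> C) G" using subgroups_Inter_pair[OF Qs] C D by simp_all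
  interpret D: fin_group "G\<lparr>carrier := D\<rparr>" by (rule fin_group_sub[OF D])
  have "Q \<inter> D \<lhd> G\<lparr>carrier := D\<rparr>" using normal_Int_subgroup[OF D Q(1)] by (simp add: Int_commute)
  from D.mult_norm_subgroup[OF this] have "subgroup ((Q \<inter> D) <#> C) (G\<lparr>carrier := D\<rparr>)"
    using subgroup_in_sub_iff[OF D] C CD by simp
  hence XC: "subgroup ((Q \<inter> D) <#> C) G" "(Q \<inter> D) <#> C \<subseteq> D" using subgroup_in_sub_iff[OF D] by simp_all
  from card_sub_mono_dvd[OF C XC(1) subset_set_mult(2)[OF X C]] obtain t where t: "card ((Q \<inter> D) <#> C) = card C * t" by (rule dvdE)
  have "card C * t dvd card C * r" using card_sub_mono_dvd[OF XC(1) D XC(2)] t r(2) by (simp add: mult.commute)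
  hence tr: "t = 1 \<or> t = r" using card_sub_pos[OF C] r(1) by (auto simp: prime_nat_iff)
  have "(Q \<inter> D) \<inter> C = Q \<inter> C" using CD by (simp add: Int_assoc Int_absorb1)
  hence "card C * t * card (Q \<inter> C) = card (Q \<inter> D) * card C" using card_set_mult[OF X C] t by simp
  hence cX: "card (Q \<inter> D) = t * card (Q \<inter> C)" using card_sub_pos[OF C] by simp
  show ?thesis
  proof (cases "t = 1")
    case True
    have "Q \<inter> C \<subseteq> Q \<inter> D" using CD by auto
    from card_subset_eq[OF finite_sub[OF X] this] cX True show ?thesis by simp
  next
    case False
    hence "t = r" using tr by simp
    moreover have "r dvd q ^ a" using card_sub_mono_dvd[OF X Qs] cX Q(2) \<open>t = r\<close> by (metis Int_lower1 dvd_trans dvd_triv_left)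
    hence "r = q" using r(1) q by (metis prime_dvd_power primes_dvd_imp_eq)
    ultimately show ?thesis using cX by simp
  qed
qed

text \<open>
  Climbing the chain, the power of \<open>g\<close> centralizes \<open>Q \<inter> E\<close> and acts trivially on the next factor of order
  \<open>q\<close>; having order prime to \<open>q\<close>, it centralizes the next intersection as well.
\<close>
lemma prime_chain_centralizes:
  assumes chain: "prime_step\<^sup>*\<^sup>* C D" and C: "subgroup C G"
    and Q: "Q \<lhd> G" "card Q = q ^ a" and q: "prime q"
    and g: "g \<in> C" "g [^] (m::nat) = \<one>" "coprime m q"
    and triv: "\<forall>x\<in>Q \<inter> C. g [^] (q - 1) \<otimes> x = x \<otimes> g [^] (q - 1)"
  shows "g \<in> D \<and> (\<forall>x\<in>Q \<inter> D. g [^] (q - 1) \<otimes> x = x \<otimes> g [^] (q - 1))"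
  using chain
proof (induction rule: rtranclp_induct)
  case base
  show ?case using g triv by simp
next
  case (step E F)
  note Qs = normal_imp_subgroup[OF Q(1)]
  have E: "subgroup E G" and F: "subgroup F G" and EF: "E \<subseteq> F" using step.hyps(2) by (simp_all add: prime_step_def)
  have gE: "g \<in> E" and gF: "g \<in> F" using step.IH EF by auto
  have gc: "g \<in> carrier G" by (rule subgroup.mem_carrier[OF F gF])
  let ?h = "g [^] (q - 1)"
  have X: "subgroup (Q \<inter> F) G" and Y: "subgroup (Q \<inter> E) G" using subgroups_Inter_pair[OF Qs] E F by simp_all
  have YX: "Q \<inter> E \<subseteq> Q \<inter> F" using EF by auto
  have nrm: "g \<in> conj_normalizer (Q \<inter> K)" if K: "subgroup K G" "g \<in> K" for K
    unfolding conj_normalizer_def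
  proof (intro CollectI conjI ballI gc)
    fix y assume "y \<in> Q \<inter> K"
    thus "g \<otimes> y \<otimes> inv g \<in> Q \<inter> K"
      using normal_invE(2)[OF Q(1) gc, of y] K subgroup.m_closed[OF K(1)] subgroup.m_inv_closed[OF K(1)] by simp
  qed
  have "\<forall>x\<in>Q \<inter> F. ?h \<otimes> x = x \<otimes> ?h"
  proof (cases "Q \<inter> E = Q \<inter> F")
    case True
    thus ?thesis using step.IH by simp
  next
    case False
    hence cX: "card (Q \<inter> F) = q * card (Q \<inter> E)"
      using prime_step_intersection[OF step.hyps(2) Q q] by simp
    have "card (Q \<inter> F) dvd q ^ a" using card_sub_mono_dvd[OF X Qs] Q(2) by simp
    then obtain b where b: "card (Q \<inter> F) = q ^ b" using q by (auto simp: divides_primepow_nat)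
    obtain K where K: "subgroup K G" "Q \<inter> E \<subseteq> K" "K \<subseteq> Q \<inter> F" "card K = q * card (Q \<inter> E)" "K \<subseteq> conj_normalizer (Q \<inter> E)"
      by (rule p_group_growth[OF X b q Y YX False])
    have "K = Q \<inter> F" using card_subset_eq[OF finite_sub[OF X] K(3)] K(4) cX by simp
    hence nX: "Q \<inter> F \<subseteq> conj_normalizer (Q \<inter> E)" using K(5) by simp
    show ?thesis
    proof
      fix x assume x: "x \<in> Q \<inter> F"
      obtain y where y: "y \<in> Q \<inter> E" "?h \<otimes> x \<otimes> inv ?h = x \<otimes> y"
        using power_acts_trivially_on_prime_quotient[OF X Y YX nX q cX nrm[OF F gF] nrm[OF E gE] x] by auto
      have yc: "y \<in> carrier G" using subgroup.mem_carrier[OF Y y(1)] .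
      have xc: "x \<in> carrier G" using subgroup.mem_carrier[OF X x] .
      have hc: "?h \<in> carrier G" using gc by simp
      have "?h [^] m = (g [^] m) [^] (q - 1)" using gc by (simp add: nat_pow_pow mult.commute)
      hence hm: "?h [^] m = \<one>" using g(2) by simp
      have ya: "y [^] (q ^ a) = \<one>" using pow_card_sub[OF Qs, of y] y(1) Q(2) by simp
      have "coprime m (q ^ a)" using g(3) by simp
      moreover have "?h \<otimes> y = y \<otimes> ?h" using step.IH y(1) by simp
      ultimately show "?h \<otimes> x = x \<otimes> ?h"
        using coprime_action_trivial[OF hc hm xc yc ya _ y(2)] by simp
    qed
  qed
  thus ?case using gF by simp
qed

text \<open>
  The index of the images divides the index of the originals, so in the image some steps may collapse,
  and the others keep their prime index.
\<close>
lemma prime_chain_image: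
  assumes f: "group_hom G K f" "fin_group K" and chain: "prime_step\<^sup>*\<^sup>* C D"
  shows "(fin_group.prime_step K)\<^sup>*\<^sup>* (f ` C) (f ` D)"
  using chain
proof (induction rule: rtranclp_induct)
  case (step E F)
  interpret K: fin_group K by fact
  interpret f: group_hom G K f by fact
  obtain r where E: "subgroup E G" and F: "subgroup F G" and EF: "E \<subseteq> F" and r: "prime r" "card F = r * card E"
    using step.hyps(2) by (auto simp: prime_step_def)
  have fE: "subgroup (f ` E) K" and fF: "subgroup (f ` F) K" using f.subgroup_img_is_subgroup E F by simp_all
  have fEF: "f ` E \<subseteq> f ` F" using EF by auto
  obtain s where s: "card (f ` F) = card (f ` E) * s" using K.card_sub_mono_dvd[OF fE fF fEF] by (rule dvdE)
  let ?k = "kernel G K f"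
  have k: "subgroup ?k G" by (rule f.subgroup_kernel)
  have kE: "card H = card (f ` H) * card (H \<inter> ?k)" if H: "subgroup H G" for H
  proof -
    have "{x \<in> H. f x = \<one>\<^bsub>K\<^esub>} = H \<inter> ?k" using subgroup.subset[OF H] by (auto simp: kernel_def)
    thus ?thesis using card_hom_image[OF f(1) H] by simp
  qed
  obtain t where t: "card (F \<inter> ?k) = card (E \<inter> ?k) * t"
    using card_sub_mono_dvd[OF subgroups_Inter_pair[OF E k] subgroups_Inter_pair[OF F k]] EF by (auto elim: dvdE)
  have "card E * r = card E * (s * t)" using kE[OF E] kE[OF F] r(2) s t by (simp add: ac_simps)
  hence "r = s * t" using card_sub_pos[OF E] by simp
  hence "s = 1 \<or> s = r" using r(1) by (metis dvd_triv_left prime_nat_iff)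
  hence "f ` E = f ` F \<or> K.prime_step (f ` E) (f ` F)"
  proof
    assume "s = 1"
    thus ?thesis using card_subset_eq[OF K.finite_sub[OF fF] fEF] s by simp
  next
    assume "s = r"
    thus ?thesis using fE fF fEF r(1) s by (auto simp: K.prime_step_def)
  qed
  thus ?case using step.IH by (auto intro: rtranclp.rtrancl_into_rtrancl)
qed simp

lemma coprime_card_Int_trivial:
  assumes "subgroup H G" "subgroup K G" "coprime (card H) (card K)"
  shows "H \<inter> K = {\<one>}"
proof
  show "H \<inter> K \<subseteq> {\<one>}"
  proof
    fix x assume "x \<in> H \<inter> K"
    hence "x = \<one>"
      using coprime_order_one[OF subgroup.mem_carrier[OF assms(1), of x], of "card H" "card K"]
        pow_card_sub[OF assms(1), of x] pow_card_sub[OF assms(2), of x] assms(3) by simp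
    thus "x \<in> {\<one>}" by simp
  qed
  show "{\<one>} \<subseteq> H \<inter> K" using subgroup.one_closed[OF assms(1)] subgroup.one_closed[OF assms(2)] by simp
qed

lemma sylow_chain_centralizes:
  assumes chain: "prime_step\<^sup>*\<^sup>* P D" and P: "subgroup P G" "card P = p ^ c"
    and Q: "Q \<lhd> G" "card Q = q ^ a" and pq: "prime p" "prime q" "p \<noteq> q"
    and g: "g \<in> P" and x: "x \<in> Q" "x \<in> D"
  shows "g [^] (q - 1) \<otimes> x = x \<otimes> g [^] (q - 1)"
proof -
  have co: "coprime (p ^ c) q" using primes_coprime[OF pq] by simp
  have "Q \<inter> P = {\<one>}"
    by (rule coprime_card_Int_trivial[OF normal_imp_subgroup[OF Q(1)] P(1)]) (simp add: Q(2) P(2) primes_coprime[OF pq] coprime_commute)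
  moreover have "g \<in> carrier G" using subgroup.mem_carrier[OF P(1) g] .
  ultimately have "\<forall>x\<in>Q \<inter> P. g [^] (q - 1) \<otimes> x = x \<otimes> g [^] (q - 1)" by simp
  moreover have "g [^] (p ^ c) = \<one>" using pow_card_sub[OF P(1) g] P(2) by simp
  ultimately show ?thesis using prime_chain_centralizes[OF chain P(1) Q pq(2) g _ co] x by simp
qed

lemma sylow_chain_centralizes_Mod:
  assumes K: "K \<lhd> G" and chain: "prime_step\<^sup>*\<^sup>* P D" and P: "subgroup P G" "card P = p ^ c"
    and Q: "Q \<lhd> (G Mod K)" "card Q = q ^ a" and pq: "prime p" "prime q" "p \<noteq> q"
    and g: "g \<in> P" and x: "x \<in> D" "K #> x \<in> Q"
  shows "(K #> g) [^]\<^bsub>G Mod K\<^esub> (q - 1) \<otimes>\<^bsub>G Mod K\<^esub> (K #> x) = (K #> x) \<otimes>\<^bsub>G Mod K\<^esub> (K #> g) [^]\<^bsub>G Mod K\<^esub> (q - 1)"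
proof -
  interpret Q: fin_group "G Mod K" by (rule fin_group_Mod[OF K])
  interpret f: group_hom G "G Mod K" "\<lambda>x. K #> x" by (rule Mod_hom[OF K])
  have "card ((\<lambda>x. K #> x) ` P) dvd p ^ c" using card_Mod_image[OF K P(1)] P(2) by (metis dvd_triv_left)
  then obtain d where d: "card ((\<lambda>x. K #> x) ` P) = p ^ d" using pq(1) by (auto simp: divides_primepow_nat)
  show ?thesis
    by (rule Q.sylow_chain_centralizes[OF prime_chain_image[OF Mod_hom[OF K] fin_group_Mod[OF K] chain]
        f.subgroup_img_is_subgroup[OF P(1)] d Q pq]) (use g x in simp_all)
qed

section \<open>Permutability with maximal subgroups\<close>

lemma maximal_subgroup_above:
  assumes Q: "subgroup Q G" and D: "subgroup D G" "D \<subseteq> Q" "D \<noteq> Q"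
  obtains M where "maximal_subgroup M (G\<lparr>carrier := Q\<rparr>)" "D \<subseteq> M"
proof -
  let ?S = "{M. subgroup M G \<and> D \<subseteq> M \<and> M \<subseteq> Q \<and> M \<noteq> Q}"
  have "finite ?S" by (rule finite_subset[of _ "Pow Q"]) (use finite_sub[OF Q] in auto)
  moreover have "D \<in> ?S" using D by simp
  ultimately obtain M where M: "M \<in> ?S" "D \<subseteq> M" "\<forall>b\<in>?S. M \<subseteq> b \<longrightarrow> M = b"
    using finite_has_maximal2[of ?S D] by auto
  have "maximal_subgroup M (G\<lparr>carrier := Q\<rparr>)"
    unfolding maximal_subgroup_def
  proof (intro conjI allI impI)
    show "subgroup M (G\<lparr>carrier := Q\<rparr>)" "M \<noteq> carrier (G\<lparr>carrier := Q\<rparr>)"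
      using M(1) subgroup_in_sub_iff[OF Q] by simp_all
    fix K assume K: "subgroup K (G\<lparr>carrier := Q\<rparr>) \<and> M \<subseteq> K"
    show "K = M \<or> K = carrier (G\<lparr>carrier := Q\<rparr>)"
    proof (cases "K = Q")
      case False
      hence "K \<in> ?S" using K M(2) subgroup_in_sub_iff[OF Q] by auto
      thus ?thesis using M(3) K by blast
    qed simp
  qed
  thus thesis using that M(2) by blast
qed

text \<open>
  Suppose the centralizer \<open>D\<close> of \<open>h = g^(q-1)\<close> in \<open>Q\<close> is proper and let \<open>M\<close> be a maximal subgroup above it.
  For \<open>m \<in> M\<close> the conjugate of \<open>m\<close> by \<open>g\<close> is in \<open>Q \<inter> M B = M (Q \<inter> B)\<close>, which is \<open>M\<close> since \<open>Q \<inter> B \<le> D\<close>.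
  Hence \<open>g\<close> acts on \<open>Q/M\<close>, of order \<open>q\<close>, and \<open>h\<close> maps every coset of \<open>M\<close> in \<open>Q\<close> to itself.  A coset has
  \<open>q\<close>-power size and \<open>h\<close> has \<open>p\<close>-power order, so \<open>h\<close> has a fixed point in each coset, even outside \<open>M\<close>.
\<close>
lemma permutable_maximal_centralizes:
  assumes Q: "Q \<lhd> G" "card Q = q ^ a" and B: "subgroup B G"
    and perm: "\<And>M. maximal_subgroup M (G\<lparr>carrier := Q\<rparr>) \<Longrightarrow> B <#> M = M <#> B"
    and pq: "prime p" "prime q" "p \<noteq> q"
    and g: "g \<in> B" "g [^] (p ^ b :: nat) = \<one>"
    and triv: "\<And>x. x \<in> Q \<Longrightarrow> x \<in> B \<Longrightarrow> g [^] (q - 1) \<otimes> x = x \<otimes> g [^] (q - 1)"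
    and x: "x \<in> Q"
  shows "g [^] (q - 1) \<otimes> x = x \<otimes> g [^] (q - 1)"
proof (rule ccontr)
  assume neg: "\<not> ?thesis"
  note Qs = normal_imp_subgroup[OF Q(1)]
  interpret Q: subgroup Q G by (rule Qs)
  define h where "h = g [^] (q - 1)"
  have gc: "g \<in> carrier G" using subgroup.mem_carrier[OF B g(1)] .
  hence hc: "h \<in> carrier G" by (simp add: h_def)
  define D where "D = {x \<in> Q. h \<otimes> x = x \<otimes> h}"
  have D: "subgroup D G"
  proof (rule subgroupI)
    show "D \<subseteq> carrier G" by (auto simp: D_def)
    have "\<one> \<in> D" using hc by (simp add: D_def)
    thus "D \<noteq> {}" by (metis empty_iff)
    fix x assume x: "x \<in> D"
    hence xc: "x \<in> carrier G" "x \<in> Q" "h \<otimes> x = x \<otimes> h" by (auto simp: D_def)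
    have "inv x \<otimes> (h \<otimes> x) \<otimes> inv x = inv x \<otimes> (x \<otimes> h) \<otimes> inv x" using xc(3) by simp
    hence "inv x \<otimes> h = h \<otimes> inv x" using xc(1) hc by (simp add: group_cancel)
    thus "inv x \<in> D" using xc by (simp add: D_def)
    fix y assume "y \<in> D"
    hence yc: "y \<in> carrier G" "y \<in> Q" "h \<otimes> y = y \<otimes> h" by (auto simp: D_def)
    have "h \<otimes> (x \<otimes> y) = (x \<otimes> y) \<otimes> h" using xc yc hc by (metis m_assoc)
    thus "x \<otimes> y \<in> D" using xc yc by (simp add: D_def)
  qed
  have "x \<notin> D" using neg by (simp add: D_def h_def)
  hence DQ: "D \<noteq> Q" "D \<subseteq> Q" using x by (auto simp: D_def)
  obtain M where max: "maximal_subgroup M (G\<lparr>carrier := Q\<rparr>)" and DM: "D \<subseteq> M"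
    by (rule maximal_subgroup_above[OF Qs D DQ(2,1)])
  have M: "subgroup M G" "M \<subseteq> Q" "M \<noteq> Q" using max subgroup_in_sub_iff[OF Qs] by (auto simp: maximal_subgroup_def)
  interpret M: subgroup M G by (rule M)
  have gM: "g \<in> conj_normalizer M"
    unfolding conj_normalizer_def
  proof (intro CollectI conjI ballI gc)
    fix m assume m: "m \<in> M"
    have "g \<otimes> m \<in> B <#> M" using g(1) m unfolding set_mult_def by blast
    then obtain m' b' where mb: "m' \<in> M" "b' \<in> B" "g \<otimes> m = m' \<otimes> b'" unfolding perm[OF max] by (auto simp: set_mult_def)
    define c where "c = b' \<otimes> inv g"
    have b'c: "b' \<in> carrier G" using subgroup.mem_carrier[OF B mb(2)] .
    have cB: "c \<in> B" unfolding c_def using mb(2) g(1) B by (simp add: subgroup.m_closed subgroup.m_inv_closed)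
    have eq: "g \<otimes> m \<otimes> inv g = m' \<otimes> c" using mb(1,3) m gc b'c by (simp add: c_def m_assoc)
    have "g \<otimes> m \<otimes> inv g \<in> Q" using normal_invE(2)[OF Q(1) gc, of m] m M(2) by auto
    hence "inv m' \<otimes> (m' \<otimes> c) \<in> Q" using eq mb(1) M(2) by auto
    hence "c \<in> Q" using mb(1) subgroup.mem_carrier[OF B cB] by (simp add: group_cancel)
    hence "c \<in> D" using triv[OF _ cB] by (simp add: D_def h_def)
    thus "g \<otimes> m \<otimes> inv g \<in> M" using eq mb(1) DM by auto
  qed
  obtain K where K: "subgroup K G" "M \<subseteq> K" "K \<subseteq> Q" "card K = q * card M" "K \<subseteq> conj_normalizer M"
    by (rule p_group_growth[OF Qs Q(2) pq(2) M])
  have "K \<noteq> M" using K(4) card_sub_pos[OF M(1)] pq(2) by (auto simp: prime_gt_1_nat)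
  hence "K = Q" using max K(1,2,3) subgroup_in_sub_iff[OF Qs, of K] by (auto simp: maximal_subgroup_def)
  hence cQ: "card Q = q * card M" and nQ: "Q \<subseteq> conj_normalizer M" using K by simp_all
  have gQ: "g \<in> conj_normalizer Q" using normal_invE(2)[OF Q(1) gc] gc by (simp add: conj_normalizer_def)
  have "\<not> Q \<subseteq> M" using M by auto
  then obtain z where z: "z \<in> Q" "z \<notin> M" by auto
  let ?P = "generate G {h}"
  have P: "subgroup ?P G" by (rule generate_is_subgroup) (simp add: hc)
  have "h [^] (p ^ b) = (g [^] (p ^ b)) [^] (q - 1)" using gc by (simp add: h_def nat_pow_pow mult.commute)
  hence "ord h dvd p ^ b" using g(2) pow_eq_id[OF hc] by simp
  then obtain d where d: "ord h = p ^ d" using pq(1) by (auto simp: divides_primepow_nat)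
  have cP: "card ?P = p ^ d" using generate_pow_card[OF hc] d by simp
  let ?E = "z <#\<^bsub>G\<^esub> M"
  have hQ: "h \<in> conj_normalizer Q" and hM: "h \<in> conj_normalizer M"
    unfolding h_def using sub_pow_closed[OF conj_normalizer_subgroup[OF Qs] gQ]
      sub_pow_closed[OF conj_normalizer_subgroup[OF M(1)] gM] by simp_all
  have fE: "finite ?E" using finite_sub[OF M(1)] by (simp add: l_coset_def)
  have Ec: "?E \<subseteq> carrier G" using z(1) by (auto simp: l_coset_def)
  have hE: "h \<otimes> e \<otimes> inv h \<in> ?E" if e: "e \<in> ?E" for e
  proof -
    obtain m where m: "m \<in> M" "e = z \<otimes> m" using e by (auto simp: l_coset_def)
    obtain y where y: "y \<in> M" "h \<otimes> z \<otimes> inv h = z \<otimes> y"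
      using power_acts_trivially_on_prime_quotient[OF Qs M(1,2) nQ pq(2) cQ gQ gM z(1)] by (auto simp: h_def)
    have "h \<otimes> e \<otimes> inv h = (z \<otimes> y) \<otimes> (h \<otimes> m \<otimes> inv h)"
      unfolding m(2) using conj_mult[of z m h] y(2) z(1) m(1) hc by simp
    also have "\<dots> = z \<otimes> (y \<otimes> (h \<otimes> m \<otimes> inv h))" using z(1) y(1) m(1) hc by (simp add: m_assoc)
    finally show ?thesis
      using y(1) conj_normalizerD(2)[OF hM m(1)] M.m_closed unfolding l_coset_def by blast
  qed
  have pow: "u \<otimes> e \<otimes> inv u \<in> ?E" if "u \<in> ?P" "e \<in> ?E" for u e
  proof -
    have "ord h \<noteq> 0" using d pq(1) by (auto simp: prime_gt_0_nat)
    from generate_pow_nat[OF hc this] that(1) obtain k :: nat where k: "u = h [^] k" by auto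
    have "h [^] k \<otimes> e \<otimes> inv (h [^] k) \<in> ?E"
    proof (induction k)
      case 0 show ?case using that(2) Ec by auto
    next
      case (Suc k)
      have ec: "e \<in> carrier G" using that(2) Ec by auto
      have "h [^] Suc k = h \<otimes> h [^] k" by (rule nat_pow_Suc2[OF hc])
      thus ?case using hE[OF Suc] conj_conj[OF ec hc nat_pow_closed[OF hc, of k]] by simp
    qed
    thus ?thesis using k by simp
  qed
  have dv: "p dvd card (?E - {e \<in> ?E. \<forall>u\<in>carrier (G\<lparr>carrier := ?P\<rparr>). u \<otimes> e \<otimes> inv u = e})"
  proof (rule p_group_fixed_points[OF subgroup_imp_group[OF P], of p d])
    show "u \<otimes> e \<otimes> inv u \<in> ?E" if "u \<in> carrier (G\<lparr>carrier := ?P\<rparr>)" "e \<in> ?E" for u e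
      using pow that by simp
    show "\<one>\<^bsub>G\<lparr>carrier := ?P\<rparr>\<^esub> \<otimes> e \<otimes> inv \<one>\<^bsub>G\<lparr>carrier := ?P\<rparr>\<^esub> = e" if "e \<in> ?E" for e
      using that Ec by auto
    show "(u \<otimes>\<^bsub>G\<lparr>carrier := ?P\<rparr>\<^esub> v) \<otimes> e \<otimes> inv (u \<otimes>\<^bsub>G\<lparr>carrier := ?P\<rparr>\<^esub> v) = u \<otimes> (v \<otimes> e \<otimes> inv v) \<otimes> inv u"
      if "u \<in> carrier (G\<lparr>carrier := ?P\<rparr>)" "v \<in> carrier (G\<lparr>carrier := ?P\<rparr>)" "e \<in> ?E" for u v e
    proof -
      have "u \<in> carrier G" "v \<in> carrier G" "e \<in> carrier G" using that subgroup.subset[OF P] Ec by auto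
      thus ?thesis using conj_conj by simp
    qed
  qed (simp_all add: cP pq(1) fE)
  have "{e \<in> ?E. \<forall>u\<in>carrier (G\<lparr>carrier := ?P\<rparr>). u \<otimes> e \<otimes> inv u = e} = {}"
  proof (rule ccontr)
    assume "\<not> ?thesis"
    then obtain e where e: "e \<in> ?E" "\<forall>u\<in>?P. u \<otimes> e \<otimes> inv u = e" by auto
    have ec: "e \<in> carrier G" using e(1) Ec by auto
    obtain m where m: "m \<in> M" "e = z \<otimes> m" using e(1) by (auto simp: l_coset_def)
    have "h \<in> ?P" by (rule generate.incl) simp
    hence "h \<otimes> e \<otimes> inv h \<otimes> h = e \<otimes> h" using e(2) by simp
    hence "h \<otimes> e = e \<otimes> h" using ec hc by (simp add: m_assoc)
    moreover have "e \<in> Q" using m z M(2) by auto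
    ultimately have "e \<in> M" using DM by (auto simp: D_def)
    hence "e \<otimes> inv m \<in> M" using m(1) by simp
    thus False using z m by (simp add: group_cancel)
  qed
  hence "p dvd card ?E" using dv by (simp only: Diff_empty)
  moreover have "card ?E = card M" by (rule card_coset) (use z(1) in auto)
  moreover have "card M dvd q ^ a" using card_sub_mono_dvd[OF M(1) Qs M(2)] Q(2) by simp
  ultimately have "p dvd q ^ a" by (metis dvd_trans)
  thus False using pq by (metis prime_dvd_power primes_dvd_imp_eq)
qed

section \<open>Nilpotent groups\<close>

lemma commutator_subgroup_normal:
  assumes H: "H \<lhd> G"
  shows "commutator_subgroup G H (carrier G) \<lhd> G"
  unfolding commutator_subgroup_def
proof (rule normal_generateI)
  have Hc: "h \<in> carrier G" if "h \<in> H" for h using subgroup.mem_carrier[OF normal_imp_subgroup[OF H] that] .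
  show "(\<Union>h\<in>H. \<Union>k\<in>carrier G. {h \<otimes> k \<otimes> inv h \<otimes> inv k}) \<subseteq> carrier G" by (intro UN_least) (simp add: Hc)
  fix c g assume c: "c \<in> (\<Union>h\<in>H. \<Union>k\<in>carrier G. {h \<otimes> k \<otimes> inv h \<otimes> inv k})" and g: "g \<in> carrier G"
  then obtain h k where hk: "h \<in> H" "k \<in> carrier G" "c = h \<otimes> k \<otimes> inv h \<otimes> inv k"
    by (elim UN_E singletonE)
  let ?h = "g \<otimes> h \<otimes> inv g" and ?k = "g \<otimes> k \<otimes> inv g"
  have "g \<otimes> c \<otimes> inv g = ?h \<otimes> ?k \<otimes> inv ?h \<otimes> inv ?k"
    unfolding hk(3) using g hk(2) Hc[OF hk(1)] by (simp add: group_cancel)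
  moreover have "?h \<in> H" using normal_invE(2)[OF H g hk(1)] .
  moreover have "?k \<in> carrier G" using g hk by simp
  ultimately show "g \<otimes> c \<otimes> inv g \<in> (\<Union>h\<in>H. \<Union>k\<in>carrier G. {h \<otimes> k \<otimes> inv h \<otimes> inv k})"
    by (intro UN_I[of ?h] UN_I[of ?k]) simp_all
qed

text \<open>
  The relation makes both \<open>C [^] m\<close> and \<open>C [^] n\<close> trivial: the first by iterating conjugation by \<open>X\<close>, the
  second because \<open>Y \<otimes> C\<close> is a conjugate of \<open>Y\<close>.
\<close>
lemma coprime_central_commutator:
  assumes X: "X \<in> carrier G" and Y: "Y \<in> carrier G" and C: "C \<in> carrier G"
    and XYC: "X \<otimes> Y \<otimes> inv X = Y \<otimes> C" and com: "C \<otimes> X = X \<otimes> C" "C \<otimes> Y = Y \<otimes> C"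
    and mn: "X [^] (m::nat) = \<one>" "Y [^] (n::nat) = \<one>" "coprime m n"
  shows "C = \<one>"
proof -
  have "C [^] m = \<one>" by (rule conj_shift_order[OF X Y C XYC com(1)[symmetric] mn(1)])
  moreover have "C [^] n = \<one>"
  proof -
    have "(Y \<otimes> C) [^] n = Y [^] n \<otimes> C [^] n" by (rule pow_mult_distrib[OF com(2)[symmetric] Y C])
    moreover have "(Y \<otimes> C) [^] n = \<one>" using conj_pow[OF Y X, of n] mn(2) X XYC by simp
    ultimately show ?thesis using mn(2) nat_pow_closed[OF C, of n] by simp
  qed
  ultimately show ?thesis by (rule coprime_order_one[OF C _ _ mn(3)])
qed

lemma coprime_central_commutator_mod:
  assumes K: "K \<lhd> G" and x: "x \<in> carrier G" and y: "y \<in> carrier G" and c: "c \<in> carrier G"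
    and xyc: "x \<otimes> y \<otimes> inv x = y \<otimes> c" and com: "\<And>z. z \<in> carrier G \<Longrightarrow> c \<otimes> z \<otimes> inv c \<otimes> inv z \<in> K"
    and mn: "x [^] (m::nat) = \<one>" "y [^] (n::nat) = \<one>" "coprime m n"
  shows "c \<in> K"
proof -
  define Z where "Z = G Mod K"
  define f where "f = (\<lambda>u. K #> u)"
  interpret Q: fin_group Z unfolding Z_def by (rule fin_group_Mod[OF K])
  interpret f: group_hom G Z f unfolding f_def Z_def by (rule Mod_hom[OF K])
  have f1: "f u = \<one>\<^bsub>Z\<^esub> \<longleftrightarrow> u \<in> K" if "u \<in> carrier G" for u
    using Mod_one_iff[OF K that] by (simp only: f_def Z_def)
  have fcom: "f c \<otimes>\<^bsub>Z\<^esub> f z = f z \<otimes>\<^bsub>Z\<^esub> f c" if z: "z \<in> carrier G" for z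
  proof -
    let ?k = "c \<otimes> z \<otimes> inv c \<otimes> inv z"
    have kc: "?k \<in> carrier G" and zc: "z \<otimes> c \<in> carrier G" using c z by simp_all
    have kz: "?k \<otimes> (z \<otimes> c) = c \<otimes> z" using c z by (simp add: m_assoc inv_mult_cancel)
    have "f (c \<otimes> z) = f ?k \<otimes>\<^bsub>Z\<^esub> f (z \<otimes> c)" using f.hom_mult[OF kc zc] unfolding kz .
    also have "f ?k = \<one>\<^bsub>Z\<^esub>" using f1[OF kc] com[OF z] by (rule iffD2)
    also have "\<one>\<^bsub>Z\<^esub> \<otimes>\<^bsub>Z\<^esub> f (z \<otimes> c) = f (z \<otimes> c)" by (rule Q.l_one[OF f.hom_closed[OF zc]])
    finally have "f (c \<otimes> z) = f (z \<otimes> c)" .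
    thus ?thesis using c z by simp
  qed
  have "f x \<otimes>\<^bsub>Z\<^esub> f y \<otimes>\<^bsub>Z\<^esub> inv\<^bsub>Z\<^esub> f x = f y \<otimes>\<^bsub>Z\<^esub> f c"
    using arg_cong[OF xyc, of f] x y c by simp
  moreover have "f x [^]\<^bsub>Z\<^esub> m = \<one>\<^bsub>Z\<^esub>" using f.hom_nat_pow[OF x, of m] mn(1) by simp
  moreover have "f y [^]\<^bsub>Z\<^esub> n = \<one>\<^bsub>Z\<^esub>" using f.hom_nat_pow[OF y, of n] mn(2) by simp
  ultimately have "f c = \<one>\<^bsub>Z\<^esub>"
    using Q.coprime_central_commutator[of "f x" "f y" "f c" m n] fcom x y c mn(3) by simp
  thus ?thesis using f1[OF c] by simp
qed

text \<open>
  The commutator \<open>c\<close> descends through the lower central series: modulo the next term it is central, and then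
  coprimality kills it.
\<close>
lemma nilpotent_coprime_commute:
  assumes nil: "nilpotent_group G" and xy: "x \<in> carrier G" "y \<in> carrier G"
    and mn: "x [^] (m::nat) = \<one>" "y [^] (n::nat) = \<one>" "coprime m n"
  shows "x \<otimes> y = y \<otimes> x"
proof -
  let ?L = "\<lambda>i. ((\<lambda>H. commutator_subgroup G H (carrier G)) ^^ i) (carrier G)"
  have L: "?L i \<lhd> G" for i by (induction i) (simp_all add: normal_self commutator_subgroup_normal)
  define c where "c = inv y \<otimes> x \<otimes> y \<otimes> inv x"
  have cc: "c \<in> carrier G" using xy by (simp add: c_def)
  have xyc: "x \<otimes> y \<otimes> inv x = y \<otimes> c" using xy by (simp add: c_def group_cancel)
  have cL: "c \<in> ?L i" for i
  proof (induction i)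
    case 0 show ?case using cc by simp
  next
    case (Suc i)
    have "c \<in> ?L (Suc i)"
    proof (rule coprime_central_commutator_mod[OF L[of "Suc i"] xy cc xyc _ mn])
      fix z assume z: "z \<in> carrier G"
      have "c \<otimes> z \<otimes> inv c \<otimes> inv z \<in> (\<Union>h\<in>?L i. \<Union>k\<in>carrier G. {h \<otimes> k \<otimes> inv h \<otimes> inv k})"
        by (intro UN_I[OF Suc] UN_I[OF z]) simp
      hence "c \<otimes> z \<otimes> inv c \<otimes> inv z \<in> commutator_subgroup G (?L i) (carrier G)"
        unfolding commutator_subgroup_def by (rule generate.incl)
      thus "c \<otimes> z \<otimes> inv c \<otimes> inv z \<in> ?L (Suc i)" by (simp only: funpow.simps o_apply)
    qed
    thus ?case .
  qed
  have "\<exists>n. ?L n = {\<one>}" using nil by (simp only: nilpotent_group_def)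
  then obtain n where n: "?L n = {\<one>}" by (rule exE)
  have "c = \<one>" using cL[of n] unfolding n by (rule singletonD)
  hence "x \<otimes> y \<otimes> inv x \<otimes> x = y \<otimes> x" using xyc xy by simp
  thus ?thesis using xy by (simp add: m_assoc)
qed

lemma set_mult_normal:
  assumes "K \<lhd> G" "L \<lhd> G" shows "K <#> L \<lhd> G"
proof (rule normal_invI)
  show "subgroup (K <#> L) G" by (rule mult_norm_subgroup[OF assms(1) normal_imp_subgroup[OF assms(2)]])
  fix x h assume x: "x \<in> carrier G" and "h \<in> K <#> L"
  then obtain k l where kl: "k \<in> K" "l \<in> L" "h = k \<otimes> l" by (auto simp: set_mult_def)
  have "x \<otimes> h \<otimes> inv x = (x \<otimes> k \<otimes> inv x) \<otimes> (x \<otimes> l \<otimes> inv x)"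
    unfolding kl(3) by (rule conj_mult[OF _ _ x])
      (use subgroup.mem_carrier[OF normal_imp_subgroup[OF assms(1)] kl(1)] subgroup.mem_carrier[OF normal_imp_subgroup[OF assms(2)] kl(2)] in simp_all)
  thus "x \<otimes> h \<otimes> inv x \<in> K <#> L"
    unfolding set_mult_def
    by (intro UN_I[OF normal_invE(2)[OF assms(1) x kl(1)]] UN_I[OF normal_invE(2)[OF assms(2) x kl(2)]]) simp
qed

lemma card_set_mult_dvd:
  assumes "subgroup H G" "subgroup K G" shows "card (H <#> K) dvd card H * card K"
  using card_set_mult[OF assms] by (metis dvd_triv_left)

text \<open>
  \<open>Q P\<close> is a \<open>p\<close>-subgroup containing the Sylow subgroup \<open>P\<close>.
\<close>
lemma normal_p_subgroup_le_sylow: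
  assumes p: "prime p" and P: "subgroup P G" "card P = p ^ multiplicity p (card (carrier G))"
    and Q: "Q \<lhd> G" "card Q = p ^ k"
  shows "Q \<subseteq> P"
proof -
  note Qs = normal_imp_subgroup[OF Q(1)]
  have S: "subgroup (Q <#> P) G" by (rule mult_norm_subgroup[OF Q(1) P(1)])
  have "card (Q <#> P) dvd p ^ (k + multiplicity p (card (carrier G)))"
    using card_set_mult_dvd[OF Qs P(1)] Q(2) P(2) by (simp add: power_add)
  then obtain i where i: "card (Q <#> P) = p ^ i" using p by (auto simp: divides_primepow_nat)
  have "p ^ i dvd card (carrier G)" using card_sub_mono_dvd[OF S subgroup_self] subgroup.subset[OF S] i by simp
  hence "i \<le> multiplicity p (card (carrier G))"
    using p card_sub_pos[OF subgroup_self] by (intro multiplicity_geI) (auto simp: prime_gt_1_nat)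
  hence "card (Q <#> P) \<le> card P" using i P(2) prime_gt_0_nat[OF p] power_increasing[of i _ p] by simp
  hence "P = Q <#> P" using card_seteq[OF finite_sub[OF S] subset_set_mult(2)[OF Qs P(1)]] by simp
  thus ?thesis using subset_set_mult(1)[OF Qs P(1)] by simp
qed

text \<open>
  For the nilpotent subgroups considered below this is the Sylow \<open>p\<close>-subgroup.  The elementwise description makes
  it evident that it is invariant under all automorphisms of \<open>N\<close>.
\<close>
definition p_part :: "nat \<Rightarrow> 'a set \<Rightarrow> 'a set" where
  "p_part p N = {x \<in> N. \<exists>k. x [^] (p ^ k :: nat) = \<one>}"

definition centralizer :: "'a set \<Rightarrow> 'a set" where
  "centralizer V = {g \<in> carrier G. \<forall>x\<in>V. g \<otimes> x = x \<otimes> g}"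

lemma centralizer_normal:
  assumes V: "V \<lhd> G" shows "centralizer V \<lhd> G"
proof (rule normal_invI)
  have Vc: "x \<in> carrier G" if "x \<in> V" for x using subgroup.mem_carrier[OF normal_imp_subgroup[OF V] that] .
  show "subgroup (centralizer V) G"
  proof (rule subgroupI)
    show "centralizer V \<subseteq> carrier G" by (auto simp: centralizer_def)
    have "\<one> \<in> centralizer V" using Vc by (simp add: centralizer_def)
    thus "centralizer V \<noteq> {}" by (metis empty_iff)
    fix g assume "g \<in> centralizer V"
    hence g: "g \<in> carrier G" "\<forall>x\<in>V. g \<otimes> x = x \<otimes> g" by (auto simp: centralizer_def)
    have "inv g \<otimes> x = x \<otimes> inv g" if x: "x \<in> V" for x
    proof -
      have "inv g \<otimes> (g \<otimes> x) \<otimes> inv g = inv g \<otimes> (x \<otimes> g) \<otimes> inv g" using g(2) x by simp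
      thus ?thesis using g(1) Vc[OF x] by (simp add: group_cancel)
    qed
    thus "inv g \<in> centralizer V" using g(1) by (simp add: centralizer_def)
    fix h assume "h \<in> centralizer V"
    hence h: "h \<in> carrier G" "\<forall>x\<in>V. h \<otimes> x = x \<otimes> h" by (auto simp: centralizer_def)
    have "(g \<otimes> h) \<otimes> x = x \<otimes> (g \<otimes> h)" if x: "x \<in> V" for x
    proof -
      have "(g \<otimes> h) \<otimes> x = g \<otimes> (x \<otimes> h)" using g(1) h x Vc[OF x] by (simp add: m_assoc)
      also have "\<dots> = (g \<otimes> x) \<otimes> h" using g(1) h(1) Vc[OF x] by (simp add: m_assoc)
      also have "\<dots> = x \<otimes> (g \<otimes> h)" using g h(1) x Vc[OF x] by (simp add: m_assoc)
      finally show ?thesis .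
    qed
    thus "g \<otimes> h \<in> centralizer V" using g(1) h(1) by (simp add: centralizer_def)
  qed
  fix x h assume x: "x \<in> carrier G" and "h \<in> centralizer V"
  hence h: "h \<in> carrier G" "\<forall>x\<in>V. h \<otimes> x = x \<otimes> h" by (auto simp: centralizer_def)
  have "(x \<otimes> h \<otimes> inv x) \<otimes> v = v \<otimes> (x \<otimes> h \<otimes> inv x)" if v: "v \<in> V" for v
  proof -
    have "inv x \<otimes> v \<otimes> inv (inv x) \<in> V" by (rule normal_invE(2)[OF V _ v]) (simp add: x)
    hence "h \<otimes> (inv x \<otimes> v \<otimes> x) = (inv x \<otimes> v \<otimes> x) \<otimes> h" using h(2) x by simp
    hence "x \<otimes> (h \<otimes> (inv x \<otimes> v \<otimes> x)) \<otimes> inv x = x \<otimes> ((inv x \<otimes> v \<otimes> x) \<otimes> h) \<otimes> inv x" by simp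
    thus ?thesis using x h(1) Vc[OF v] by (simp add: group_cancel)
  qed
  thus "x \<otimes> h \<otimes> inv x \<in> centralizer V" using x h by (simp add: centralizer_def)
qed

lemma conj_quotient_in_normal:
  assumes V: "V \<lhd> G" and g: "g \<in> carrier G" and x: "x \<in> V"
  shows "inv x \<otimes> (g \<otimes> x \<otimes> inv g) \<in> V"
  using subgroup.m_closed[OF normal_imp_subgroup[OF V] subgroup.m_inv_closed[OF normal_imp_subgroup[OF V] x] normal_invE(2)[OF V g x]] .

lemma Mod_image_normal:
  assumes K: "K \<lhd> G" and L: "L \<lhd> G" shows "(\<lambda>x. K #> x) ` L \<lhd> G Mod K"
  by (rule normal.surj_hom_normal_subgroup[OF L Mod_hom[OF K]]) (simp add: carrier_FactGroup)

lemma commute_Mod: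
  assumes K: "K \<lhd> G" and h: "h \<in> carrier G" and x: "x \<in> carrier G"
    and com: "(K #> h) \<otimes>\<^bsub>G Mod K\<^esub> (K #> x) = (K #> x) \<otimes>\<^bsub>G Mod K\<^esub> (K #> h)"
  shows "inv x \<otimes> (h \<otimes> x \<otimes> inv h) \<in> K"
proof -
  have hx: "h \<otimes> x \<in> carrier G" and xh: "x \<otimes> h \<in> carrier G" using h x by simp_all
  have e: "K #> (h \<otimes> x) = K #> (x \<otimes> h)"
    using com normal.rcos_sum[OF K h x] normal.rcos_sum[OF K x h] by simp
  have "h \<otimes> x \<in> K #> (x \<otimes> h)" using rcos_self[OF hx normal_imp_subgroup[OF K]] unfolding e .
  then obtain k where k: "k \<in> K" "h \<otimes> x = k \<otimes> (x \<otimes> h)" by (auto simp: r_coset_def)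
  have kc: "k \<in> carrier G" by (rule subgroup.mem_carrier[OF normal_imp_subgroup[OF K] k(1)])
  have "inv x \<otimes> (h \<otimes> x \<otimes> inv h) = inv x \<otimes> k \<otimes> inv (inv x)"
    unfolding k(2) using kc h x by (simp add: m_assoc)
  thus ?thesis using normal_invE(2)[OF K _ k(1), of "inv x"] x by simp
qed

text \<open>
  Products of two subgroups of this kind are again of this kind, so a maximal one is the largest.
\<close>
lemma coprime_normal_core:
  assumes A: "A \<lhd> G" and q: "prime q"
  obtains K where "K \<lhd> G" "K \<subseteq> A" "coprime q (card K)"
    "\<And>L. L \<lhd> G \<Longrightarrow> L \<subseteq> A \<Longrightarrow> coprime q (card L) \<Longrightarrow> L \<subseteq> K"
proof -
  let ?S = "{K. K \<lhd> G \<and> K \<subseteq> A \<and> coprime q (card K)}"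
  have "finite ?S"
    by (rule finite_subset[of _ "Pow A"]) (use finite_sub[OF normal_imp_subgroup[OF A]] in auto)
  moreover have "{\<one>} \<in> ?S" using one_is_normal subgroup.one_closed[OF normal_imp_subgroup[OF A]] by simp
  ultimately obtain K where K: "K \<in> ?S" "\<forall>b\<in>?S. K \<subseteq> b \<longrightarrow> K = b"
    using finite_has_maximal2[of ?S "{\<one>}"] by auto
  hence Kn: "K \<lhd> G" "K \<subseteq> A" "coprime q (card K)" by simp_all
  note Ks = normal_imp_subgroup[OF Kn(1)]
  show thesis
  proof (rule that[OF Kn])
    fix L assume L: "L \<lhd> G" "L \<subseteq> A" "coprime q (card L)"
    note Ls = normal_imp_subgroup[OF L(1)]
    have "K <#> L \<subseteq> A"
      by (rule set_mult_subset[OF normal_imp_subgroup[OF A] Kn(2) L(2)])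
    moreover have "coprime q (card K * card L)" using Kn(3) L(3) by simp
    hence "coprime q (card (K <#> L))" using card_set_mult_dvd[OF Ks Ls] by (rule coprime_divisors[OF dvd_refl _, rotated])
    ultimately have "K <#> L \<in> ?S" using set_mult_normal[OF Kn(1) L(1)] by simp
    hence "K = K <#> L" using K(2) subset_set_mult(1)[OF Ks Ls] by simp
    thus "L \<subseteq> K" using subset_set_mult(2)[OF Ks Ls] by simp
  qed
qed

end

section \<open>Sylow subgroups of a nilpotent normal subgroup with abelian quotient\<close>

text \<open>
  Nilpotency of \<open>N\<close> enters only through the commuting of elements of coprime order.
\<close>
locale nilpotent_by_abelian = fin_group +
  fixes N
  assumes normal_N: "N \<lhd> G"
    and coprime_commute_N: "\<lbrakk>x \<in> N; y \<in> N; x [^] (m::nat) = \<one>; y [^] (n::nat) = \<one>; coprime m n\<rbrakk> \<Longrightarrow> x \<otimes> y = y \<otimes> x"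
    and commutator_N: "\<lbrakk>x \<in> carrier G; y \<in> carrier G\<rbrakk> \<Longrightarrow> x \<otimes> y \<otimes> inv x \<otimes> inv y \<in> N"
begin

lemmas sub_N = normal_imp_subgroup[OF normal_N]

lemma carrier_N: "x \<in> N \<Longrightarrow> x \<in> carrier G" by (rule subgroup.mem_carrier[OF sub_N])

text \<open>
  The normalizer of a Sylow \<open>q\<close>-subgroup \<open>S\<close> contains \<open>S\<close> and, by coprime commuting, all other Sylow subgroups
  of \<open>N\<close>; so \<open>S\<close> is normal in \<open>N\<close> and contains all \<open>q\<close>-elements.
\<close>
lemma p_part_sylow:
  assumes q: "prime q"
  shows "subgroup (p_part q N) G" "\<exists>k. card (p_part q N) = q ^ k"
proof -
  let ?a = "multiplicity q (card N)"
  obtain S where S: "subgroup S G" "S \<subseteq> N" "card S = q ^ ?a" by (rule sylow_exists[OF q sub_N])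
  have nS: "subgroup (conj_normalizer S) G" by (rule conj_normalizer_subgroup[OF S(1)])
  have "N \<inter> conj_normalizer S = N"
  proof (rule eq_if_sylow_subgroups[OF subgroups_Inter_pair[OF sub_N nS] sub_N Int_lower1])
    fix r :: nat assume r: "prime r"
    show "\<exists>R. subgroup R G \<and> R \<subseteq> N \<inter> conj_normalizer S \<and> card R = r ^ multiplicity r (card N)"
    proof (cases "r = q")
      case True
      thus ?thesis using S subgroup_le_conj_normalizer[OF S(1)] by auto
    next
      case False
      obtain R where R: "subgroup R G" "R \<subseteq> N" "card R = r ^ multiplicity r (card N)" by (rule sylow_exists[OF r sub_N])
      have "R \<subseteq> conj_normalizer S"
      proof
        fix x assume x: "x \<in> R"
        have xc: "x \<in> carrier G" using subgroup.mem_carrier[OF R(1) x] .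
        have "x \<otimes> y \<otimes> inv x = y" if y: "y \<in> S" for y
        proof -
          have "x \<otimes> y = y \<otimes> x"
          proof (rule coprime_commute_N)
            show "x [^] card R = \<one>" by (rule pow_card_sub[OF R(1) x])
            show "y [^] card S = \<one>" by (rule pow_card_sub[OF S(1) y])
            show "coprime (card R) (card S)" using R(3) S(3) primes_coprime[OF r q False] by simp
          qed (use x y R S in auto)
          thus ?thesis using xc subgroup.mem_carrier[OF S(1) y] by (simp add: m_assoc)
        qed
        thus "x \<in> conj_normalizer S" using xc by (simp add: conj_normalizer_def)
      qed
      thus ?thesis using R by auto
    qed
  qed
  hence Nn: "N \<subseteq> conj_normalizer S" by auto
  let ?M = "G\<lparr>carrier := N\<rparr>"
  interpret M: fin_group ?M by (rule fin_group_sub[OF sub_N])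
  have SM: "S \<lhd> ?M" using normal_in_sub_iff[OF sub_N S(1,2)] Nn by simp
  have "card N \<noteq> 0" "\<not> is_unit q" using card_sub_pos[OF sub_N] prime_gt_1_nat[OF q] by simp_all
  then obtain m where m: "card N = q ^ ?a * m" "\<not> q dvd m"
    by (rule multiplicity_decompose')
  have "p_part q N = S"
  proof
    show "S \<subseteq> p_part q N"
    proof
      fix x assume "x \<in> S"
      thus "x \<in> p_part q N" using S pow_card_sub[OF S(1), of x] by (auto simp: p_part_def)
    qed
    show "p_part q N \<subseteq> S"
    proof
      fix x assume "x \<in> p_part q N"
      then obtain k where x: "x \<in> N" "x [^] (q ^ k :: nat) = \<one>" by (auto simp: p_part_def)
      have "x [^]\<^bsub>?M\<^esub> m \<in> S"
      proof (rule M.power_index_in_normal[OF SM])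
        show "subgroup N ?M" using M.subgroup_self by simp
        show "subgroup S ?M" using subgroup_in_sub_iff[OF sub_N] S by simp
        show "card N = card S * m" using m S by simp
      qed (use S x in auto)
      hence "x [^] m \<in> S" by (simp add: nat_pow_consistent[symmetric])
      moreover have "x [^] (q ^ k :: nat) \<in> S" using x(2) subgroup.one_closed[OF S(1)] by simp
      moreover have "coprime m (q ^ k)" using prime_imp_coprime[OF q m(2)] by (simp add: coprime_commute)
      ultimately show "x \<in> S" using pow_coprime_mem[OF S(1) carrier_N[OF x(1)]] by simp
    qed
  qed
  thus "subgroup (p_part q N) G" "\<exists>k. card (p_part q N) = q ^ k" using S by auto
qed

lemma p_part_normal: assumes q: "prime q" shows "p_part q N \<lhd> G"
proof (rule normal_invI[OF p_part_sylow(1)[OF q]])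
  fix g x assume g: "g \<in> carrier G" and "x \<in> p_part q N"
  then obtain k where x: "x \<in> N" "x [^] (q ^ k :: nat) = \<one>" by (auto simp: p_part_def)
  have "(g \<otimes> x \<otimes> inv g) [^] (q ^ k :: nat) = \<one>" using conj_pow[OF carrier_N[OF x(1)] g, of "q ^ k"] x(2) g by simp
  thus "g \<otimes> x \<otimes> inv g \<in> p_part q N" using normal_invE(2)[OF normal_N g x(1)] by (auto simp: p_part_def)
qed

lemma p_part_carrier: "x \<in> p_part q N \<Longrightarrow> x \<in> carrier G"
  using carrier_N by (simp add: p_part_def)

lemma prime_power_in_centralizer:
  assumes "prime r" "prime q" "r \<noteq> q" "x \<in> N" "x [^] (r ^ j :: nat) = \<one>"
  shows "x \<in> centralizer (p_part q N)"
proof -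
  have "x \<otimes> y = y \<otimes> x" if y': "y \<in> p_part q N" for y
  proof -
    obtain k where y: "y \<in> N" "y [^] (q ^ k :: nat) = \<one>" using y' by (auto simp: p_part_def)
    show ?thesis by (rule coprime_commute_N[OF assms(4) y(1) assms(5) y(2)]) (simp add: primes_coprime assms)
  qed
  thus ?thesis using carrier_N[OF assms(4)] by (simp add: centralizer_def)
qed

section \<open>Sylow subgroups of the two factors\<close>

text \<open>
  Coprime action along the series \<open>1 \<le> A \<inter> N_q \<le> N_q\<close>.
\<close>
lemma centralizes_if_stabilizes:
  assumes pq: "prime p" "prime q" "p \<noteq> q" and h: "h \<in> carrier G" "h [^] (p ^ k :: nat) = \<one>"
    and A: "\<And>x. x \<in> p_part q N \<Longrightarrow> inv x \<otimes> (h \<otimes> x \<otimes> inv h) \<in> A"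
    and W: "\<And>x. x \<in> p_part q N \<Longrightarrow> x \<in> A \<Longrightarrow> h \<otimes> x = x \<otimes> h"
  shows "h \<in> centralizer (p_part q N)"
proof -
  note V = p_part_normal[OF pq(2)]
  note Vs = normal_imp_subgroup[OF V]
  obtain a where a: "card (p_part q N) = q ^ a" using p_part_sylow(2)[OF pq(2)] by (rule exE)
  have "h \<otimes> x = x \<otimes> h" if x: "x \<in> p_part q N" for x
  proof -
    let ?c = "inv x \<otimes> (h \<otimes> x \<otimes> inv h)"
    have xc: "x \<in> carrier G" by (rule p_part_carrier[OF x])
    have cV: "?c \<in> p_part q N" by (rule conj_quotient_in_normal[OF V h(1) x])
    have cc: "?c \<in> carrier G" by (rule p_part_carrier[OF cV])
    have eq: "h \<otimes> x \<otimes> inv h = x \<otimes> ?c" using xc h(1) by (simp add: mult_inv_cancel)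
    have ca: "?c [^] (q ^ a) = \<one>" using pow_card_sub[OF Vs cV] a by simp
    have co: "coprime (p ^ k) (q ^ a)" using primes_coprime[OF pq] by simp
    show ?thesis by (rule coprime_action_trivial[OF h xc cc ca co eq W[OF cV A[OF x]]])
  qed
  thus ?thesis using h(1) by (simp add: centralizer_def)
qed

text \<open>
  The commutators of \<open>g\<close> with \<open>N_q\<close> lie in \<open>A\<close>, and on \<open>A \<inter> N_q\<close> the chain from \<open>P\<close> to \<open>A\<close> applies.
\<close>
lemma sylow_of_normal_factor_centralizes:
  assumes A: "A \<lhd> G" and P: "subgroup P G" "card P = p ^ c" and chain: "prime_step\<^sup>*\<^sup>* P A"
    and pq: "prime p" "prime q" "p \<noteq> q" and g: "g \<in> P" "g \<in> A"
  shows "g [^] (q - 1) \<in> centralizer (p_part q N)"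
proof (rule centralizes_if_stabilizes[OF pq, where k = c and A = A])
  note V = p_part_normal[OF pq(2)]
  have gc: "g \<in> carrier G" by (rule subgroup.mem_carrier[OF P(1) g(1)])
  thus hc: "g [^] (q - 1) \<in> carrier G" by simp
  have hP: "g [^] (q - 1) \<in> P" by (rule sub_pow_closed[OF P(1) g(1)])
  show "(g [^] (q - 1)) [^] (p ^ c) = \<one>" using pow_card_sub[OF P(1) hP] P(2) by simp
  have hA: "g [^] (q - 1) \<in> A" by (rule sub_pow_closed[OF normal_imp_subgroup[OF A] g(2)])
  fix x assume x: "x \<in> p_part q N"
  have xc: "x \<in> carrier G" by (rule p_part_carrier[OF x])
  let ?h = "g [^] (q - 1)"
  have "inv x \<otimes> ?h \<otimes> inv (inv x) \<in> A" by (rule normal_invE(2)[OF A _ hA]) (simp add: xc)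
  hence "inv x \<otimes> ?h \<otimes> inv (inv x) \<otimes> inv ?h \<in> A"
    using hA subgroup.m_closed[OF normal_imp_subgroup[OF A]] subgroup.m_inv_closed[OF normal_imp_subgroup[OF A] hA] by simp
  moreover have "inv x \<otimes> ?h \<otimes> inv (inv x) \<otimes> inv ?h = inv x \<otimes> (?h \<otimes> x \<otimes> inv ?h)"
    using xc hc by (simp add: m_assoc)
  ultimately show "inv x \<otimes> (?h \<otimes> x \<otimes> inv ?h) \<in> A" by simp
next
  fix x assume x: "x \<in> p_part q N" "x \<in> A"
  note V = p_part_normal[OF pq(2)]
  obtain a where a: "card (p_part q N) = q ^ a" using p_part_sylow(2)[OF pq(2)] by (rule exE)
  have W: "p_part q N \<inter> A \<lhd> G" by (rule normal_subgroup_intersect[OF V A])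
  have "card (p_part q N \<inter> A) dvd q ^ a"
    using card_sub_mono_dvd[OF normal_imp_subgroup[OF W] normal_imp_subgroup[OF V] Int_lower1] a by simp
  then obtain b where b: "card (p_part q N \<inter> A) = q ^ b" using pq(2) by (auto simp: divides_primepow_nat)
  show "g [^] (q - 1) \<otimes> x = x \<otimes> g [^] (q - 1)"
    by (rule sylow_chain_centralizes[OF chain P W b pq g(1)]) (simp_all add: x)
qed

text \<open>
  \<open>K Q\<close> contains \<open>N \<inter> A\<close>, because \<open>K\<close> absorbs the \<open>r\<close>-part for every \<open>r \<noteq> q\<close> and \<open>Q\<close> contains the
  \<open>q\<close>-part.  As all commutators of \<open>A\<close> with \<open>G\<close> lie in \<open>N \<inter> A\<close>, normality follows.
\<close>
lemma coprime_core_times_sylow_normal: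
  assumes A: "A \<lhd> G" and q: "prime q"
    and K: "K \<lhd> G" "K \<subseteq> A"
    and max: "\<And>L. L \<lhd> G \<Longrightarrow> L \<subseteq> A \<Longrightarrow> coprime q (card L) \<Longrightarrow> L \<subseteq> K"
    and Q: "subgroup Q G" "Q \<subseteq> A" "card Q = q ^ multiplicity q (card A)"
  shows "p_part q N \<inter> A \<subseteq> Q" "K <#> Q \<lhd> G"
proof -
  note As = normal_imp_subgroup[OF A]
  note Ks = normal_imp_subgroup[OF K(1)]
  have pA: "p_part r N \<inter> A \<lhd> G" if "prime r" for r by (rule normal_subgroup_intersect[OF p_part_normal[OF that] A])
  have cA: "\<exists>b. card (p_part r N \<inter> A) = r ^ b" if r: "prime r" for r
  proof -
    obtain a where a: "card (p_part r N) = r ^ a" using p_part_sylow(2)[OF r] by (rule exE)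
    have "card (p_part r N \<inter> A) dvd r ^ a"
      using card_sub_mono_dvd[OF normal_imp_subgroup[OF pA[OF r]] p_part_sylow(1)[OF r] Int_lower1] a by simp
    thus ?thesis using r by (auto simp: divides_primepow_nat)
  qed
  let ?M = "G\<lparr>carrier := A\<rparr>"
  interpret M: fin_group ?M by (rule fin_group_sub[OF As])
  show W: "p_part q N \<inter> A \<subseteq> Q"
  proof -
    obtain b where b: "card (p_part q N \<inter> A) = q ^ b" using cA[OF q] by (rule exE)
    have "A \<subseteq> conj_normalizer (p_part q N \<inter> A)"
    proof
      fix g assume "g \<in> A"
      hence gc: "g \<in> carrier G" by (rule subgroup.mem_carrier[OF As])
      show "g \<in> conj_normalizer (p_part q N \<inter> A)"
        unfolding conj_normalizer_def using normal_invE(2)[OF pA[OF q] gc] gc by simp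
    qed
    hence "p_part q N \<inter> A \<lhd> ?M"
      using normal_in_sub_iff[OF As normal_imp_subgroup[OF pA[OF q]] Int_lower2] by simp
    moreover have "subgroup Q ?M" using subgroup_in_sub_iff[OF As] Q by simp
    ultimately show ?thesis using M.normal_p_subgroup_le_sylow[OF q _ _ _ b] Q(3) by simp
  qed
  have R: "subgroup (K <#> Q) G" by (rule mult_norm_subgroup[OF K(1) Q(1)])
  have KR: "K \<subseteq> K <#> Q" and QR: "Q \<subseteq> K <#> Q" by (rule subset_set_mult[OF Ks Q(1)])+
  have RA: "K <#> Q \<subseteq> A" by (rule set_mult_subset[OF As K(2) Q(2)])
  have NR: "N \<inter> A \<subseteq> K <#> Q"
  proof (rule subset_if_prime_power_elements[OF R subgroups_Inter_pair[OF sub_N As]])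
    fix r :: nat and x j assume r: "prime r" and x: "x \<in> N \<inter> A" "x [^] (r ^ j :: nat) = \<one>"
    have xr: "x \<in> p_part r N \<inter> A" using x by (auto simp: p_part_def)
    show "x \<in> K <#> Q"
    proof (cases "r = q")
      case True
      thus ?thesis using xr W QR by auto
    next
      case False
      obtain b where b: "card (p_part r N \<inter> A) = r ^ b" using cA[OF r] by (rule exE)
      have "coprime q (card (p_part r N \<inter> A))" using b primes_coprime[OF q r] False by simp
      hence "p_part r N \<inter> A \<subseteq> K" by (rule max[OF pA[OF r] Int_lower2])
      thus ?thesis using xr KR by auto
    qed
  qed
  show "K <#> Q \<lhd> G"
  proof (rule normal_invI[OF R])
    fix g x assume g: "g \<in> carrier G" and x: "x \<in> K <#> Q"
    have xc: "x \<in> carrier G" by (rule subgroup.mem_carrier[OF R x])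
    have xA: "x \<in> A" using x RA by auto
    have gx: "g \<otimes> x \<otimes> inv g \<in> A" by (rule normal_invE(2)[OF A g xA])
    have "g \<otimes> x \<otimes> inv g \<otimes> inv x \<in> A"
      by (rule subgroup.m_closed[OF As gx subgroup.m_inv_closed[OF As xA]])
    hence "g \<otimes> x \<otimes> inv g \<otimes> inv x \<in> K <#> Q" using commutator_N[OF g xc] NR by auto
    from subgroup.m_closed[OF R this x] show "g \<otimes> x \<otimes> inv g \<in> K <#> Q" using g xc by (simp add: m_assoc)
  qed
qed

text \<open>
  \<open>permutable_maximal_centralizes\<close> requires the Sylow subgroup \<open>Q\<close> of \<open>A\<close> to be normal.  It becomes so modulo the
  largest normal \<open>q'\<close>-subgroup \<open>K\<close>; nothing is lost on \<open>N_q\<close>, which meets \<open>K\<close> trivially.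
\<close>
lemma permuting_sylow_centralizes_Int:
  assumes A: "A \<lhd> G" and B: "subgroup B G" and P: "subgroup P G" "card P = p ^ c" and chain: "prime_step\<^sup>*\<^sup>* P B"
    and pq: "prime p" "prime q" "p \<noteq> q" and g: "g \<in> P" "g \<in> B"
    and perm: "\<And>Q M. subgroup Q G \<Longrightarrow> Q \<subseteq> A \<Longrightarrow> card Q = q ^ multiplicity q (card A) \<Longrightarrow>
       maximal_subgroup M (G\<lparr>carrier := Q\<rparr>) \<Longrightarrow> B <#> M = M <#> B"
    and x: "x \<in> p_part q N" "x \<in> A"
  shows "g [^] (q - 1) \<otimes> x = x \<otimes> g [^] (q - 1)"
proof -
  note As = normal_imp_subgroup[OF A]
  note V = p_part_normal[OF pq(2)]
  obtain K where K: "K \<lhd> G" "K \<subseteq> A" "coprime q (card K)"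
    and max: "\<And>L. L \<lhd> G \<Longrightarrow> L \<subseteq> A \<Longrightarrow> coprime q (card L) \<Longrightarrow> L \<subseteq> K"
    using coprime_normal_core[OF A pq(2)] by metis
  note Ks = normal_imp_subgroup[OF K(1)]
  obtain Q where Q: "subgroup Q G" "Q \<subseteq> A" "card Q = q ^ multiplicity q (card A)" by (rule sylow_exists[OF pq(2) As])
  note WQ = coprime_core_times_sylow_normal(1)[OF A pq(2) K(1,2) max Q]
  note Rn = coprime_core_times_sylow_normal(2)[OF A pq(2) K(1,2) max Q]
  define f where "f = (\<lambda>x. K #> x)"
  define Z where "Z = G Mod K"
  interpret Z: fin_group Z unfolding Z_def by (rule fin_group_Mod[OF K(1)])
  interpret f: group_hom G Z f unfolding f_def Z_def by (rule Mod_hom[OF K(1)])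
  have f1: "f u = \<one>\<^bsub>Z\<^esub> \<longleftrightarrow> u \<in> K" if "u \<in> carrier G" for u
    using Mod_one_iff[OF K(1) that] by (simp only: f_def Z_def)
  have Qc: "u \<in> carrier G" if "u \<in> Q" for u by (rule subgroup.mem_carrier[OF Q(1) that])
  have fR: "f ` (K <#> Q) = f ` Q"
  proof
    show "f ` Q \<subseteq> f ` (K <#> Q)" using subset_set_mult(2)[OF Ks Q(1)] by (rule image_mono)
    show "f ` (K <#> Q) \<subseteq> f ` Q"
    proof
      fix z assume "z \<in> f ` (K <#> Q)"
      then obtain k u where ku: "k \<in> K" "u \<in> Q" "z = f (k \<otimes> u)" by (auto simp: set_mult_def)
      have kc: "k \<in> carrier G" by (rule subgroup.mem_carrier[OF Ks ku(1)])
      have "z = f k \<otimes>\<^bsub>Z\<^esub> f u" unfolding ku(3) by (rule f.hom_mult[OF kc Qc[OF ku(2)]])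
      also have "f k = \<one>\<^bsub>Z\<^esub>" using f1[OF kc] ku(1) by (rule iffD2)
      also have "\<one>\<^bsub>Z\<^esub> \<otimes>\<^bsub>Z\<^esub> f u = f u" by (rule Z.l_one[OF f.hom_closed[OF Qc[OF ku(2)]]])
      finally show "z \<in> f ` Q" using ku(2) by simp
    qed
  qed
  have Qn: "f ` Q \<lhd> Z" using Mod_image_normal[OF K(1) Rn] fR by (simp add: f_def Z_def)
  note Qns = normal_imp_subgroup[OF Qn]
  have "card (f ` Q) dvd q ^ multiplicity q (card A)"
    using card_Mod_image[OF K(1) Q(1)] Q(3) by (metis dvd_triv_left f_def)
  then obtain a where a: "card (f ` Q) = q ^ a" using pq(2) by (auto simp: divides_primepow_nat)
  have gc: "g \<in> carrier G" by (rule subgroup.mem_carrier[OF B g(2)])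
  have Bc: "b \<in> carrier G" if "b \<in> B" for b by (rule subgroup.mem_carrier[OF B that])
  have mod: "f g [^]\<^bsub>Z\<^esub> (q - 1) \<otimes>\<^bsub>Z\<^esub> z = z \<otimes>\<^bsub>Z\<^esub> f g [^]\<^bsub>Z\<^esub> (q - 1)" if z: "z \<in> f ` Q" for z
  proof (rule Z.permutable_maximal_centralizes[OF Qn a _ _ pq _ _ _ z])
    show fB: "subgroup (f ` B) Z" by (rule f.subgroup_img_is_subgroup[OF B])
    show "f g \<in> f ` B" using g(2) by simp
    have "f g [^]\<^bsub>Z\<^esub> (p ^ c) = f (g [^] (p ^ c))" using f.hom_nat_pow[OF gc] by simp
    also have "g [^] (p ^ c) = \<one>" using pow_card_sub[OF P(1) g(1)] P(2) by simp
    finally show "f g [^]\<^bsub>Z\<^esub> (p ^ c) = \<one>\<^bsub>Z\<^esub>" by simp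
    show "f g [^]\<^bsub>Z\<^esub> (q - 1) \<otimes>\<^bsub>Z\<^esub> y = y \<otimes>\<^bsub>Z\<^esub> f g [^]\<^bsub>Z\<^esub> (q - 1)" if y: "y \<in> f ` Q" "y \<in> f ` B" for y
    proof -
      obtain b where b: "b \<in> B" "y = f b" using y(2) by (rule imageE)
      show ?thesis
        unfolding b(2) f_def Z_def
        by (rule sylow_chain_centralizes_Mod[OF K(1) chain P Qn[unfolded f_def Z_def] a[unfolded f_def] pq g(1) b(1)])
          (use y(1) b(2) in \<open>simp add: f_def\<close>)
    qed
    fix M' assume M': "maximal_subgroup M' (Z\<lparr>carrier := f ` Q\<rparr>)"
    have M's: "subgroup M' Z" "M' \<subseteq> f ` Q" "M' \<noteq> f ` Q"
      and M'max: "\<And>L. subgroup L Z \<Longrightarrow> L \<subseteq> f ` Q \<Longrightarrow> M' \<subseteq> L \<Longrightarrow> L = M' \<or> L = f ` Q"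
      using M' Z.subgroup_in_sub_iff[OF Qns] by (auto simp: maximal_subgroup_def)
    \<comment> \<open>Permutability is known for maximal subgroups of \<open>Q\<close> only, so \<open>M'\<close> is pulled back to \<open>Q\<close>.\<close>
    define M where "M = {u \<in> Q. f u \<in> M'}"
    have fM: "f ` M = M'"
    proof
      show "f ` M \<subseteq> M'" by (auto simp: M_def)
      show "M' \<subseteq> f ` M"
      proof
        fix z assume z: "z \<in> M'"
        hence "z \<in> f ` Q" using M's(2) by auto
        then obtain u where "u \<in> Q" "z = f u" by (rule imageE)
        thus "z \<in> f ` M" using z by (auto simp: M_def)
      qed
    qed
    have Ms: "subgroup M G"
    proof (rule subgroupI)
      show "M \<subseteq> carrier G" using Qc by (auto simp: M_def)
      have "\<one> \<in> M" using subgroup.one_closed[OF Q(1)] subgroup.one_closed[OF M's(1)] by (simp add: M_def)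
      thus "M \<noteq> {}" by (metis empty_iff)
      fix u assume "u \<in> M"
      hence u: "u \<in> Q" "f u \<in> M'" "u \<in> carrier G" using Qc by (simp_all add: M_def)
      show "inv u \<in> M" using subgroup.m_inv_closed[OF Q(1) u(1)] subgroup.m_inv_closed[OF M's(1) u(2)] u(3) by (simp add: M_def)
      fix v assume "v \<in> M"
      hence v: "v \<in> Q" "f v \<in> M'" "v \<in> carrier G" using Qc by (simp_all add: M_def)
      show "u \<otimes> v \<in> M" using subgroup.m_closed[OF Q(1) u(1) v(1)] subgroup.m_closed[OF M's(1) u(2) v(2)] u(3) v(3) by (simp add: M_def)
    qed
    have MQ: "M \<subseteq> Q" by (auto simp: M_def)
    have "maximal_subgroup M (G\<lparr>carrier := Q\<rparr>)"
      unfolding maximal_subgroup_def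
    proof (intro conjI allI impI)
      show "subgroup M (G\<lparr>carrier := Q\<rparr>)" using subgroup_in_sub_iff[OF Q(1)] Ms MQ by simp
      show "M \<noteq> carrier (G\<lparr>carrier := Q\<rparr>)" using fM M's(3) by auto
      fix L assume "subgroup L (G\<lparr>carrier := Q\<rparr>) \<and> M \<subseteq> L"
      hence L: "subgroup L G" "L \<subseteq> Q" "M \<subseteq> L" using subgroup_in_sub_iff[OF Q(1)] by simp_all
      have "M' \<subseteq> f ` L" using L(3) fM by auto
      from M'max[OF f.subgroup_img_is_subgroup[OF L(1)] image_mono[OF L(2)] this]
      show "L = M \<or> L = carrier (G\<lparr>carrier := Q\<rparr>)"
      proof
        assume "f ` L = M'"
        hence "L \<subseteq> M" using L(2) by (auto simp: M_def)
        thus ?thesis using L(3) by simp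
      next
        assume fL: "f ` L = f ` Q"
        have "Q \<subseteq> L"
        proof
          fix u assume u: "u \<in> Q"
          hence "f u \<in> f ` L" using fL by simp
          then obtain l where l: "l \<in> L" "f u = f l" by (rule imageE)
          have lQ: "l \<in> Q" using l(1) L(2) by auto
          have luQ: "inv l \<otimes> u \<in> Q" using subgroup.m_closed[OF Q(1) subgroup.m_inv_closed[OF Q(1) lQ] u] .
          have "f (inv l \<otimes> u) = inv\<^bsub>Z\<^esub> f l \<otimes>\<^bsub>Z\<^esub> f l" using Qc[OF u] Qc[OF lQ] l(2) by simp
          hence "f (inv l \<otimes> u) = \<one>\<^bsub>Z\<^esub>" using f.hom_closed[OF Qc[OF lQ]] by (simp only: Z.l_inv)
          hence "inv l \<otimes> u \<in> M" using luQ subgroup.one_closed[OF M's(1)] by (simp only: M_def mem_Collect_eq)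
          hence "inv l \<otimes> u \<in> L" using L(3) by auto
          from subgroup.m_closed[OF L(1) l(1) this] show "u \<in> L" using Qc[OF u] Qc[OF lQ] by (simp add: mult_inv_cancel)
        qed
        thus ?thesis using L(2) by simp
      qed
    qed
    hence BM: "B <#> M = M <#> B" by (rule perm[OF Q])
    have img: "f ` (S <#> T) = f ` S <#>\<^bsub>Z\<^esub> f ` T" if "S \<subseteq> carrier G" "T \<subseteq> carrier G" for S T
      using set_mult_hom[of f G Z S T] f.homh that by simp
    show "f ` B <#>\<^bsub>Z\<^esub> M' = M' <#>\<^bsub>Z\<^esub> f ` B"
      using img[OF subgroup.subset[OF B] subgroup.subset[OF Ms]] img[OF subgroup.subset[OF Ms] subgroup.subset[OF B]] BM fM
      by simp
  qed
  let ?h = "g [^] (q - 1)"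
  have hc: "?h \<in> carrier G" using gc by simp
  have xQ: "x \<in> Q" using WQ x by auto
  have xc: "x \<in> carrier G" by (rule p_part_carrier[OF x(1)])
  have "f ?h \<otimes>\<^bsub>Z\<^esub> f x = f x \<otimes>\<^bsub>Z\<^esub> f ?h" using mod[OF imageI[OF xQ]] f.hom_nat_pow[OF gc, of "q - 1"] by simp
  from commute_Mod[OF K(1) hc xc this[unfolded f_def Z_def]]
  have "inv x \<otimes> (?h \<otimes> x \<otimes> inv ?h) \<in> K" .
  moreover have "inv x \<otimes> (?h \<otimes> x \<otimes> inv ?h) \<in> p_part q N" by (rule conj_quotient_in_normal[OF V hc x(1)])
  moreover obtain b where b: "card (p_part q N) = q ^ b" using p_part_sylow(2)[OF pq(2)] by (rule exE)
  have "coprime (card (p_part q N)) (card K)" using K(3) b by simp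
  hence "p_part q N \<inter> K = {\<one>}" by (rule coprime_card_Int_trivial[OF normal_imp_subgroup[OF V] Ks])
  ultimately have "inv x \<otimes> (?h \<otimes> x \<otimes> inv ?h) = \<one>" by auto
  hence "x \<otimes> (inv x \<otimes> (?h \<otimes> x \<otimes> inv ?h)) \<otimes> ?h = x \<otimes> \<one> \<otimes> ?h" by simp
  thus ?thesis using xc hc by (simp add: group_cancel)
qed

end

section \<open>Eigenvectors over a prime field\<close>

text \<open>
  Multiplication by a primitive root \<open>a\<close> permutes the nonzero residues, so the sum \<open>S\<close> satisfies
  \<open>a ^ i * S = S\<close> modulo \<open>q\<close>, and \<open>a ^ i\<close> is not \<open>1\<close>.
\<close>
lemma power_sum_dvd:
  assumes q: "prime (q::nat)" and i: "0 < i" "i < q - 1"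
  shows "q dvd (\<Sum>\<mu>=1..q - 1. \<mu> ^ i)"
proof -
  obtain a where a: "residue_primroot q a" using prime_primitive_root_exists[OF prime_gt_1_nat[OF q] q] by (rule exE)
  hence cop: "coprime q a" and "ord q a = q - 1" using q by (auto simp: residue_primroot_def totient_prime)
  hence ai: "\<not> [a ^ i = 1] (mod q)" using i ord_divides[of a i q] by (auto dest: dvd_imp_le)
  let ?S = "\<Sum>\<mu>=1..q - 1. \<mu> ^ i"
  have q1: "q > 1" using q by (rule prime_gt_1_nat)
  have "bij_betw (\<lambda>\<mu>. a * \<mu> mod q) {1..q - 1} {1..q - 1}"
  proof (rule bij_betw_imageI)
    show inj: "inj_on (\<lambda>\<mu>. a * \<mu> mod q) {1..q - 1}"
    proof (rule inj_onI)
      fix x y assume xy: "x \<in> {1..q - 1}" "y \<in> {1..q - 1}" "a * x mod q = a * y mod q"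
      hence "[a * x = a * y] (mod q)" by (simp add: cong_def)
      hence "[x = y] (mod q)" using cop by (simp add: cong_mult_lcancel_nat coprime_commute)
      thus "x = y" using xy q1 by (auto simp: cong_def)
    qed
    have "(\<lambda>\<mu>. a * \<mu> mod q) ` {1..q - 1} \<subseteq> {1..q - 1}"
    proof
      fix y assume "y \<in> (\<lambda>\<mu>. a * \<mu> mod q) ` {1..q - 1}"
      then obtain x where x: "x \<in> {1..q - 1}" "y = a * x mod q" by auto
      have "\<not> q dvd x" using x(1) q1 by (auto dest: dvd_imp_le)
      hence "\<not> q dvd a * x" using cop q by (metis coprime_dvd_mult_right_iff)
      hence "y \<noteq> 0" using x(2) by (simp add: mod_eq_0_iff_dvd)
      moreover have "y < q" using x(2) q1 by simp
      ultimately show "y \<in> {1..q - 1}" by simp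
    qed
    thus "(\<lambda>\<mu>. a * \<mu> mod q) ` {1..q - 1} = {1..q - 1}"
      by (rule endo_inj_surj[rotated, OF _ inj]) simp
  qed
  hence "?S = (\<Sum>\<mu>=1..q - 1. (a * \<mu> mod q) ^ i)" by (rule sum.reindex_bij_betw[symmetric])
  moreover have "[(\<Sum>\<mu>=1..q - 1. (a * \<mu> mod q) ^ i) = (\<Sum>\<mu>=1..q - 1. (a * \<mu>) ^ i)] (mod q)"
    by (intro cong_sum cong_pow) (simp add: cong_def)
  moreover have "(\<Sum>\<mu>=1..q - 1. (a * \<mu>) ^ i) = a ^ i * ?S" by (simp add: power_mult_distrib sum_distrib_left)
  ultimately have "[a ^ i * ?S = 1 * ?S] (mod q)" by (simp add: cong_sym)
  hence "\<not> coprime ?S q" using ai by (metis cong_mult_rcancel_nat)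
  thus ?thesis using prime_imp_coprime[OF q] by (metis coprime_commute)
qed

text \<open>
  The group is a vector space over the field with \<open>q\<close> elements, written multiplicatively, and the operator \<open>f\<close>
  satisfies \<open>f^(q-1) = 1\<close>.  The averages \<open>w_\<mu>\<close>, the product over \<open>i < q - 1\<close> of \<open>f^i(x)\<close> to the power \<open>\<mu>^i\<close>,
  are mapped by \<open>f\<close> to their own \<open>(1/\<mu>)\<close>-th powers.  The product of all of them is \<open>x^(q-1)\<close> by the power sums
  modulo \<open>q\<close>, so not all of them are trivial.
\<close>
lemma (in comm_group) eigenvector_exists:
  assumes f: "f \<in> hom G G" and q: "prime q" and exp: "\<And>x. x \<in> carrier G \<Longrightarrow> x [^] q = \<one>"
    and per: "\<And>x. x \<in> carrier G \<Longrightarrow> (f ^^ (q - 1)) x = x"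
    and x: "x \<in> carrier G" "x \<noteq> \<one>"
  shows "\<exists>w j. w \<in> carrier G \<and> w \<noteq> \<one> \<and> f w = w [^] (j::nat)"
proof (rule ccontr)
  assume neg: "\<not> ?thesis"
  interpret f: group_hom G G f using f by (simp add: group_hom_def group_hom_axioms_def is_group)
  have fi: "(f ^^ i) x \<in> carrier G" for i by (induction i) (use x in simp_all)
  have pow_cong: "y [^] m = y [^] n" if y: "y \<in> carrier G" and mn: "[m = n] (mod q)" for y and m n :: nat
  proof -
    have "y [^] k = y [^] (k mod q)" for k
    proof -
      have "y [^] k = y [^] (q * (k div q) + k mod q)" by simp
      also have "\<dots> = (y [^] q) [^] (k div q) \<otimes> y [^] (k mod q)"
        using y by (simp only: nat_pow_mult[symmetric] nat_pow_pow[symmetric])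
      also have "\<dots> = y [^] (k mod q)" using exp[OF y] y by simp
      finally show ?thesis .
    qed
    from this[of m] this[of n] show ?thesis using mn by (simp add: cong_def)
  qed
  define W where "W c n = finprod G (\<lambda>i. (f ^^ i) x [^] (c i :: nat)) {..<n}" for c n
  have W0: "W c 0 = \<one>" for c by (simp add: W_def)
  have WS: "W c (Suc n) = W c n \<otimes> (f ^^ n) x [^] c n" for c n
    using fi by (simp add: W_def lessThan_Suc m_comm)
  have Wc: "W c n \<in> carrier G" for c n by (simp add: W_def fi)
  have Wtriv: "W (\<lambda>i. \<mu> ^ i) (q - 1) = \<one>" if \<mu>: "\<mu> \<in> {1..q - 1}" for \<mu>
  proof -
    \<comment> \<open>Telescoping: applying \<open>f\<close> and raising to \<open>\<mu>\<close> shifts the index by one, so only the two ends differ.\<close>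
    have tel: "f (W (\<lambda>i. \<mu> ^ i) n) [^] \<mu> \<otimes> x = W (\<lambda>i. \<mu> ^ i) n \<otimes> (f ^^ n) x [^] (\<mu> ^ n)" for n
    proof (induction n)
      case 0 show ?case using x by (simp add: W0)
    next
      case (Suc n)
      let ?w = "W (\<lambda>i. \<mu> ^ i) n" let ?y = "(f ^^ n) x"
      have y: "?y \<in> carrier G" "f ?y \<in> carrier G" and w: "?w \<in> carrier G" "f ?w \<in> carrier G" using fi Wc by simp_all
      have "f (W (\<lambda>i. \<mu> ^ i) (Suc n)) [^] \<mu> \<otimes> x = (f ?w \<otimes> f ?y [^] (\<mu> ^ n)) [^] \<mu> \<otimes> x"
        using y w by (simp add: WS f.hom_nat_pow)
      also have "\<dots> = (f ?w [^] \<mu> \<otimes> x) \<otimes> f ?y [^] (\<mu> ^ Suc n)"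
        using y w x by (simp add: pow_mult_distrib m_comm nat_pow_pow m_ac mult.commute)
      also have "\<dots> = W (\<lambda>i. \<mu> ^ i) (Suc n) \<otimes> (f ^^ Suc n) x [^] (\<mu> ^ Suc n)"
        using Suc by (simp add: WS)
      finally show ?case .
    qed
    let ?w = "W (\<lambda>i. \<mu> ^ i) (q - 1)"
    have q1: "q > 1" using q by (rule prime_gt_1_nat)
    have nd: "\<not> q dvd \<mu>" using \<mu> q1 by (auto dest: dvd_imp_le)
    have "[\<mu> ^ (q - 1) = 1] (mod q)" by (rule fermat_theorem[OF q nd])
    hence "x [^] (\<mu> ^ (q - 1)) = x [^] (1::nat)" by (rule pow_cong[OF x(1)])
    hence "f ?w [^] \<mu> \<otimes> x = ?w \<otimes> x" using tel[of "q - 1"] per[OF x(1)] x(1) by simp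
    hence fw: "f ?w [^] \<mu> = ?w" using x(1) Wc by simp
    have "coprime \<mu> q" using prime_imp_coprime[OF q nd] by (simp add: coprime_commute)
    \<comment> \<open>An inverse of \<open>\<mu>\<close> turns the relation into an eigenvector equation with eigenvalue \<open>\<nu>\<close>.\<close>
    then obtain \<nu> where \<nu>: "[\<mu> * \<nu> = 1] (mod q)" using cong_solve_coprime_nat by auto
    have "f ?w = f ?w [^] (1::nat)" using Wc by simp
    also have "\<dots> = f ?w [^] (\<mu> * \<nu>)" using Wc by (intro pow_cong cong_sym[OF \<nu>]) simp
    also have "\<dots> = ?w [^] \<nu>" using Wc fw by (simp add: nat_pow_pow[symmetric])
    finally show ?thesis using neg Wc by blast
  qed
  have sum_triv: "W (\<lambda>i. \<Sum>\<mu>=1..m. \<mu> ^ i) (q - 1) = \<one>" if "m \<le> q - 1" for m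
    using that
  proof (induction m)
    case 0 show ?case using fi by (simp add: W_def)
  next
    case (Suc m)
    have "W (\<lambda>i. \<Sum>\<mu>=1..Suc m. \<mu> ^ i) (q - 1) = W (\<lambda>i. \<Sum>\<mu>=1..m. \<mu> ^ i) (q - 1) \<otimes> W (\<lambda>i. Suc m ^ i) (q - 1)"
      unfolding W_def by (subst finprod_multf[symmetric]) (use fi in \<open>auto simp: nat_pow_mult intro!: finprod_cong'\<close>)
    thus ?case using Suc Wtriv[of "Suc m"] by simp
  qed
  have "W (\<lambda>i. \<Sum>\<mu>=1..q - 1. \<mu> ^ i) n = x [^] (q - 1)" if "0 < n" "n \<le> q - 1" for n
    using that
  proof (induction n)
    case (Suc n)
    show ?case
    proof (cases "n = 0")
      case True
      thus ?thesis using x by (simp add: WS W0)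
    next
      case False
      obtain k where k: "(\<Sum>\<mu>=1..q - 1. \<mu> ^ n) = q * k" using power_sum_dvd[OF q, of n] False Suc.prems by (auto elim: dvdE)
      have "(f ^^ n) x [^] (q * k) = \<one>" using fi[of n] exp by (simp add: nat_pow_pow[symmetric])
      thus ?thesis using Suc False k Wc x by (simp add: WS)
    qed
  qed simp
  hence "x [^] (q - 1) = \<one>" using sum_triv[of "q - 1"] prime_gt_1_nat[OF q] by simp
  moreover have "x [^] q = x [^] (q - 1) \<otimes> x" using prime_gt_1_nat[OF q] by (cases q) simp_all
  ultimately show False using exp[OF x(1)] x by simp
qed

context fin_group
begin

text \<open>
  The number of fixed points of \<open>X\<close> under its own conjugation is divisible by \<open>q\<close>, so the centre is nontrivial.
\<close>
lemma central_subgroup_exponent: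
  assumes X: "subgroup X G" "card X = q ^ a" "X \<noteq> {\<one>}" and q: "prime q"
  defines "Z \<equiv> {z \<in> X. z [^] q = \<one> \<and> (\<forall>y\<in>X. z \<otimes> y = y \<otimes> z)}"
  shows "subgroup Z G" "Z \<noteq> {\<one>}"
proof -
  interpret X: subgroup X G by fact
  show Z: "subgroup Z G"
  proof (rule subgroupI)
    show "Z \<subseteq> carrier G" by (auto simp: Z_def)
    have "\<one> \<in> Z" by (simp add: Z_def)
    thus "Z \<noteq> {}" by (metis empty_iff)
    fix z assume "z \<in> Z"
    hence z: "z \<in> X" "z [^] q = \<one>" "\<And>y. y \<in> X \<Longrightarrow> z \<otimes> y = y \<otimes> z" "z \<in> carrier G" by (auto simp: Z_def)
    have "inv z \<otimes> y = y \<otimes> inv z" if y: "y \<in> X" for y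
    proof -
      have "inv z \<otimes> (z \<otimes> y) \<otimes> inv z = inv z \<otimes> (y \<otimes> z) \<otimes> inv z" using z(3)[OF y] by simp
      thus ?thesis using z(4) X.mem_carrier[OF y] by (simp add: group_cancel)
    qed
    moreover have "inv z [^] q = \<one>" using z(2,4) by (simp add: nat_pow_inv)
    ultimately show "inv z \<in> Z" using z(1) by (simp add: Z_def)
    fix y assume "y \<in> Z"
    hence y: "y \<in> X" "y [^] q = \<one>" "\<And>u. u \<in> X \<Longrightarrow> y \<otimes> u = u \<otimes> y" "y \<in> carrier G" by (auto simp: Z_def)
    have "(z \<otimes> y) \<otimes> u = u \<otimes> (z \<otimes> y)" if u: "u \<in> X" for u
    proof -
      have uc: "u \<in> carrier G" using u by simp
      have "(z \<otimes> y) \<otimes> u = z \<otimes> (u \<otimes> y)" using y(3)[OF u] z(4) y(4) uc by (simp add: m_assoc)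
      also have "\<dots> = (z \<otimes> u) \<otimes> y" using z(4) y(4) uc by (simp add: m_assoc)
      also have "\<dots> = u \<otimes> (z \<otimes> y)" using z(3)[OF u] z(4) y(4) uc by (simp add: m_assoc)
      finally show ?thesis .
    qed
    moreover have "(z \<otimes> y) [^] q = \<one>" using pow_mult_distrib[OF z(3)[OF y(1)] z(4) y(4), of q] z(2) y(2) by simp
    ultimately show "z \<otimes> y \<in> Z" using z(1) y(1) by (simp add: Z_def)
  qed
  let ?F = "{z \<in> X. \<forall>y\<in>X. y \<otimes> z \<otimes> inv y = z}"
  have "q dvd card (X - {z \<in> X. \<forall>y\<in>carrier (G\<lparr>carrier := X\<rparr>). y \<otimes> z \<otimes> inv y = z})"
  proof (rule p_group_fixed_points[OF subgroup_imp_group[OF X(1)], of q a])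
    show "(u \<otimes>\<^bsub>G\<lparr>carrier := X\<rparr>\<^esub> v) \<otimes> e \<otimes> inv (u \<otimes>\<^bsub>G\<lparr>carrier := X\<rparr>\<^esub> v) = u \<otimes> (v \<otimes> e \<otimes> inv v) \<otimes> inv u"
      if "u \<in> carrier (G\<lparr>carrier := X\<rparr>)" "v \<in> carrier (G\<lparr>carrier := X\<rparr>)" "e \<in> X" for u v e
      using that conj_conj[of e u v] by simp
  qed (simp_all add: X(2) q finite_sub[OF X(1)])
  hence d: "q dvd card (X - ?F)" by simp
  have "a \<noteq> 0"
  proof
    assume "a = 0"
    hence "card X = 1" using X(2) by simp
    then obtain u where "X = {u}" by (rule card_1_singletonE)
    thus False using X.one_closed X(3) by simp
  qed
  hence "q dvd card X" using X(2) by simp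
  moreover have FX: "?F \<subseteq> X" by (rule Collect_restrict)
  have "card X = card (X - ?F) + card ?F"
    using card_Diff_subset[OF finite_subset[OF FX finite_sub[OF X(1)]] FX] card_mono[OF finite_sub[OF X(1)] FX] by linarith
  ultimately have "q dvd card ?F" using d dvd_add_right_iff[OF d, of "card ?F"] by simp
  hence cF: "card ?F \<noteq> 1" using q by auto
  have "\<one> \<in> ?F" by simp
  have "\<exists>z\<in>?F. z \<noteq> \<one>"
  proof (rule ccontr)
    assume "\<not> ?thesis"
    hence "z = \<one>" if "z \<in> ?F" for z using that by blast
    hence "?F \<subseteq> {\<one>}" by blast
    hence "?F = {\<one>}" using \<open>\<one> \<in> ?F\<close> by (intro equalityI) simp_all
    thus False using cF by simp
  qed
  then obtain z where "z \<in> ?F" "z \<noteq> \<one>" by (rule bexE)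
  hence z: "z \<in> X" "z \<noteq> \<one>" "\<And>y. y \<in> X \<Longrightarrow> y \<otimes> z \<otimes> inv y = z" by auto
  have zc: "z \<in> carrier G" using z(1) by simp
  have "z [^] (q ^ a) \<in> {\<one>}" using pow_card_sub[OF X(1) z(1)] X(2) by simp
  then obtain i where i: "z [^] (q ^ i :: nat) \<notin> {\<one>}" "(z [^] (q ^ i :: nat)) [^] q \<in> {\<one>}"
    by (rule last_power_outside[OF zc, rotated]) (use z(2) in auto)
  have "z [^] (q ^ i) \<otimes> y = y \<otimes> z [^] (q ^ i)" if y: "y \<in> X" for y
  proof -
    have yc: "y \<in> carrier G" using y by simp
    have "y \<otimes> z [^] (q ^ i) \<otimes> inv y \<otimes> y = z [^] (q ^ i) \<otimes> y" using conj_pow[OF zc yc, of "q ^ i"] z(3)[OF y] by simp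
    thus ?thesis using yc zc by (simp add: m_assoc)
  qed
  hence "z [^] (q ^ i) \<in> Z" using i(2) sub_pow_closed[OF X(1) z(1)] by (simp add: Z_def)
  thus "Z \<noteq> {\<one>}" using i(1) by auto
qed

text \<open>
  Take a minimal \<open>P\<close>-invariant subgroup \<open>L\<close> in the central elementary abelian part of \<open>X\<close>.  Each \<open>g \<in> P\<close> has an
  eigenvector in \<open>L\<close>; since the operators commute, its eigenspace is \<open>P\<close>-invariant, hence all of \<open>L\<close>.  So \<open>P\<close>
  acts on \<open>L\<close> by power maps, and every cyclic subgroup of \<open>L\<close> is invariant.
\<close>
lemma invariant_subgroup_of_prime_order:
  assumes X: "subgroup X G" "card X = q ^ a" "X \<noteq> {\<one>}" and q: "prime q"
    and P: "subgroup P G" "P \<subseteq> conj_normalizer X"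
    and com: "\<And>g h x. g \<in> P \<Longrightarrow> h \<in> P \<Longrightarrow> x \<in> X \<Longrightarrow> (g \<otimes> h) \<otimes> x \<otimes> inv (g \<otimes> h) = (h \<otimes> g) \<otimes> x \<otimes> inv (h \<otimes> g)"
    and exp: "\<And>g x. g \<in> P \<Longrightarrow> x \<in> X \<Longrightarrow> g [^] (q - 1) \<otimes> x = x \<otimes> g [^] (q - 1)"
  obtains E where "subgroup E G" "E \<subseteq> X" "card E = q" "P \<subseteq> conj_normalizer E"
proof -
  interpret X: subgroup X G by (rule X)
  define Z where "Z = {z \<in> X. z [^] q = \<one> \<and> (\<forall>y\<in>X. z \<otimes> y = y \<otimes> z)}"
  have Z: "subgroup Z G" "Z \<noteq> {\<one>}" unfolding Z_def by (rule central_subgroup_exponent[OF X q])+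
  have ZX: "Z \<subseteq> X" by (auto simp: Z_def)
  have Pc: "g \<in> carrier G" if "g \<in> P" for g by (rule subgroup.mem_carrier[OF P(1) that])
  have PX: "g \<otimes> x \<otimes> inv g \<in> X" if "g \<in> P" "x \<in> X" for g x
    by (rule conj_normalizerD(2)) (use P(2) that in auto)
  have PZ: "P \<subseteq> conj_normalizer Z"
  proof
    fix g assume g: "g \<in> P"
    have gc: "g \<in> carrier G" by (rule Pc[OF g])
    have "g \<otimes> z \<otimes> inv g \<in> Z" if "z \<in> Z" for z
    proof -
      have z: "z \<in> X" "z [^] q = \<one>" "\<And>y. y \<in> X \<Longrightarrow> z \<otimes> y = y \<otimes> z" using that by (auto simp: Z_def)
      have zc: "z \<in> carrier G" using z(1) by simp
      have "(g \<otimes> z \<otimes> inv g) \<otimes> y = y \<otimes> (g \<otimes> z \<otimes> inv g)" if y: "y \<in> X" for y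
      proof -
        have yc: "y \<in> carrier G" using y by simp
        have "inv g \<otimes> y \<otimes> inv (inv g) \<in> X" by (rule PX[OF subgroup.m_inv_closed[OF P(1) g] y])
        hence "z \<otimes> (inv g \<otimes> y \<otimes> g) = (inv g \<otimes> y \<otimes> g) \<otimes> z" using z(3) gc by simp
        hence "g \<otimes> (z \<otimes> (inv g \<otimes> y \<otimes> g)) \<otimes> inv g = g \<otimes> ((inv g \<otimes> y \<otimes> g) \<otimes> z) \<otimes> inv g" by simp
        thus ?thesis using gc zc yc by (simp add: group_cancel)
      qed
      moreover have "(g \<otimes> z \<otimes> inv g) [^] q = \<one>" using conj_pow[OF zc gc, of q] z(2) gc by simp
      ultimately show ?thesis using PX[OF g z(1)] by (simp add: Z_def)
    qed
    thus "g \<in> conj_normalizer Z" using gc by (simp add: conj_normalizer_def)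
  qed
  let ?S = "{L. subgroup L G \<and> L \<subseteq> Z \<and> L \<noteq> {\<one>} \<and> P \<subseteq> conj_normalizer L}"
  have "finite ?S" by (rule finite_subset[of _ "Pow Z"]) (use finite_sub[OF Z(1)] in auto)
  moreover have "Z \<in> ?S" using Z PZ by simp
  ultimately obtain L where L': "L \<in> ?S" "\<forall>b\<in>?S. b \<subseteq> L \<longrightarrow> L = b"
    using finite_has_minimal2[of ?S Z] by auto
  hence L: "subgroup L G" "L \<subseteq> Z" "L \<noteq> {\<one>}" "P \<subseteq> conj_normalizer L" by simp_all
  have Lmin: "K = L" if "subgroup K G" "K \<subseteq> L" "K \<noteq> {\<one>}" "P \<subseteq> conj_normalizer K" for K
  proof -
    have "K \<in> ?S" using that L(2) by simp
    from bspec[OF L'(2) this] that(2) show ?thesis by simp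
  qed
  have Lc: "x \<in> carrier G" if "x \<in> L" for x by (rule subgroup.mem_carrier[OF L(1) that])
  have Lq: "x [^] q = \<one>" if "x \<in> L" for x using that L(2) by (auto simp: Z_def)
  have Lcom: "x \<otimes> y = y \<otimes> x" if "x \<in> L" "y \<in> L" for x y using that L(2) by (auto simp: Z_def)
  have LX: "L \<subseteq> X" using L(2) ZX by simp
  obtain v where v: "v \<in> L" "v \<noteq> \<one>" using L(3) subgroup.one_closed[OF L(1)] by auto
  let ?L = "G\<lparr>carrier := L\<rparr>"
  interpret L: group ?L by (rule subgroup_imp_group[OF L(1)])
  interpret L: comm_group ?L by (rule L.group_comm_groupI) (simp add: Lcom)
  have scalar: "\<exists>j::nat. g \<otimes> v \<otimes> inv g = v [^] j" if g: "g \<in> P" for g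
  proof -
    have gc: "g \<in> carrier G" by (rule Pc[OF g])
    let ?f = "\<lambda>x. g \<otimes> x \<otimes> inv g"
    have fL: "h \<otimes> x \<otimes> inv h \<in> L" if "h \<in> P" "x \<in> L" for h x by (rule conj_normalizerD(2)) (use L(4) that in auto)
    have "?f \<in> hom ?L ?L" using fL[OF g] conj_mult[OF Lc Lc gc] by (auto simp: hom_def)
    moreover have "x [^]\<^bsub>?L\<^esub> q = \<one>\<^bsub>?L\<^esub>" if "x \<in> carrier ?L" for x
      using Lq[of x] that by (simp add: nat_pow_consistent[symmetric])
    moreover have "(?f ^^ (q - 1)) x = x" if "x \<in> carrier ?L" for x
    proof -
      have xL: "x \<in> L" and xc: "x \<in> carrier G" using that Lc by simp_all
      have it: "(?f ^^ n) x = g [^] n \<otimes> x \<otimes> inv (g [^] n)" for n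
      proof (induction n)
        case 0 show ?case using xc by simp
      next
        case (Suc n)
        thus ?case using conj_conj[OF xc gc nat_pow_closed[OF gc, of n]] nat_pow_Suc2[OF gc, of n] by simp
      qed
      have "g [^] (q - 1) \<otimes> x = x \<otimes> g [^] (q - 1)" using exp[OF g] xL LX by auto
      thus ?thesis unfolding it using gc xc by (simp add: m_assoc)
    qed
    ultimately have "\<exists>w j. w \<in> carrier ?L \<and> w \<noteq> \<one>\<^bsub>?L\<^esub> \<and> ?f w = w [^]\<^bsub>?L\<^esub> (j::nat)"
      using v by (intro L.eigenvector_exists[OF _ q, where x = v]) simp_all
    then obtain w and j :: nat where w: "w \<in> L" "w \<noteq> \<one>" "g \<otimes> w \<otimes> inv g = w [^] j"
      by (auto simp: nat_pow_consistent[symmetric])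
    define K where "K = {x \<in> L. g \<otimes> x \<otimes> inv g = x [^] j}"
    have "K = L"
    proof (rule Lmin)
      show "subgroup K G"
      proof (rule subgroupI)
        show "K \<subseteq> carrier G" using Lc by (auto simp: K_def)
        show "K \<noteq> {}" using w(1,3) by (auto simp: K_def)
        fix x assume "x \<in> K"
        hence x: "x \<in> L" "g \<otimes> x \<otimes> inv g = x [^] j" "x \<in> carrier G" using Lc by (simp_all add: K_def)
        have "g \<otimes> inv x \<otimes> inv g = inv (g \<otimes> x \<otimes> inv g)" using gc x(3) by (simp add: group_cancel)
        also have "\<dots> = inv x [^] j" using x(2,3) by (simp add: nat_pow_inv)
        finally show "inv x \<in> K" using subgroup.m_inv_closed[OF L(1) x(1)] by (simp add: K_def)
        fix y assume "y \<in> K"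
        hence y: "y \<in> L" "g \<otimes> y \<otimes> inv g = y [^] j" "y \<in> carrier G" using Lc by (simp_all add: K_def)
        have "g \<otimes> (x \<otimes> y) \<otimes> inv g = x [^] j \<otimes> y [^] j" using conj_mult[OF x(3) y(3) gc] x(2) y(2) by simp
        also have "\<dots> = (x \<otimes> y) [^] j" using pow_mult_distrib[OF Lcom[OF x(1) y(1)] x(3) y(3)] by simp
        finally show "x \<otimes> y \<in> K" using subgroup.m_closed[OF L(1) x(1) y(1)] by (simp add: K_def)
      qed
      show "K \<subseteq> L" by (auto simp: K_def)
      show "K \<noteq> {\<one>}" using w by (auto simp: K_def)
      show "P \<subseteq> conj_normalizer K"
      proof
        fix h assume h: "h \<in> P"
        have hc: "h \<in> carrier G" by (rule Pc[OF h])
        have "h \<otimes> x \<otimes> inv h \<in> K" if "x \<in> K" for x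
        proof -
          have x: "x \<in> L" "g \<otimes> x \<otimes> inv g = x [^] j" "x \<in> carrier G" "x \<in> X" using that Lc LX by (auto simp: K_def)
          have "g \<otimes> (h \<otimes> x \<otimes> inv h) \<otimes> inv g = (g \<otimes> h) \<otimes> x \<otimes> inv (g \<otimes> h)" by (rule conj_conj[OF x(3) gc hc, symmetric])
          also have "\<dots> = (h \<otimes> g) \<otimes> x \<otimes> inv (h \<otimes> g)" by (rule com[OF g h x(4)])
          also have "\<dots> = h \<otimes> (g \<otimes> x \<otimes> inv g) \<otimes> inv h" by (rule conj_conj[OF x(3) hc gc])
          also have "\<dots> = (h \<otimes> x \<otimes> inv h) [^] j" unfolding x(2) by (rule conj_pow[OF x(3) hc])
          finally show ?thesis using fL[OF h x(1)] by (simp add: K_def)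
        qed
        thus "h \<in> conj_normalizer K" using hc by (simp add: conj_normalizer_def)
      qed
    qed
    hence "v \<in> K" using v(1) by simp
    thus ?thesis by (auto simp: K_def)
  qed
  have vc: "v \<in> carrier G" by (rule Lc[OF v(1)])
  have ordv: "ord v = q"
  proof -
    have "ord v dvd q" using pow_eq_id[OF vc] Lq[OF v(1)] by simp
    moreover have "ord v \<noteq> 1" using ord_eq_1[OF vc] v(2) by simp
    ultimately show ?thesis using q by (metis prime_nat_iff)
  qed
  let ?E = "generate G {v}"
  have E: "subgroup ?E G" by (rule generate_is_subgroup) (simp add: vc)
  have Ek: "?E = {v [^] k | k. k \<in> (UNIV :: nat set)}"
    by (rule generate_pow_nat[OF vc]) (use ordv q in auto)
  show thesis
  proof (rule that[OF E])
    show "?E \<subseteq> X"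
    proof
      fix x assume "x \<in> ?E"
      then obtain k :: nat where "x = v [^] k" using Ek by auto
      moreover have "v \<in> X" using v(1) LX by auto
      ultimately show "x \<in> X" using sub_pow_closed[OF X(1)] by simp
    qed
    show "card ?E = q" using generate_pow_card[OF vc] ordv by simp
    show "P \<subseteq> conj_normalizer ?E"
    proof
      fix g assume g: "g \<in> P"
      have gc: "g \<in> carrier G" by (rule Pc[OF g])
      obtain j :: nat where j: "g \<otimes> v \<otimes> inv g = v [^] j" using scalar[OF g] by (rule exE)
      have "g \<otimes> x \<otimes> inv g \<in> ?E" if x: "x \<in> ?E" for x
      proof -
        obtain k :: nat where k: "x = v [^] k" using x Ek by auto
        have "g \<otimes> x \<otimes> inv g = v [^] (j * k)" unfolding k using conj_pow[OF vc gc, of k] j vc by (simp add: nat_pow_pow)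
        thus ?thesis unfolding Ek by blast
      qed
      thus "g \<in> conj_normalizer ?E" using gc by (simp add: conj_normalizer_def)
    qed
  qed
qed

end

section \<open>From the factors to the product\<close>

context nilpotent_by_abelian
begin

text \<open>
  Modulo \<open>A\<close> every element of \<open>N_q\<close> is represented by an element of \<open>B\<close>, so the chain from \<open>P\<close> to \<open>B\<close> shows
  that the commutators with \<open>N_q\<close> lie in \<open>A\<close>.
\<close>
lemma permuting_sylow_centralizes:
  assumes A: "A \<lhd> G" and B: "subgroup B G" and AB: "A <#> B = carrier G"
    and P: "subgroup P G" "card P = p ^ c" and chain: "prime_step\<^sup>*\<^sup>* P B"
    and pq: "prime p" "prime q" "p \<noteq> q" and g: "g \<in> P" "g \<in> B"
    and perm: "\<And>Q M. subgroup Q G \<Longrightarrow> Q \<subseteq> A \<Longrightarrow> card Q = q ^ multiplicity q (card A) \<Longrightarrow>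
       maximal_subgroup M (G\<lparr>carrier := Q\<rparr>) \<Longrightarrow> B <#> M = M <#> B"
  shows "g [^] (q - 1) \<in> centralizer (p_part q N)"
proof (rule centralizes_if_stabilizes[OF pq, where k = c and A = A])
  note V = p_part_normal[OF pq(2)]
  have gc: "g \<in> carrier G" by (rule subgroup.mem_carrier[OF P(1) g(1)])
  thus hc: "g [^] (q - 1) \<in> carrier G" by simp
  have hP: "g [^] (q - 1) \<in> P" by (rule sub_pow_closed[OF P(1) g(1)])
  show "(g [^] (q - 1)) [^] (p ^ c) = \<one>" using pow_card_sub[OF P(1) hP] P(2) by simp
  show "g [^] (q - 1) \<otimes> x = x \<otimes> g [^] (q - 1)" if "x \<in> p_part q N" "x \<in> A" for x
    by (rule permuting_sylow_centralizes_Int[OF A B P chain pq g perm that])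
  fix x assume x: "x \<in> p_part q N"
  have xc: "x \<in> carrier G" by (rule p_part_carrier[OF x])
  obtain a where a: "card (p_part q N) = q ^ a" using p_part_sylow(2)[OF pq(2)] by (rule exE)
  have "card ((\<lambda>x. A #> x) ` p_part q N) dvd q ^ a"
    using card_Mod_image[OF A normal_imp_subgroup[OF V]] a by (metis dvd_triv_left)
  then obtain d where d: "card ((\<lambda>x. A #> x) ` p_part q N) = q ^ d" using pq(2) by (auto simp: divides_primepow_nat)
  have "x \<in> A <#> B" using xc AB by simp
  then obtain u b where ub: "u \<in> A" "b \<in> B" "x = u \<otimes> b" by (auto simp: set_mult_def)
  have bc: "b \<in> carrier G" by (rule subgroup.mem_carrier[OF B ub(2)])
  have "x \<in> A #> b" using ub by (auto simp: r_coset_def)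
  hence Axb: "A #> b = A #> x" by (rule repr_independence[OF _ bc normal_imp_subgroup[OF A]])
  have "A #> b \<in> (\<lambda>x. A #> x) ` p_part q N" unfolding Axb using x by (rule imageI)
  from sylow_chain_centralizes_Mod[OF A chain P Mod_image_normal[OF A V] d pq g(1) ub(2) this]
  have "(A #> g [^] (q - 1)) \<otimes>\<^bsub>G Mod A\<^esub> (A #> x) = (A #> x) \<otimes>\<^bsub>G Mod A\<^esub> (A #> g [^] (q - 1))"
    unfolding Axb normal.FactGroup_pow[OF A gc] .
  thus "inv x \<otimes> (g [^] (q - 1) \<otimes> x \<otimes> inv (g [^] (q - 1))) \<in> A" by (rule commute_Mod[OF A hc xc])
qed

text \<open>
  Let \<open>C\<close> be the centralizer of \<open>N_q\<close> and \<open>U = C N_q\<close>, which contains \<open>N\<close>.  The elements whose \<open>(q-1)\<close>-st power is in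
  \<open>U\<close> form a normal subgroup \<open>T\<close> with abelian quotient.  Since \<open>T\<close> contains a Sylow \<open>p\<close>-subgroup of each factor,
  \<open>A T/T\<close> and \<open>B T/T\<close> have order prime to \<open>p\<close>, so \<open>T\<close> contains \<open>g\<close>.  Hence \<open>g^(q-1)\<close> is in \<open>U\<close>, and \<open>U/C\<close> is a
  \<open>q\<close>-group.
\<close>
lemma product_centralizes:
  assumes A: "subgroup A G" and B: "subgroup B G" and AB: "A <#> B = carrier G"
    and pq: "prime p" "prime q" "p \<noteq> q"
    and PA: "subgroup PA G" "PA \<subseteq> A" "card PA = p ^ multiplicity p (card A)"
      "\<And>g. g \<in> PA \<Longrightarrow> g [^] (q - 1) \<in> centralizer (p_part q N)"
    and PB: "subgroup PB G" "PB \<subseteq> B" "card PB = p ^ multiplicity p (card B)"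
      "\<And>g. g \<in> PB \<Longrightarrow> g [^] (q - 1) \<in> centralizer (p_part q N)"
    and g: "g \<in> carrier G" "g [^] (p ^ k :: nat) = \<one>"
  shows "g [^] (q - 1) \<in> centralizer (p_part q N)"
proof -
  let ?V = "p_part q N" let ?C = "centralizer (p_part q N)"
  note V = p_part_normal[OF pq(2)]
  note Vs = normal_imp_subgroup[OF V]
  have C: "?C \<lhd> G" by (rule centralizer_normal[OF V])
  note Cs = normal_imp_subgroup[OF C]
  obtain a where a: "card ?V = q ^ a" using p_part_sylow(2)[OF pq(2)] by (rule exE)
  define U where "U = ?C <#> ?V"
  have U: "U \<lhd> G" unfolding U_def by (rule set_mult_normal[OF C V])
  note Us = normal_imp_subgroup[OF U]
  have CU: "?C \<subseteq> U" and VU: "?V \<subseteq> U" unfolding U_def by (rule subset_set_mult[OF Cs Vs])+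
  have NU: "N \<subseteq> U"
  proof (rule subset_if_prime_power_elements[OF Us sub_N])
    fix r :: nat and x j assume r: "prime r" and x: "x \<in> N" "x [^] (r ^ j :: nat) = \<one>"
    show "x \<in> U"
    proof (cases "r = q")
      case True
      hence "x \<in> ?V" using x by (auto simp: p_part_def)
      thus ?thesis using VU by auto
    next
      case False
      thus ?thesis using prime_power_in_centralizer[OF r pq(2) _ x] CU by auto
    qed
  qed
  have abel: "K #> x \<otimes> y = K #> y \<otimes> x" if K: "K \<lhd> G" "N \<subseteq> K" and x: "x \<in> carrier G" and y: "y \<in> carrier G" for K x y
  proof -
    have "x \<otimes> y \<otimes> inv x \<otimes> inv y \<in> K" using commutator_N[OF x y] K(2) by auto
    moreover have "x \<otimes> y = (x \<otimes> y \<otimes> inv x \<otimes> inv y) \<otimes> (y \<otimes> x)" using x y by (simp add: m_assoc inv_mult_cancel)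
    ultimately have "x \<otimes> y \<in> K #> y \<otimes> x" unfolding r_coset_def by (intro UN_I[of "x \<otimes> y \<otimes> inv x \<otimes> inv y"]) simp_all
    thus ?thesis using repr_independence[OF _ _ normal_imp_subgroup[OF K(1)], of "x \<otimes> y" "y \<otimes> x"] x y by simp
  qed
  have powmul: "K #> ((x \<otimes> y) [^] n) = K #> (x [^] n \<otimes> y [^] n)"
    if K: "K \<lhd> G" "N \<subseteq> K" and x: "x \<in> carrier G" and y: "y \<in> carrier G" for K x y and n :: nat
  proof -
    define Z where "Z = G Mod K"
    define f where "f = (\<lambda>u. K #> u)"
    interpret Q: fin_group Z unfolding Z_def by (rule fin_group_Mod[OF K(1)])
    interpret f: group_hom G Z f unfolding f_def Z_def by (rule Mod_hom[OF K(1)])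
    have "f x \<otimes>\<^bsub>Z\<^esub> f y = f y \<otimes>\<^bsub>Z\<^esub> f x" using abel[OF K x y] f.hom_mult[OF x y] f.hom_mult[OF y x] by (simp add: f_def)
    hence "(f x \<otimes>\<^bsub>Z\<^esub> f y) [^]\<^bsub>Z\<^esub> n = f x [^]\<^bsub>Z\<^esub> n \<otimes>\<^bsub>Z\<^esub> f y [^]\<^bsub>Z\<^esub> n"
      by (rule Q.pow_mult_distrib) (simp_all add: x y)
    moreover have "f ((x \<otimes> y) [^] n) = (f x \<otimes>\<^bsub>Z\<^esub> f y) [^]\<^bsub>Z\<^esub> n"
      using f.hom_nat_pow[of "x \<otimes> y" n] f.hom_mult[OF x y] x y by simp
    moreover have "f (x [^] n \<otimes> y [^] n) = f x [^]\<^bsub>Z\<^esub> n \<otimes>\<^bsub>Z\<^esub> f y [^]\<^bsub>Z\<^esub> n"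
      using f.hom_mult[of "x [^] n" "y [^] n"] f.hom_nat_pow[OF x, of n] f.hom_nat_pow[OF y, of n] x y by simp
    ultimately show ?thesis by (simp add: f_def)
  qed
  have coset_mem: "x \<in> K" if K: "K \<lhd> G" and x: "x \<in> carrier G" and e: "K #> x = K #> y" and y: "y \<in> K" for K x y
  proof -
    have "K #> y = K" by (rule coset_join2[OF subgroup.mem_carrier[OF normal_imp_subgroup[OF K] y] normal_imp_subgroup[OF K] y])
    thus ?thesis using rcos_self[OF x normal_imp_subgroup[OF K]] e by simp
  qed
  define T where "T = {x \<in> carrier G. x [^] (q - 1) \<in> U}"
  have TN: "N \<subseteq> T"
  proof
    fix x assume x: "x \<in> N"
    thus "x \<in> T" using carrier_N[OF x] sub_pow_closed[OF sub_N x, of "q - 1"] NU by (auto simp: T_def)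
  qed
  have Ts: "subgroup T G"
  proof (rule subgroupI)
    show "T \<subseteq> carrier G" by (auto simp: T_def)
    show "T \<noteq> {}" using TN subgroup.one_closed[OF sub_N] by auto
    fix x assume "x \<in> T"
    hence x: "x \<in> carrier G" "x [^] (q - 1) \<in> U" by (simp_all add: T_def)
    have "inv x [^] (q - 1) = inv (x [^] (q - 1))" by (rule nat_pow_inv[OF x(1)])
    thus "inv x \<in> T" using x(1) subgroup.m_inv_closed[OF Us x(2)] by (simp add: T_def)
    fix y assume "y \<in> T"
    hence y: "y \<in> carrier G" "y [^] (q - 1) \<in> U" by (simp_all add: T_def)
    have "(x \<otimes> y) [^] (q - 1) \<in> U"
      by (rule coset_mem[OF U _ powmul[OF U NU x(1) y(1)] subgroup.m_closed[OF Us x(2) y(2)]]) (simp add: x y)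
    thus "x \<otimes> y \<in> T" using x(1) y(1) by (simp add: T_def)
  qed
  have T: "T \<lhd> G"
  proof (rule normal_invI[OF Ts])
    fix u x assume u: "u \<in> carrier G" and x: "x \<in> T"
    have xc: "x \<in> carrier G" by (rule subgroup.mem_carrier[OF Ts x])
    have "u \<otimes> x \<otimes> inv u \<otimes> inv x \<in> T" using commutator_N[OF u xc] TN by auto
    from subgroup.m_closed[OF Ts this x] show "u \<otimes> x \<otimes> inv u \<in> T" using u xc by (simp add: m_assoc)
  qed
  have index: "\<exists>m. coprime m p \<and> (\<forall>x\<in>H. x [^] m \<in> T)"
    if H: "subgroup H G" and S: "subgroup S G" "S \<subseteq> H" "card S = p ^ multiplicity p (card H)"
      "\<And>g. g \<in> S \<Longrightarrow> g [^] (q - 1) \<in> ?C" for H S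
  proof -
    have "card H \<noteq> 0" "\<not> is_unit p" using card_sub_pos[OF H] prime_gt_1_nat[OF pq(1)] by simp_all
    then obtain m where m: "card H = p ^ multiplicity p (card H) * m" "\<not> p dvd m" by (rule multiplicity_decompose')
    have "S \<subseteq> T"
    proof
      fix x assume x: "x \<in> S"
      thus "x \<in> T" using subgroup.mem_carrier[OF S(1) x] S(4)[OF x] CU by (auto simp: T_def)
    qed
    hence "S \<subseteq> H \<inter> T" using S(2) by simp
    hence "x [^] m \<in> T" if "x \<in> H" for x
      by (rule power_index_in_normal[OF T H S(1) _ _ that]) (use m(1) S(3) in simp)
    thus ?thesis using prime_imp_coprime[OF pq(1) m(2)] by (auto simp: coprime_commute)
  qed
  obtain m where m: "coprime m p" "\<And>x. x \<in> A \<Longrightarrow> x [^] m \<in> T" using index[OF A PA] by auto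
  obtain n where n: "coprime n p" "\<And>x. x \<in> B \<Longrightarrow> x [^] n \<in> T" using index[OF B PB] by auto
  have "g \<in> A <#> B" using g(1) AB by simp
  then obtain u b where ub: "u \<in> A" "b \<in> B" "g = u \<otimes> b" by (auto simp: set_mult_def)
  have uc: "u \<in> carrier G" and bc: "b \<in> carrier G"
    by (rule subgroup.mem_carrier[OF A ub(1)], rule subgroup.mem_carrier[OF B ub(2)])
  have "u [^] (m * n) \<in> T" using sub_pow_closed[OF Ts m(2)[OF ub(1)], of n] uc by (simp add: nat_pow_pow)
  moreover have "b [^] (m * n) \<in> T" using sub_pow_closed[OF Ts n(2)[OF ub(2)], of m] bc by (simp add: nat_pow_pow mult.commute)
  ultimately have "u [^] (m * n) \<otimes> b [^] (m * n) \<in> T" by (rule subgroup.m_closed[OF Ts])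
  hence "g [^] (m * n) \<in> T" unfolding ub(3)
    by (intro coset_mem[OF T _ powmul[OF T TN uc bc]]) (simp_all add: uc bc)
  moreover have "g [^] (p ^ k) \<in> T" using g(2) subgroup.one_closed[OF Ts] by simp
  moreover have "coprime (m * n) (p ^ k)" using m(1) n(1) by simp
  ultimately have "g \<in> T" by (rule pow_coprime_mem[OF Ts g(1)])
  hence zU: "g [^] (q - 1) \<in> U" by (simp add: T_def)
  have zc: "g [^] (q - 1) \<in> carrier G" using g(1) by simp
  obtain s where s: "card U = card ?C * s" using card_sub_mono_dvd[OF Cs Us CU] by (rule dvdE)
  have "card ?C * (s * card (?C \<inter> ?V)) = card ?C * card ?V"
    using card_set_mult[OF Cs Vs] s by (simp add: U_def ac_simps)
  hence "s * card (?C \<inter> ?V) = card ?V" using card_sub_pos[OF Cs] by simp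
  hence "s dvd q ^ a" using a by (metis dvd_triv_left)
  then obtain e where e: "s = q ^ e" using pq(2) by (auto simp: divides_primepow_nat)
  have "(g [^] (q - 1)) [^] s \<in> ?C" by (rule power_index_in_normal[OF C Us Cs _ s zU]) (use CU in auto)
  moreover have "(g [^] (q - 1)) [^] (p ^ k) = (g [^] (p ^ k)) [^] (q - 1)" using g(1) by (simp add: nat_pow_pow mult.commute)
  hence "(g [^] (q - 1)) [^] (p ^ k) \<in> ?C" using g(2) subgroup.one_closed[OF Cs] by simp
  moreover have "coprime s (p ^ k)" unfolding e using primes_coprime[OF pq(2,1)] pq(3) by simp
  ultimately show ?thesis using pow_coprime_mem[OF Cs zc] by simp
qed

section \<open>Construction of chains with prime indices\<close>

text \<open>
  Some \<open>N_q\<close> is not contained in \<open>H\<close>, and \<open>q \<noteq> p\<close> because \<open>P\<close> contains the \<open>p\<close>-part of \<open>N\<close>.  With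
  \<open>D = H \<inter> N_q\<close> and \<open>X\<close> the normalizer of \<open>D\<close> in \<open>N_q\<close>, the section \<open>X/D\<close> has a \<open>P\<close>-invariant subgroup \<open>E/D\<close>
  of order \<open>q\<close>.  It is invariant under \<open>H = (H \<inter> N) P\<close> too: the elements of \<open>H \<inter> N\<close> of order prime to \<open>q\<close>
  centralize \<open>N_q\<close>, and its \<open>q\<close>-elements lie in \<open>D \<le> E\<close>.  So \<open>E H\<close> is a subgroup, of index \<open>q\<close> over \<open>H\<close>.
\<close>
lemma prime_step_within_product:
  assumes p: "prime p" and P: "subgroup P G" "card P = p ^ multiplicity p (card (carrier G))"
    and act: "\<And>q g. prime q \<Longrightarrow> p \<noteq> q \<Longrightarrow> g \<in> P \<Longrightarrow> g [^] (q - 1) \<in> centralizer (p_part q N)"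
    and H: "subgroup H G" "P \<subseteq> H" "H \<subseteq> N <#> P" "H \<noteq> N <#> P"
  obtains K where "prime_step H K" "K \<subseteq> N <#> P"
proof -
  have NP: "subgroup (N <#> P) G" by (rule mult_norm_subgroup[OF normal_N P(1)])
  have "\<not> N \<subseteq> H"
  proof
    assume "N \<subseteq> H"
    hence "N <#> P \<subseteq> H" by (rule set_mult_subset[OF H(1) _ H(2)])
    thus False using H(3,4) by simp
  qed
  then obtain q x j where q: "prime q" and x: "x \<in> N" "x [^] (q ^ j :: nat) = \<one>" "x \<notin> H"
    using subset_if_prime_power_elements[OF H(1) sub_N] by blast
  let ?V = "p_part q N"
  note V = p_part_normal[OF q]
  note Vs = normal_imp_subgroup[OF V]
  obtain a where a: "card ?V = q ^ a" using p_part_sylow(2)[OF q] by (rule exE)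
  have xV: "x \<in> ?V" using x by (auto simp: p_part_def)
  have pq: "p \<noteq> q"
  proof
    assume "p = q"
    hence "?V \<subseteq> P" using normal_p_subgroup_le_sylow[OF p P V] a by simp
    thus False using xV x(3) H(2) by auto
  qed
  define D where "D = H \<inter> ?V"
  have D: "subgroup D G" unfolding D_def by (rule subgroups_Inter_pair[OF H(1) Vs])
  have DV: "D \<subseteq> ?V" "D \<noteq> ?V" using xV x(3) by (auto simp: D_def)
  have HD: "H \<subseteq> conj_normalizer D"
  proof
    fix h assume h: "h \<in> H"
    have hc: "h \<in> carrier G" by (rule subgroup.mem_carrier[OF H(1) h])
    have "h \<otimes> d \<otimes> inv h \<in> D" if "d \<in> D" for d
      using that normal_invE(2)[OF V hc, of d] h subgroup.m_closed[OF H(1)] subgroup.m_inv_closed[OF H(1) h] by (simp add: D_def)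
    thus "h \<in> conj_normalizer D" using hc by (simp add: conj_normalizer_def)
  qed
  define \<Gamma> where "\<Gamma> = conj_normalizer D"
  have \<Gamma>: "subgroup \<Gamma> G" unfolding \<Gamma>_def by (rule conj_normalizer_subgroup[OF D])
  have \<Gamma>c: "u \<in> carrier G" if "u \<in> \<Gamma>" for u by (rule subgroup.mem_carrier[OF \<Gamma> that])
  have D\<Gamma>: "D \<subseteq> \<Gamma>" unfolding \<Gamma>_def by (rule subgroup_le_conj_normalizer[OF D])
  define X where "X = ?V \<inter> \<Gamma>"
  have X: "subgroup X G" unfolding X_def by (rule subgroups_Inter_pair[OF Vs \<Gamma>])
  have DX: "D \<subseteq> X" using DV(1) D\<Gamma> by (simp add: X_def)
  have "D \<noteq> X"
  proof -
    obtain K where K: "subgroup K G" "D \<subseteq> K" "K \<subseteq> ?V" "card K = q * card D" "K \<subseteq> conj_normalizer D"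
      by (rule p_group_growth[OF Vs a q D DV])
    have "K \<subseteq> X" using K(3,5) by (simp add: X_def \<Gamma>_def)
    moreover have "card K \<noteq> card D" using K(4) card_sub_pos[OF D] prime_gt_1_nat[OF q] by simp
    ultimately show ?thesis using K(2) by auto
  qed
  let ?M = "G\<lparr>carrier := \<Gamma>\<rparr>"
  interpret M: fin_group ?M by (rule fin_group_sub[OF \<Gamma>])
  have DM: "D \<lhd> ?M" using normal_in_sub_iff[OF \<Gamma> D D\<Gamma>] by (simp add: \<Gamma>_def)
  have XM: "subgroup X ?M" using subgroup_in_sub_iff[OF \<Gamma>] X by (simp add: X_def)
  have P\<Gamma>: "P \<subseteq> \<Gamma>" using H(2) HD by (simp add: \<Gamma>_def)
  have PM: "subgroup P ?M" using subgroup_in_sub_iff[OF \<Gamma>] P(1) P\<Gamma> by simp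
  define Z where "Z = ?M Mod D"
  define f where "f = (\<lambda>u. D #>\<^bsub>?M\<^esub> u)"
  interpret Z: fin_group Z unfolding Z_def by (rule M.fin_group_Mod[OF DM])
  interpret f: group_hom ?M Z f unfolding f_def Z_def by (rule M.Mod_hom[OF DM])
  have f1: "f u = \<one>\<^bsub>Z\<^esub> \<longleftrightarrow> u \<in> D" if u: "u \<in> \<Gamma>" for u
  proof -
    have "u \<in> carrier ?M" using u by simp
    thus ?thesis using M.Mod_one_iff[OF DM] by (simp only: f_def Z_def)
  qed
  have fmult: "f (u \<otimes> v) = f u \<otimes>\<^bsub>Z\<^esub> f v" if "u \<in> \<Gamma>" "v \<in> \<Gamma>" for u v using f.hom_mult[of u v] that by simp
  have finv: "f (inv u) = inv\<^bsub>Z\<^esub> f u" if "u \<in> \<Gamma>" for u using f.hom_inv[of u] that inv_in_sub[OF \<Gamma> that] by simp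
  have fcl: "f u \<in> carrier Z" if "u \<in> \<Gamma>" for u using f.hom_closed[of u] that by simp
  have fconj: "f (u \<otimes> v \<otimes> inv u) = f u \<otimes>\<^bsub>Z\<^esub> f v \<otimes>\<^bsub>Z\<^esub> inv\<^bsub>Z\<^esub> f u" if u: "u \<in> \<Gamma>" and v: "v \<in> \<Gamma>" for u v
    using fmult[OF subgroup.m_closed[OF \<Gamma> u v] subgroup.m_inv_closed[OF \<Gamma> u]] fmult[OF u v] finv[OF u] by simp
  have fpow: "f (u [^] n) = f u [^]\<^bsub>Z\<^esub> n" if "u \<in> \<Gamma>" for u and n :: nat
    using f.hom_nat_pow[of u n] that by (simp add: nat_pow_consistent[symmetric])
  have X\<Gamma>: "X \<subseteq> \<Gamma>" by (simp add: X_def)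
  have XV: "X \<subseteq> ?V" by (simp add: X_def)
  have fX: "subgroup (f ` X) Z" by (rule f.subgroup_img_is_subgroup[OF XM])
  have fP: "subgroup (f ` P) Z" by (rule f.subgroup_img_is_subgroup[OF PM])
  have cfX: "\<exists>b. card (f ` X) = q ^ b"
  proof -
    have "card (f ` X) dvd card X" using M.card_Mod_image[OF DM XM] by (metis dvd_triv_left f_def)
    also have "card X dvd q ^ a" using card_sub_mono_dvd[OF X Vs XV] a by simp
    finally show ?thesis using q by (auto simp: divides_primepow_nat)
  qed
  then obtain b where b: "card (f ` X) = q ^ b" by (rule exE)
  have fXn: "f ` X \<noteq> {\<one>\<^bsub>Z\<^esub>}"
  proof
    assume e: "f ` X = {\<one>\<^bsub>Z\<^esub>}"
    have "X \<subseteq> D"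
    proof
      fix u assume u: "u \<in> X"
      hence "f u \<in> f ` X" by (rule imageI)
      hence "f u = \<one>\<^bsub>Z\<^esub>" unfolding e by (rule singletonD)
      thus "u \<in> D" using f1[of u] u X\<Gamma> by auto
    qed
    thus False using DX \<open>D \<noteq> X\<close> by simp
  qed
  have Pc: "g \<in> carrier G" if "g \<in> P" for g by (rule subgroup.mem_carrier[OF P(1) that])
  have Vc: "v \<in> carrier G" if "v \<in> ?V" for v by (rule p_part_carrier[OF that])
  have PX: "g \<otimes> u \<otimes> inv g \<in> X" if g: "g \<in> P" and u: "u \<in> X" for g u
  proof -
    have g\<Gamma>: "g \<in> \<Gamma>" and u\<Gamma>: "u \<in> \<Gamma>" using g u P\<Gamma> X\<Gamma> by auto
    have "g \<otimes> u \<otimes> inv g \<in> \<Gamma>"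
      by (rule subgroup.m_closed[OF \<Gamma> subgroup.m_closed[OF \<Gamma> g\<Gamma> u\<Gamma>] subgroup.m_inv_closed[OF \<Gamma> g\<Gamma>]])
    moreover have "g \<otimes> u \<otimes> inv g \<in> ?V" by (rule normal_invE(2)[OF V Pc[OF g]]) (use u XV in auto)
    ultimately show ?thesis by (simp add: X_def)
  qed
  have comV: "(g \<otimes> h) \<otimes> v \<otimes> inv (g \<otimes> h) = (h \<otimes> g) \<otimes> v \<otimes> inv (h \<otimes> g)"
    if g: "g \<in> P" and h: "h \<in> P" and v: "v \<in> ?V" for g h v
  proof -
    have gc: "g \<in> carrier G" and hc: "h \<in> carrier G" and vc: "v \<in> carrier G" using Pc g h Vc v by simp_all
    let ?c = "g \<otimes> h \<otimes> inv g \<otimes> inv h"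
    have cP: "?c \<in> P" using g h P(1) by (simp add: subgroup.m_closed subgroup.m_inv_closed)
    have cc: "?c \<in> carrier G" by (rule Pc[OF cP])
    have "?c [^] (p ^ multiplicity p (card (carrier G))) = \<one>" using pow_card_sub[OF P(1) cP] P(2) by simp
    hence cen: "?c \<in> centralizer ?V" by (rule prime_power_in_centralizer[OF p q pq commutator_N[OF gc hc]])
    let ?v = "(h \<otimes> g) \<otimes> v \<otimes> inv (h \<otimes> g)"
    have hg: "h \<otimes> g \<in> carrier G" using hc gc by simp
    have v'V: "?v \<in> ?V" by (rule normal_invE(2)[OF V hg v])
    have v'c: "?v \<in> carrier G" by (rule Vc[OF v'V])
    have eq: "?c \<otimes> (h \<otimes> g) = g \<otimes> h" using gc hc by (simp add: m_assoc inv_mult_cancel)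
    have "(g \<otimes> h) \<otimes> v \<otimes> inv (g \<otimes> h) = ?c \<otimes> ?v \<otimes> inv ?c" using conj_conj[OF vc cc hg] unfolding eq .
    also have "?c \<otimes> ?v = ?v \<otimes> ?c" using cen v'V by (simp only: centralizer_def mem_Collect_eq)
    also have "?v \<otimes> ?c \<otimes> inv ?c = ?v" using v'c cc by (simp only: m_assoc r_inv inv_closed r_one)
    finally show ?thesis .
  qed
  have X\<Gamma>': "u \<in> \<Gamma>" if "u \<in> X" for u using that X\<Gamma> by auto
  have P\<Gamma>': "u \<in> \<Gamma>" if "u \<in> P" for u using that P\<Gamma> by auto
  have "\<exists>E. subgroup E Z \<and> E \<subseteq> f ` X \<and> card E = q \<and> f ` P \<subseteq> Z.conj_normalizer E"
  proof (rule Z.invariant_subgroup_of_prime_order[OF fX b fXn q fP])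
    show "f ` P \<subseteq> Z.conj_normalizer (f ` X)"
    proof
      fix y assume "y \<in> f ` P"
      then obtain g where g: "g \<in> P" "y = f g" by auto
      have "y \<otimes>\<^bsub>Z\<^esub> z \<otimes>\<^bsub>Z\<^esub> inv\<^bsub>Z\<^esub> y \<in> f ` X" if "z \<in> f ` X" for z
      proof -
        obtain u where u: "u \<in> X" "z = f u" using \<open>z \<in> f ` X\<close> by (rule imageE)
        show ?thesis unfolding u(2) g(2) using fconj[OF P\<Gamma>'[OF g(1)] X\<Gamma>'[OF u(1)], symmetric] PX[OF g(1) u(1)] by (rule image_eqI)
      qed
      moreover have "y \<in> carrier Z" using fcl[OF P\<Gamma>'[OF g(1)]] g(2) by simp
      ultimately show "y \<in> Z.conj_normalizer (f ` X)" by (simp add: Z.conj_normalizer_def)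
    qed
    show "(y \<otimes>\<^bsub>Z\<^esub> z) \<otimes>\<^bsub>Z\<^esub> w \<otimes>\<^bsub>Z\<^esub> inv\<^bsub>Z\<^esub> (y \<otimes>\<^bsub>Z\<^esub> z) = (z \<otimes>\<^bsub>Z\<^esub> y) \<otimes>\<^bsub>Z\<^esub> w \<otimes>\<^bsub>Z\<^esub> inv\<^bsub>Z\<^esub> (z \<otimes>\<^bsub>Z\<^esub> y)"
      if yz: "y \<in> f ` P" "z \<in> f ` P" and w: "w \<in> f ` X" for y z w
    proof -
      obtain g where g: "g \<in> P" "y = f g" using yz(1) by (rule imageE)
      obtain h where h: "h \<in> P" "z = f h" using yz(2) by (rule imageE)
      obtain u where u: "u \<in> X" "w = f u" using w by (rule imageE)
      have gh: "g \<otimes> h \<in> \<Gamma>" and hg: "h \<otimes> g \<in> \<Gamma>" using P\<Gamma>'[OF g(1)] P\<Gamma>'[OF h(1)] subgroup.m_closed[OF \<Gamma>] by simp_all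
      have "u \<in> ?V" using u(1) XV by auto
      hence "f ((g \<otimes> h) \<otimes> u \<otimes> inv (g \<otimes> h)) = f ((h \<otimes> g) \<otimes> u \<otimes> inv (h \<otimes> g))" by (simp only: comV[OF g(1) h(1)])
      thus ?thesis
        unfolding fconj[OF gh X\<Gamma>'[OF u(1)]] fconj[OF hg X\<Gamma>'[OF u(1)]]
          fmult[OF P\<Gamma>'[OF g(1)] P\<Gamma>'[OF h(1)]] fmult[OF P\<Gamma>'[OF h(1)] P\<Gamma>'[OF g(1)]] g(2) h(2) u(2) .
    qed
    show "y [^]\<^bsub>Z\<^esub> (q - 1) \<otimes>\<^bsub>Z\<^esub> w = w \<otimes>\<^bsub>Z\<^esub> y [^]\<^bsub>Z\<^esub> (q - 1)" if y: "y \<in> f ` P" and w: "w \<in> f ` X" for y w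
    proof -
      obtain g where g: "g \<in> P" "y = f g" using y by (rule imageE)
      obtain u where u: "u \<in> X" "w = f u" using w by (rule imageE)
      have g\<Gamma>: "g [^] (q - 1) \<in> \<Gamma>" by (rule sub_pow_closed[OF \<Gamma> P\<Gamma>'[OF g(1)]])
      have "u \<in> ?V" using u(1) XV by auto
      hence "g [^] (q - 1) \<otimes> u = u \<otimes> g [^] (q - 1)" using act[OF q pq g(1)] by (simp only: centralizer_def mem_Collect_eq)
      hence "f (g [^] (q - 1) \<otimes> u) = f (u \<otimes> g [^] (q - 1))" by simp
      thus ?thesis
        unfolding fmult[OF g\<Gamma> X\<Gamma>'[OF u(1)]] fmult[OF X\<Gamma>'[OF u(1)] g\<Gamma>] fpow[OF P\<Gamma>'[OF g(1)]] g(2) u(2) .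
    qed
  qed blast
  then obtain E' where E': "subgroup E' Z" "E' \<subseteq> f ` X" "card E' = q" "f ` P \<subseteq> Z.conj_normalizer E'" by auto
  define E where "E = \<Union>E'"
  note pb = M.Mod_pullback[OF DM E'(1)[unfolded Z_def], folded E_def]
  have E: "subgroup E G" "E \<subseteq> \<Gamma>" using pb(1) subgroup_in_sub_iff[OF \<Gamma>] by auto
  have Emem: "u \<in> E \<longleftrightarrow> f u \<in> E'" if "u \<in> \<Gamma>" for u using pb(4)[of u] that by (simp add: f_def)
  have cE: "card E = q * card D" using pb(3) E'(3) by simp
  have DE: "D \<subseteq> E" by (rule pb(2))
  have EX: "E \<subseteq> X"
  proof
    fix e assume e: "e \<in> E"
    have e\<Gamma>: "e \<in> \<Gamma>" using e E(2) by auto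
    have "f e \<in> f ` X" using Emem[OF e\<Gamma>] e E'(2) by auto
    then obtain u where u: "u \<in> X" "f e = f u" by (rule imageE)
    have u\<Gamma>: "u \<in> \<Gamma>" by (rule X\<Gamma>'[OF u(1)])
    have iu: "inv u \<in> \<Gamma>" by (rule subgroup.m_inv_closed[OF \<Gamma> u\<Gamma>])
    have "f (e \<otimes> inv u) = f u \<otimes>\<^bsub>Z\<^esub> inv\<^bsub>Z\<^esub> f u" using fmult[OF e\<Gamma> iu] finv[OF u\<Gamma>] u(2) by simp
    also have "\<dots> = \<one>\<^bsub>Z\<^esub>" by (rule Z.r_inv[OF fcl[OF u\<Gamma>]])
    finally have "e \<otimes> inv u \<in> D" using f1[OF subgroup.m_closed[OF \<Gamma> e\<Gamma> iu]] by simp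
    hence "e \<otimes> inv u \<in> X" using DX by auto
    from subgroup.m_closed[OF X this u(1)] show "e \<in> X" using \<Gamma>c[OF e\<Gamma>] \<Gamma>c[OF u\<Gamma>] by (simp add: m_assoc)
  qed
  hence EV: "E \<subseteq> ?V" using XV by auto
  have PE: "P \<subseteq> conj_normalizer E"
  proof
    fix g assume g: "g \<in> P"
    have "g \<otimes> e \<otimes> inv g \<in> E" if e: "e \<in> E" for e
    proof -
      have e\<Gamma>: "e \<in> \<Gamma>" using e E(2) by auto
      have g\<Gamma>: "g \<in> \<Gamma>" by (rule P\<Gamma>'[OF g])
      have "f g \<in> Z.conj_normalizer E'" using E'(4) g by auto
      hence "f g \<otimes>\<^bsub>Z\<^esub> f e \<otimes>\<^bsub>Z\<^esub> inv\<^bsub>Z\<^esub> f g \<in> E'" by (rule Z.conj_normalizerD(2)) (use Emem[OF e\<Gamma>] e in simp)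
      hence "f (g \<otimes> e \<otimes> inv g) \<in> E'" unfolding fconj[OF g\<Gamma> e\<Gamma>] .
      moreover have "g \<otimes> e \<otimes> inv g \<in> \<Gamma>"
        by (rule subgroup.m_closed[OF \<Gamma> subgroup.m_closed[OF \<Gamma> g\<Gamma> e\<Gamma>] subgroup.m_inv_closed[OF \<Gamma> g\<Gamma>]])
      ultimately show ?thesis using Emem by simp
    qed
    thus "g \<in> conj_normalizer E" using Pc[OF g] by (simp add: conj_normalizer_def)
  qed
  have nE: "subgroup (conj_normalizer E) G" by (rule conj_normalizer_subgroup[OF E(1)])
  have NE: "H \<inter> N \<subseteq> conj_normalizer E"
  proof (rule subset_if_prime_power_elements[OF nE subgroups_Inter_pair[OF H(1) sub_N]])
    fix r :: nat and y i assume r: "prime r" and y: "y \<in> H \<inter> N" "y [^] (r ^ i :: nat) = \<one>"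
    have yN: "y \<in> N" using y(1) by simp
    have yc: "y \<in> carrier G" by (rule carrier_N[OF yN])
    show "y \<in> conj_normalizer E"
    proof (cases "r = q")
      case True
      hence "y \<in> D" using y by (auto simp: D_def p_part_def)
      thus ?thesis using DE subgroup_le_conj_normalizer[OF E(1)] by auto
    next
      case False
      have cen: "y \<in> centralizer ?V" by (rule prime_power_in_centralizer[OF r q False yN y(2)])
      have "y \<otimes> e \<otimes> inv y \<in> E" if e: "e \<in> E" for e
      proof -
        have eV: "e \<in> ?V" using e EV by auto
        have "y \<otimes> e = e \<otimes> y" using cen eV by (simp add: centralizer_def)
        hence "y \<otimes> e \<otimes> inv y = e" using yc Vc[OF eV] by (simp add: m_assoc)
        thus ?thesis using e by simp
      qed
      thus ?thesis using yc by (simp add: conj_normalizer_def)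
    qed
  qed
  have HE: "H \<subseteq> conj_normalizer E"
  proof
    fix h assume h: "h \<in> H"
    have "h \<in> N <#> P" using h H(3) by auto
    then obtain n g where ng: "n \<in> N" "g \<in> P" "h = n \<otimes> g" by (auto simp: set_mult_def)
    have gH: "g \<in> H" using ng(2) H(2) by auto
    have "h \<otimes> inv g = n" using ng carrier_N[OF ng(1)] Pc[OF ng(2)] by (simp add: m_assoc)
    hence "n \<in> H" using subgroup.m_closed[OF H(1) h subgroup.m_inv_closed[OF H(1) gH]] by simp
    hence "n \<in> conj_normalizer E" using NE ng(1) by auto
    thus "h \<in> conj_normalizer E" unfolding ng(3) using subgroup.m_closed[OF nE] PE ng(2) by auto
  qed
  let ?L = "G\<lparr>carrier := conj_normalizer E\<rparr>"
  interpret L: fin_group ?L by (rule fin_group_sub[OF nE])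
  have "E \<lhd> ?L" using normal_in_sub_iff[OF nE E(1) subgroup_le_conj_normalizer[OF E(1)]] by simp
  moreover have "subgroup H ?L" using subgroup_in_sub_iff[OF nE] H(1) HE by simp
  ultimately have "subgroup (E <#> H) ?L" using L.mult_norm_subgroup[of E H] by simp
  hence EH: "subgroup (E <#> H) G" using subgroup_in_sub_iff[OF nE] by simp
  have "E \<inter> H = D" using EV DE by (auto simp: D_def)
  hence "card (E <#> H) * card D = q * card D * card H" using card_set_mult[OF E(1) H(1)] cE by simp
  hence "card (E <#> H) = q * card H" using card_sub_pos[OF D] by simp
  hence "prime_step H (E <#> H)"
    unfolding prime_step_def using H(1) EH q subset_set_mult(2)[OF E(1) H(1)] by auto
  moreover have "E <#> H \<subseteq> N <#> P"
  proof -
    have "E \<subseteq> N" using EV by (auto simp: p_part_def)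
    hence "E \<subseteq> N <#> P" using subset_set_mult(1)[OF sub_N P(1)] by auto
    thus ?thesis by (rule set_mult_subset[OF NP _ H(3)])
  qed
  ultimately show thesis by (rule that)
qed

lemma chain_to_product:
  assumes p: "prime p" and P: "subgroup P G" "card P = p ^ multiplicity p (card (carrier G))"
    and act: "\<And>q g. prime q \<Longrightarrow> p \<noteq> q \<Longrightarrow> g \<in> P \<Longrightarrow> g [^] (q - 1) \<in> centralizer (p_part q N)"
    and H: "subgroup H G" "P \<subseteq> H" "H \<subseteq> N <#> P"
  shows "prime_step\<^sup>*\<^sup>* H (N <#> P)"
  using H
proof (induction "card (N <#> P) - card H" arbitrary: H rule: less_induct)
  case less
  have NP: "subgroup (N <#> P) G" by (rule mult_norm_subgroup[OF normal_N P(1)])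
  show ?case
  proof (cases "H = N <#> P")
    case False
    obtain K where K: "prime_step H K" "K \<subseteq> N <#> P"
      by (rule prime_step_within_product[OF p P act less.prems False])
    then obtain r where Ks: "subgroup K G" "H \<subseteq> K" and r: "prime r" "card K = r * card H" by (auto simp: prime_step_def)
    have "card H < card K" using r card_sub_pos[OF less.prems(1)] prime_gt_1_nat[OF r(1)] by simp
    moreover have "card K \<le> card (N <#> P)" by (rule card_mono[OF finite_sub[OF NP] K(2)])
    ultimately have "prime_step\<^sup>*\<^sup>* K (N <#> P)"
      using Ks less.prems(2) K(2) by (intro less.hyps) auto
    thus ?thesis using K(1) by (rule converse_rtranclp_into_rtranclp[rotated])
  qed simp
qed

text \<open>
  Every subgroup above \<open>N\<close> is normal, so an element of prime order in the quotient gives a prime step.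
\<close>
lemma chain_above_N:
  assumes H: "subgroup H G" "N \<subseteq> H"
  shows "prime_step\<^sup>*\<^sup>* H (carrier G)"
  using H
proof (induction "card (carrier G) - card H" arbitrary: H rule: less_induct)
  case less
  note H = less.prems
  show ?case
  proof (cases "H = carrier G")
    case False
    then obtain x where x: "x \<in> carrier G" "x \<notin> H" using subgroup.subset[OF H(1)] by auto
    define n where "n = (LEAST n. 0 < n \<and> x [^] (n::nat) \<in> H)"
    have "0 < card (carrier G) \<and> x [^] card (carrier G) \<in> H"
      using pow_card_sub[OF subgroup_self x(1)] subgroup.one_closed[OF H(1)] card_sub_pos[OF subgroup_self] by simp
    hence n: "0 < n \<and> x [^] n \<in> H" unfolding n_def by (rule LeastI)
    \<comment> \<open>A prime divisor \<open>r\<close> of the order \<open>n\<close> of \<open>x\<close> modulo \<open>H\<close> leaves a power of order \<open>r\<close> modulo \<open>H\<close>.\<close>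
    have "n \<noteq> 1" using n x by (intro notI) simp
    then obtain r where r: "prime r" "r dvd n" using prime_factor_nat by blast
    obtain k where k: "n = r * k" using r(2) by (rule dvdE)
    have k0: "0 < k" using n k by (cases k) simp_all
    have kn: "k < n" using k k0 prime_gt_1_nat[OF r(1)] by simp
    let ?y = "x [^] k"
    have yH: "?y \<notin> H" using not_less_Least[of k "\<lambda>n. 0 < n \<and> x [^] (n::nat) \<in> H"] kn k0 by (simp add: n_def)
    have yr: "?y [^] r \<in> H" using n k x(1) by (simp add: nat_pow_pow mult.commute)
    have yc: "?y \<in> carrier G" using x(1) by simp
    have yn: "?y \<in> conj_normalizer H"
      unfolding conj_normalizer_def
    proof (intro CollectI conjI ballI yc)
      fix h assume h: "h \<in> H"
      have hc: "h \<in> carrier G" by (rule subgroup.mem_carrier[OF H(1) h])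
      have "?y \<otimes> h \<otimes> inv ?y \<otimes> inv h \<in> H" using commutator_N[OF yc hc] H(2) by auto
      from subgroup.m_closed[OF H(1) this h] show "?y \<otimes> h \<otimes> inv ?y \<in> H" using yc hc by (simp add: m_assoc del: nat_pow_closed)
    qed
    obtain K where K: "subgroup K G" "H \<subseteq> K" "card K = r * card H"
      by (rule prime_extension[OF H(1) yn yH r(1) yr])
    have "card H < card K" using K(3) card_sub_pos[OF H(1)] prime_gt_1_nat[OF r(1)] by simp
    moreover have "card K \<le> card (carrier G)" by (rule card_mono[OF fin subgroup.subset[OF K(1)]])
    ultimately have "prime_step\<^sup>*\<^sup>* K (carrier G)" using K(1,2) H(2) by (intro less.hyps) auto
    moreover have "prime_step H K" using K H(1) r(1) by (auto simp: prime_step_def)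
    ultimately show ?thesis by (rule converse_rtranclp_into_rtranclp[rotated])
  qed simp
qed

end

section \<open>P-subnormality and w-supersoluble groups\<close>

context fin_group
begin

lemma subgroup_index_card:
  assumes "subgroup K G" "subgroup H G" "H \<subseteq> K"
  shows "subgroup_index (G\<lparr>carrier := K\<rparr>) H * card H = card K"
proof -
  interpret K: fin_group "G\<lparr>carrier := K\<rparr>" by (rule fin_group_sub[OF assms(1)])
  have "subgroup H (G\<lparr>carrier := K\<rparr>)" using subgroup_in_sub_iff[OF assms(1)] assms by simp
  from K.lagrange[OF this] show ?thesis by (simp add: subgroup_index_def order_def)
qed

lemma P_subnormal_iff_chain:
  "P_subnormal H G \<longleftrightarrow> subgroup H G \<and> prime_step\<^sup>*\<^sup>* H (carrier G)"
proof
  assume "P_subnormal H G"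
  hence H: "subgroup H G" and "H = carrier G \<or> (\<exists>(n :: nat) C. C 0 = H \<and> C n = carrier G \<and>
         (\<forall>i\<le>n. subgroup (C i) G) \<and>
         (\<forall>i\<in>{1..n}. C (i - 1) \<subseteq> C i \<and> prime (subgroup_index (G\<lparr>carrier := C i\<rparr>) (C (i - 1)))))"
    by (simp_all add: P_subnormal_def)
  thus "subgroup H G \<and> prime_step\<^sup>*\<^sup>* H (carrier G)"
  proof (elim disjE exE conjE)
    assume "H = carrier G"
    thus ?thesis using H by simp
  next
    fix n and C :: "nat \<Rightarrow> 'a set"
    assume C: "C 0 = H" "C n = carrier G" "\<forall>i\<le>n. subgroup (C i) G"
      "\<forall>i\<in>{1..n}. C (i - 1) \<subseteq> C i \<and> prime (subgroup_index (G\<lparr>carrier := C i\<rparr>) (C (i - 1)))"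
    have "prime_step\<^sup>*\<^sup>* H (C i)" if "i \<le> n" for i
      using that
    proof (induction i)
      case 0 show ?case using C(1) by simp
    next
      case (Suc i)
      have st: "C i \<subseteq> C (Suc i)" "prime (subgroup_index (G\<lparr>carrier := C (Suc i)\<rparr>) (C i))"
        using bspec[OF C(4), of "Suc i"] Suc.prems by simp_all
      have sub: "subgroup (C i) G" "subgroup (C (Suc i)) G" using C(3) Suc.prems by simp_all
      have "prime_step (C i) (C (Suc i))"
        unfolding prime_step_def using st sub subgroup_index_card[OF sub(2,1) st(1)] by metis
      thus ?case using Suc by (auto intro: rtranclp.rtrancl_into_rtrancl)
    qed
    from this[of n] show ?thesis using H C(2) by simp
  qed
next
  assume "subgroup H G \<and> prime_step\<^sup>*\<^sup>* H (carrier G)"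
  hence H: "subgroup H G" and "prime_step\<^sup>*\<^sup>* H (carrier G)" by simp_all
  then obtain n where "(prime_step ^^ n) H (carrier G)" using rtranclp_imp_relpowp by metis
  then obtain C where C: "C 0 = H" "C n = carrier G" "\<forall>i<n. prime_step (C i) (C (Suc i))"
    by (auto simp: relpowp_fun_conv)
  have sub: "subgroup (C i) G" if "i \<le> n" for i
    using that H C by (cases i) (auto simp: prime_step_def)
  have step: "C (i - 1) \<subseteq> C i \<and> prime (subgroup_index (G\<lparr>carrier := C i\<rparr>) (C (i - 1)))" if i: "i \<in> {1..n}" for i
  proof -
    have "i - 1 < n" and Si: "Suc (i - 1) = i" using i by auto
    hence "prime_step (C (i - 1)) (C i)" using C(3)[rule_format, of "i - 1"] by (simp only: Si)
    then obtain r where s: "subgroup (C (i - 1)) G" "subgroup (C i) G" "C (i - 1) \<subseteq> C i"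
      and r: "prime r" "card (C i) = r * card (C (i - 1))" by (auto simp: prime_step_def)
    have "subgroup_index (G\<lparr>carrier := C i\<rparr>) (C (i - 1)) = r"
      using subgroup_index_card[OF s(2,1,3)] r(2) card_sub_pos[OF s(1)] by simp
    thus ?thesis using s r by simp
  qed
  show "P_subnormal H G"
    unfolding P_subnormal_def
    by (intro conjI H disjI2 exI[of _ n] exI[of _ C] C(1,2) allI impI ballI sub step)
qed

lemma prime_chain_in_sub:
  assumes A: "subgroup A G" and "(fin_group.prime_step (G\<lparr>carrier := A\<rparr>))\<^sup>*\<^sup>* H K"
  shows "prime_step\<^sup>*\<^sup>* H K"
proof -
  interpret A: fin_group "G\<lparr>carrier := A\<rparr>" by (rule fin_group_sub[OF A])
  have "prime_step H K" if "A.prime_step H K" for H K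
    using that subgroup_in_sub_iff[OF A] by (simp add: A.prime_step_def prime_step_def)
  thus ?thesis using assms(2) by (metis (no_types, lifting) mono_rtranclp)
qed

lemma w_supersoluble_sylow_chain:
  assumes A: "subgroup A G" and w: "w_supersoluble (G\<lparr>carrier := A\<rparr>)" and p: "prime p"
  obtains P where "subgroup P G" "P \<subseteq> A" "card P = p ^ multiplicity p (card A)" "prime_step\<^sup>*\<^sup>* P A"
proof -
  interpret A: fin_group "G\<lparr>carrier := A\<rparr>" by (rule fin_group_sub[OF A])
  obtain P where P: "subgroup P G" "P \<subseteq> A" "card P = p ^ multiplicity p (card A)" by (rule sylow_exists[OF p A])
  have "sylow_subgroup p P (G\<lparr>carrier := A\<rparr>)" using P subgroup_in_sub_iff[OF A] by (simp add: sylow_subgroup_def order_def)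
  hence "P_subnormal P (G\<lparr>carrier := A\<rparr>)" using w p by (simp add: w_supersoluble_def)
  hence "A.prime_step\<^sup>*\<^sup>* P A" using A.P_subnormal_iff_chain by simp
  thus thesis using that[OF P] prime_chain_in_sub[OF A] by simp
qed

lemma nilpotent_by_abelian_derived:
  assumes nil: "nilpotent_group (G\<lparr>carrier := derived G (carrier G)\<rparr>)"
  shows "nilpotent_by_abelian G (derived G (carrier G))"
proof (rule nilpotent_by_abelian.intro[OF _ nilpotent_by_abelian_axioms.intro])
  let ?N = "derived G (carrier G)"
  have N: "?N \<lhd> G" by (rule derived_self_is_normal)
  interpret N: fin_group "G\<lparr>carrier := ?N\<rparr>" by (rule fin_group_sub[OF normal_imp_subgroup[OF N]])
  show "fin_group G" by unfold_locales
  show "?N \<lhd> G" by (rule N)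
  show "x \<otimes> y = y \<otimes> x"
    if "x \<in> ?N" "y \<in> ?N" "x [^] m = \<one>" "y [^] n = \<one>" "coprime m n" for x y and m n :: nat
    using N.nilpotent_coprime_commute[OF nil, of x y m n] that by (simp add: nat_pow_consistent[symmetric])
  show "x \<otimes> y \<otimes> inv x \<otimes> inv y \<in> ?N" if "x \<in> carrier G" "y \<in> carrier G" for x y
    unfolding derived_def by (rule generate.incl) (use that in auto)
qed

end

theorem corollaryB:
  fixes G :: "('a, 'b) monoid_scheme" and A B :: "'a set"
  assumes "group G" and "finite (carrier G)"
    and "weak_normal_product G A B"
    and "w_supersoluble (G\<lparr>carrier := A\<rparr>)" and "w_supersoluble (G\<lparr>carrier := B\<rparr>)"
    and "nilpotent_group (G\<lparr>carrier := derived G (carrier G)\<rparr>)"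
  shows "w_supersoluble G"
proof -
  let ?N = "derived G (carrier G)"
  interpret fin_group G using assms(1,2) by (simp add: fin_group_def fin_group_axioms_def)
  interpret nilpotent_by_abelian G ?N by (rule nilpotent_by_abelian_derived[OF assms(6)])
  have A: "subgroup A G" "A \<lhd> G" and B: "subgroup B G" and AB: "A <#>\<^bsub>G\<^esub> B = carrier G"
    using assms(3) by (simp_all add: weak_normal_product_def)
  have perm: "B <#>\<^bsub>G\<^esub> M = M <#>\<^bsub>G\<^esub> B"
    if q: "prime q" and Q: "subgroup Q G" "Q \<subseteq> A" "card Q = q ^ multiplicity q (card A)"
      and M: "maximal_subgroup M (G\<lparr>carrier := Q\<rparr>)" for q Q M
  proof -
    have "sylow_subgroup q Q (G\<lparr>carrier := A\<rparr>)"
      using Q subgroup_in_sub_iff[OF A(1)] by (simp add: sylow_subgroup_def order_def)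
    hence "permute G B M" using assms(3) q M unfolding weak_normal_product_def by blast
    thus ?thesis by (simp add: permute_def)
  qed
  show ?thesis
    unfolding w_supersoluble_def
  proof (intro allI impI, elim conjE)
    fix p P assume p: "prime p" and "sylow_subgroup p P G"
    hence P: "subgroup P G" "card P = p ^ multiplicity p (card (carrier G))"
      by (simp_all add: sylow_subgroup_def order_def)
    obtain PA where PA: "subgroup PA G" "PA \<subseteq> A" "card PA = p ^ multiplicity p (card A)" "prime_step\<^sup>*\<^sup>* PA A"
      by (rule w_supersoluble_sylow_chain[OF A(1) assms(4) p])
    obtain PB where PB: "subgroup PB G" "PB \<subseteq> B" "card PB = p ^ multiplicity p (card B)" "prime_step\<^sup>*\<^sup>* PB B"
      by (rule w_supersoluble_sylow_chain[OF B assms(5) p])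
    have act: "g [^]\<^bsub>G\<^esub> (q - 1) \<in> centralizer (p_part q ?N)" if q: "prime q" "p \<noteq> q" and g: "g \<in> P" for q g
    proof (rule product_centralizes[OF A(1) B AB p q PA(1-3) _ PB(1-3)])
      show "h [^]\<^bsub>G\<^esub> (q - 1) \<in> centralizer (p_part q ?N)" if "h \<in> PA" for h
        by (rule sylow_of_normal_factor_centralizes[OF A(2) PA(1,3,4) p q that]) (use that PA(2) in auto)
      show "h [^]\<^bsub>G\<^esub> (q - 1) \<in> centralizer (p_part q ?N)" if "h \<in> PB" for h
        by (rule permuting_sylow_centralizes[OF A(2) B AB PB(1,3,4) p q that _ perm[OF q(1)]]) (use that PB(2) in auto)
      show "g \<in> carrier G" by (rule subgroup.mem_carrier[OF P(1) g])
      show "g [^]\<^bsub>G\<^esub> (p ^ multiplicity p (card (carrier G))) = \<one>\<^bsub>G\<^esub>" using pow_card_sub[OF P(1) g] P(2) by simp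
    qed
    have NP: "subgroup (?N <#>\<^bsub>G\<^esub> P) G" by (rule mult_norm_subgroup[OF normal_N P(1)])
    have "prime_step\<^sup>*\<^sup>* P (?N <#>\<^bsub>G\<^esub> P)"
      by (rule chain_to_product[OF p P act P(1) order_refl subset_set_mult(2)[OF sub_N P(1)]])
    also have "prime_step\<^sup>*\<^sup>* (?N <#>\<^bsub>G\<^esub> P) (carrier G)"
      by (rule chain_above_N[OF NP subset_set_mult(1)[OF sub_N P(1)]])
    finally show "P_subnormal P G" using P(1) P_subnormal_iff_chain by simp
  qed
qed

end
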